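(* Assume the setting and hypotheses below, and let $c^*>0$ be the spreading speed of the yearly map $Q$. Consider $$\partial_tu=D_M(t)\partial_{xx}u-d_M(t)u+R\big(t,u(t-\tau(t),\cdot)\big)(x),\quad t>0,\ x\in\mathbb{R},$$ whose solutions are determined by $u(0,\cdot)$, and let $\bar u(t)$ be its solution with $u(0,\cdot)\equiv u^*$ (a $T$-periodic, spatially constant solution). Then: (i) for $c\in(0,c^*/T)$, this equation has no $T$-time periodic traveling wave $U(t,x-ct)$ connecting $\bar u(t)$ to $0$; (ii) for $c\ge c^*/T$, it has a $T$-time periodic traveling wave $U(t,x-ct)$ connecting $\bar u(t)$ to $0$; moreover $U(t,\xi)$ is left continuous and nonincreasing in $\xi\in\mathbb{R}$.
   Context: Setting. $T>0$; $D_M,D_I\ge0$, $d_M,d_I>0$, $\tau>0$, $p\ge0$ are $C^1$ $T$-periodic; $h\in C^1([0,\infty);[0,\infty))$; $0<\alpha\le\beta<t_\alpha\le t_\beta<T$ with $t_\alpha-\tau(t_\alpha)=\alpha$, $t_\beta-\tau(t_\beta)=\beta$, $p=0$ on $[0,\alpha]\cup[\beta,T]$; $\tau'<1$; $h(0)=0$, $h(z)\to0$ as $z\to\infty$, $h$ increasing on $[0,z^* )$, decreasing on $[z^*,\infty)$; $h(\lambda z)\ge\lambda h(z)$ for $\lambda\in(0,1)$; $L>1$; $h$ nondecreasing on $[0,u^*]$. Notation. $k_M(t,s,x)$, $k_I(t,s,x)$ are the Green functions of $\partial_t\rho=D_M(t)\rho_{xx}-d_M(t)\rho$, resp. $D_I,d_I$: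 $k(t,s,x)=(4\pi\int_s^tD)^{-1/2}\exp(-x^2/(4\int_s^tD)-\int_s^td)$. $R(t,\phi)(x)=(1-\tau'(t))\int k_I(t,t-\tau(t),x-y)p(t-\tau(t))h(\phi(y))dy$; $R(t,\cdot)\equiv0$ for $t\notin[t_\alpha,t_\beta]+T\mathbb{Z}$. $Q[\varphi]=k_M(T,0,\cdot)*\varphi+\int_{t_\alpha}^{t_\beta}k_M(T,s,\cdot)*R(s,k_M(s-\tau(s),0,\cdot)*\varphi)ds$ is the time-$T$ solution map of the equation; $\overline{k}_M(t,s)=e^{-\int_s^td_M}$; $\partial_\varphi R(s,0)=(1-\tau'(s))e^{-\int_{s-\tau(s)}^sd_I}p(s-\tau(s))h'(0)$; $L=\frac{\overline{k}_M(T,0)}{1-\overline{k}_M(T,0)}\int_{t_\alpha}^{t_\beta}\frac{\partial_\varphi R(s,0)}{\overline{k}_M(s,s-\tau(s))}ds$; $u^*$ is the minimal positive fixed point of $Q$ restricted to constants; $c^*=\inf_{\mu>0}\frac1\mu\ln\int e^{\mu y}\mathcal{K}(y)dy$ with $\mathcal{K}=k_M(T,0,\cdot)+\int_{t_\alpha}^{t_\beta}\partial_\varphi R(s,0)k_M(T,s,\cdot)*k_I(s,s-\tau(s),\cdot)*k_M(s-\tau(s),0,\cdot)ds$. A $T$-time periodic traveling wave connecting $\bar u(t)$ to $0$ with speed $c$ is a solution $u(t,x)=U(t,x-ct)$ with $U(t+T,\xi)=U(t,\xi)$, $U(t,-\infty)=\bar u(t)$ and $U(t,+\infty)=0$.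
   Formalization: c* uses the kernel of the true linearisation of Q: the factor e^{-∫d_I}, which the stated kernel counts twice (in ∂_φR(s,0) and in k_I), is counted once; solutions are mild (bounded, nonnegative, measurable), and the Green function is a Dirac mass where ∫D=0. *)

theory Defs
  imports "HOL-Analysis.Analysis"
begin

(* Green function k(t,s,x) of  rho_t = D(t) rho_xx - d(t) rho  (for  int_s^t D > 0) *)
definition green :: "(real \<Rightarrow> real) \<Rightarrow> (real \<Rightarrow> real) \<Rightarrow> real \<Rightarrow> real \<Rightarrow> real \<Rightarrow> real" where
  "green D d t s x =
     exp (- (x^2) / (4 * integral {s..t} D) - integral {s..t} d) / sqrt (4 * pi * integral {s..t} D)"

(* convolution with the Green function:  (k(t,s,.) * phi)(x).
   If int_s^t D = 0 (i.e. D vanishes on [s,t]) the Green function is the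
   Dirac mass exp(-int_s^t d) delta_0. *)
definition heatop :: "(real \<Rightarrow> real) \<Rightarrow> (real \<Rightarrow> real) \<Rightarrow> real \<Rightarrow> real \<Rightarrow> (real \<Rightarrow> real) \<Rightarrow> real \<Rightarrow> real" where
  "heatop D d t s \<phi> x =
     (if integral {s..t} D > 0
      then (LINT y|lborel. green D d t s (x - y) * \<phi> y)
      else exp (- integral {s..t} d) * \<phi> x)"

definition Rop :: "(real \<Rightarrow> real) \<Rightarrow> (real \<Rightarrow> real) \<Rightarrow> (real \<Rightarrow> real) \<Rightarrow> (real \<Rightarrow> real)
    \<Rightarrow> (real \<Rightarrow> real) \<Rightarrow> real \<Rightarrow> real \<Rightarrow> real \<Rightarrow> real \<Rightarrow> (real \<Rightarrow> real) \<Rightarrow> real \<Rightarrow> real" where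
  "Rop DI dI tau p h T ta tb t \<phi> x =
     (if \<exists>k::int. ta + of_int k * T \<le> t \<and> t \<le> tb + of_int k * T
      then (1 - deriv tau t) * p (t - tau t) * heatop DI dI t (t - tau t) (\<lambda>y. h (\<phi> y)) x
      else 0)"

definition Qmap :: "(real \<Rightarrow> real) \<Rightarrow> (real \<Rightarrow> real) \<Rightarrow> (real \<Rightarrow> real) \<Rightarrow> (real \<Rightarrow> real) \<Rightarrow> (real \<Rightarrow> real)
    \<Rightarrow> (real \<Rightarrow> real) \<Rightarrow> (real \<Rightarrow> real) \<Rightarrow> real \<Rightarrow> real \<Rightarrow> real \<Rightarrow> (real \<Rightarrow> real) \<Rightarrow> real \<Rightarrow> real" where
  "Qmap DM dM DI dI tau p h T ta tb \<phi> x =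
     heatop DM dM T 0 \<phi> x
     + integral {ta..tb} (\<lambda>s. heatop DM dM T s (Rop DI dI tau p h T ta tb s (heatop DM dM (s - tau s) 0 \<phi>)) x)"

definition dR0 :: "(real \<Rightarrow> real) \<Rightarrow> (real \<Rightarrow> real) \<Rightarrow> (real \<Rightarrow> real) \<Rightarrow> real \<Rightarrow> real \<Rightarrow> real" where
  "dR0 dI tau p hd0 s = (1 - deriv tau s) * exp (- integral {s - tau s..s} dI) * p (s - tau s) * hd0"

definition kbar :: "(real \<Rightarrow> real) \<Rightarrow> real \<Rightarrow> real \<Rightarrow> real" where
  "kbar dM t s = exp (- integral {s..t} dM)"

definition Lconst :: "(real \<Rightarrow> real) \<Rightarrow> (real \<Rightarrow> real) \<Rightarrow> (real \<Rightarrow> real) \<Rightarrow> (real \<Rightarrow> real) \<Rightarrow> real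
    \<Rightarrow> real \<Rightarrow> real \<Rightarrow> real \<Rightarrow> real" where
  "Lconst dM dI tau p hd0 T ta tb =
     kbar dM T 0 / (1 - kbar dM T 0) * integral {ta..tb} (\<lambda>s. dR0 dI tau p hd0 s / kbar dM s (s - tau s))"

(* linearisation DQ[0] of the yearly map at 0 (convolution with the kernel K) *)
definition linQ :: "(real \<Rightarrow> real) \<Rightarrow> (real \<Rightarrow> real) \<Rightarrow> (real \<Rightarrow> real) \<Rightarrow> (real \<Rightarrow> real) \<Rightarrow> (real \<Rightarrow> real)
    \<Rightarrow> (real \<Rightarrow> real) \<Rightarrow> real \<Rightarrow> real \<Rightarrow> real \<Rightarrow> real \<Rightarrow> (real \<Rightarrow> real) \<Rightarrow> real \<Rightarrow> real" where
  "linQ DM dM DI dI tau p hd0 T ta tb \<phi> x =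
     heatop DM dM T 0 \<phi> x
     + integral {ta..tb} (\<lambda>s. (1 - deriv tau s) * p (s - tau s) * hd0 *
          heatop DM dM T s (heatop DI dI s (s - tau s) (heatop DM dM (s - tau s) 0 \<phi>)) x)"

(* c* = inf_{mu>0} (1/mu) ln int e^{mu y} K(y) dy ;
   note int e^{mu y} K(y) dy = (K * e^{-mu .})(0) *)
definition spreading_speed :: "(real \<Rightarrow> real) \<Rightarrow> (real \<Rightarrow> real) \<Rightarrow> (real \<Rightarrow> real) \<Rightarrow> (real \<Rightarrow> real) \<Rightarrow> (real \<Rightarrow> real)
    \<Rightarrow> (real \<Rightarrow> real) \<Rightarrow> real \<Rightarrow> real \<Rightarrow> real \<Rightarrow> real \<Rightarrow> real" where
  "spreading_speed DM dM DI dI tau p hd0 T ta tb =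
     Inf ((\<lambda>\<mu>. ln (linQ DM dM DI dI tau p hd0 T ta tb (\<lambda>y. exp (- \<mu> * y)) 0) / \<mu>) ` {0<..})"

definition mild_solution :: "(real \<Rightarrow> real) \<Rightarrow> (real \<Rightarrow> real) \<Rightarrow> (real \<Rightarrow> real) \<Rightarrow> (real \<Rightarrow> real) \<Rightarrow> (real \<Rightarrow> real)
    \<Rightarrow> (real \<Rightarrow> real) \<Rightarrow> (real \<Rightarrow> real) \<Rightarrow> real \<Rightarrow> real \<Rightarrow> real \<Rightarrow> (real \<Rightarrow> real \<Rightarrow> real) \<Rightarrow> bool" where
  "mild_solution DM dM DI dI tau p h T ta tb u \<longleftrightarrow>
     (\<forall>t\<ge>0. u t \<in> borel_measurable lborel \<and> bounded (range (u t)) \<and> (\<forall>x. 0 \<le> u t x)) \<and>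
     (\<forall>t\<ge>0. \<forall>x. u t x = heatop DM dM t 0 (u 0) x
        + integral {0..t} (\<lambda>s. heatop DM dM t s (Rop DI dI tau p h T ta tb s (u (s - tau s))) x))"

definition periodic_tw :: "(real \<Rightarrow> real) \<Rightarrow> (real \<Rightarrow> real) \<Rightarrow> (real \<Rightarrow> real) \<Rightarrow> (real \<Rightarrow> real) \<Rightarrow> (real \<Rightarrow> real)
    \<Rightarrow> (real \<Rightarrow> real) \<Rightarrow> (real \<Rightarrow> real) \<Rightarrow> real \<Rightarrow> real \<Rightarrow> real \<Rightarrow> (real \<Rightarrow> real) \<Rightarrow> real
    \<Rightarrow> (real \<Rightarrow> real \<Rightarrow> real) \<Rightarrow> bool" where
  "periodic_tw DM dM DI dI tau p h T ta tb ubar c U \<longleftrightarrow>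
     mild_solution DM dM DI dI tau p h T ta tb (\<lambda>t x. U t (x - c * t)) \<and>
     (\<forall>t \<xi>. U (t + T) \<xi> = U t \<xi>) \<and>
     (\<forall>t\<ge>0. (U t \<longlongrightarrow> ubar t) at_bot) \<and>
     (\<forall>t. (U t \<longlongrightarrow> 0) at_top)"

end

theory Submission
  imports Defs "HOL-Probability.Probability" "HOL-Real_Asymp.Real_Asymp"
begin

text \<open>
  Convolution with a Green function is an average over a standard normal variable,
  \<open>exp (- int d) * E f (x + sqrt (2 * int D) * Z)\<close>, which also covers vanishing diffusion. The
  yearly map \<open>Q\<close> is therefore a monotone, translation invariant operator on profiles with values in
  \<open>[0, u]\<close>, continuous under bounded convergence off a countable set, although it need not be compact.

  Existence. For \<open>\<mu> > 0\<close> with \<open>K \<mu> \<le> exp (\<mu> c)\<close> the map \<open>a \<mapsto> max (k 1(s \<le> 0)) (Q a (s + c))\<close> has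
  the supersolution \<open>min u (k exp (- \<mu> s))\<close>; iterating downwards gives a solution of the obstacle
  problem decreasing from \<open>u\<close> to \<open>0\<close>. Normalising at the level \<open>u / 2\<close>, letting \<open>k \<rightarrow> 0\<close> and
  \<open>c\<close> decrease to the prescribed speed, Helly's theorem yields a profile with \<open>Q b (s + c) = b s\<close>. Its limits
  are fixed points of \<open>Q\<close> on constants, hence \<open>u\<close> and \<open>0\<close>. The wave is the mild solution started at \<open>b\<close>.

  Nonexistence. If \<open>Q \<phi> x = \<phi> (x - c)\<close>, the lower envelope \<open>v x = inf {\<phi> y | y \<le> x}\<close>
  satisfies \<open>v (x - c) \<ge> (1 - e) K * min v \<epsilon>\<close> and decays at most exponentially. Let \<open>\<mu>\<close> be a limit point
  of \<open>- ln (v x) / x\<close>. Tilting the (discretised) kernel by \<open>exp (\<mu> y)\<close>, Jensen's inequality and averaging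
  over long windows give \<open>K \<mu> \<le> exp (\<mu> c)\<close>, which is impossible for \<open>c < c*\<close>.
\<close>

section \<open>Gaussian averages\<close>

abbreviation stdN :: "real measure" where
  "stdN \<equiv> density lborel (\<lambda>x. ennreal (std_normal_density x))"

interpretation stdN: prob_space stdN
  by (rule prob_space_normal_density) simp

lemma stdN_UNIV [simp]: "stdN.prob UNIV = 1"
  using stdN.prob_space by simp

definition gavg :: "real \<Rightarrow> (real \<Rightarrow> real) \<Rightarrow> real \<Rightarrow> real" where
  "gavg a f x = (\<integral>z. f (x + a * z) \<partial>stdN)"

lemma gavg_zero [simp]: "gavg 0 f x = f x"
  by (simp add: gavg_def)

lemma gavg_const [simp]: "gavg a (\<lambda>_. v) x = v"
  by (simp add: gavg_def)

lemma gavg_translate: "gavg a (\<lambda>y. f (y + r)) x = gavg a f (x + r)"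
  by (simp add: gavg_def add_ac)

lemma gavg_measurable_pair:
  assumes g: "(\<lambda>(s, x). g s x) \<in> borel_measurable (S \<Otimes>\<^sub>M borel)"
    and A: "A \<in> borel_measurable S"
  shows "(\<lambda>(s, x). gavg (A s) (g s) x) \<in> borel_measurable (S \<Otimes>\<^sub>M borel)"
proof -
  note [measurable] = A
  have "(\<lambda>q. (\<lambda>(s, x). g s x) (fst (fst q), snd (fst q) + A (fst (fst q)) * snd q))
      \<in> borel_measurable ((S \<Otimes>\<^sub>M borel) \<Otimes>\<^sub>M stdN)"
    by (rule measurable_compose[OF _ g]) measurable
  then have "(\<lambda>q. g (fst (fst q)) (snd (fst q) + A (fst (fst q)) * snd q))
      \<in> borel_measurable ((S \<Otimes>\<^sub>M borel) \<Otimes>\<^sub>M stdN)"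
    by simp
  then have "(\<lambda>w. \<integral>z. g (fst w) (snd w + A (fst w) * z) \<partial>stdN) \<in> borel_measurable (S \<Otimes>\<^sub>M borel)"
    by (intro stdN.borel_measurable_lebesgue_integral) (simp add: case_prod_beta')
  then show ?thesis by (simp add: gavg_def case_prod_beta')
qed

lemma gavg_measurable:
  assumes f: "f \<in> borel_measurable borel"
  shows "gavg a f \<in> borel_measurable borel"
proof -
  have "(\<lambda>(s::real, x). gavg a f x) \<in> borel_measurable (borel \<Otimes>\<^sub>M borel)"
    by (rule gavg_measurable_pair) (use f in measurable)
  from measurable_compose[OF _ this, of "\<lambda>x. (0, x)" borel] show ?thesis by simp
qed

lemma gavg_integrable:
  fixes f :: "real \<Rightarrow> real"
  assumes "f \<in> borel_measurable borel" "\<And>x. \<bar>f x\<bar> \<le> M"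
  shows "integrable stdN (\<lambda>z. f (x + a * z))"
  by (rule stdN.integrable_const_bound[of _ M]) (use assms in auto)

lemma gavg_mono:
  assumes "f \<in> borel_measurable borel" "\<And>x. \<bar>f x\<bar> \<le> M"
    and "g \<in> borel_measurable borel" "\<And>x. \<bar>g x\<bar> \<le> M'" and "\<And>x. f x \<le> g x"
  shows "gavg a f x \<le> gavg a g x"
  unfolding gavg_def
  by (intro integral_mono gavg_integrable[of f M] gavg_integrable[of g M'] assms)

lemma gavg_nonneg: "(\<And>x. 0 \<le> f x) \<Longrightarrow> 0 \<le> gavg a f x"
  unfolding gavg_def by (simp add: Bochner_Integration.integral_nonneg)

lemma gavg_le_const:
  assumes "f \<in> borel_measurable borel" "\<And>x. 0 \<le> f x" "\<And>x. f x \<le> M"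
  shows "gavg a f x \<le> M"
  using gavg_mono[of f M "\<lambda>_. M" "\<bar>M\<bar>" a x] assms by simp

lemma gavg_add:
  assumes "f \<in> borel_measurable borel" "\<And>x. \<bar>f x\<bar> \<le> M"
    and "g \<in> borel_measurable borel" "\<And>x. \<bar>g x\<bar> \<le> M'"
  shows "gavg a (\<lambda>x. f x + g x) x = gavg a f x + gavg a g x"
  unfolding gavg_def
  by (intro Bochner_Integration.integral_add gavg_integrable[of f M] gavg_integrable[of g M'] assms)

lemma gavg_cmult: "gavg a (\<lambda>x. k * f x) x = k * gavg a f x"
  unfolding gavg_def by simp

lemma gavg_cmult_fun: "gavg a (\<lambda>y. k * f y) = (\<lambda>y. k * gavg a f y)"
  by (rule ext) (rule gavg_cmult)

lemma AE_stdN_notin_countable: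
  assumes "countable D" "a \<noteq> 0"
  shows "AE z in stdN. x + a * z \<notin> D"
proof -
  have "countable ((\<lambda>y. (y - x) / a) ` D)" using assms by simp
  moreover have "{z. x + a * z \<in> D} \<subseteq> (\<lambda>y. (y - x) / a) ` D"
    using assms by (force simp: image_iff)
  ultimately have "countable {z. x + a * z \<in> D}" by (rule countable_subset[rotated])
  then have "{z. x + a * z \<in> D} \<in> null_sets lborel" by (rule countable_imp_null_set_lborel)
  then have "AE z in lborel. x + a * z \<notin> D" by (rule AE_I') auto
  then show ?thesis by (subst AE_density) auto
qed

text \<open>Degenerate Gaussians (\<open>a = 0\<close>) only see the point \<open>x\<close> itself; all others ignore countable sets.\<close>
lemma gavg_tendsto:
  assumes "\<And>n. f n \<in> borel_measurable borel" "\<And>n x. \<bar>f n x\<bar> \<le> M" "g \<in> borel_measurable borel"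
    and "countable D" and lim: "\<And>x. x \<notin> D \<Longrightarrow> (\<lambda>n. f n x) \<longlonglongrightarrow> g x" and "x \<notin> D"
  shows "(\<lambda>n. gavg a (f n) x) \<longlonglongrightarrow> gavg a g x"
proof (cases "a = 0")
  case True then show ?thesis using lim[OF \<open>x \<notin> D\<close>] by simp
next
  case False
  show ?thesis unfolding gavg_def
  proof (rule integral_dominated_convergence[where w="\<lambda>_. M"])
    show "AE z in stdN. (\<lambda>n. f n (x + a * z)) \<longlonglongrightarrow> g (x + a * z)"
      using AE_stdN_notin_countable[OF \<open>countable D\<close> False, of x] by eventually_elim (rule lim)
  qed (use assms in auto)
qed

lemma std_normal_exp:
  "has_bochner_integral stdN (\<lambda>z. exp (b * z)) (exp (b\<^sup>2 / 2))"
proof -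
  have "has_bochner_integral lborel (normal_density b 1) 1"
    using integral_normal_density[of 1 b] integrable_normal_density[of 1 b]
    by (simp add: has_bochner_integral_iff)
  then have "has_bochner_integral lborel (\<lambda>z. exp (b\<^sup>2 / 2) * normal_density b 1 z) (exp (b\<^sup>2 / 2) * 1)"
    by (rule has_bochner_integral_mult_right)
  moreover have "exp (b\<^sup>2 / 2) * normal_density b 1 z = std_normal_density z *\<^sub>R exp (b * z)" for z
    by (simp add: normal_density_def exp_add[symmetric] power2_eq_square field_simps)
  ultimately have "has_bochner_integral lborel (\<lambda>z. std_normal_density z *\<^sub>R exp (b * z)) (exp (b\<^sup>2 / 2))"
    by simp
  then show ?thesis by (intro has_bochner_integral_density) auto
qed

abbreviation nmgf :: "real \<Rightarrow> real \<Rightarrow> real" where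
  "nmgf \<mu> a \<equiv> exp (\<mu>\<^sup>2 * a\<^sup>2 / 2)"

lemma gavg_exp_integrable: "integrable stdN (\<lambda>z. exp (- \<mu> * (x + a * z)))"
proof -
  have "integrable stdN (\<lambda>z. exp (- \<mu> * x) * exp ((- \<mu> * a) * z))"
    using std_normal_exp[of "- \<mu> * a"] by (auto simp: has_bochner_integral_iff)
  then show ?thesis by (simp add: exp_add[symmetric] algebra_simps)
qed

lemma gavg_exp: "gavg a (\<lambda>y. exp (- \<mu> * y)) x = nmgf \<mu> a * exp (- \<mu> * x)"
proof -
  have "gavg a (\<lambda>y. exp (- \<mu> * y)) x = (\<integral>z. exp (- \<mu> * x) * exp ((- \<mu> * a) * z) \<partial>stdN)"
    unfolding gavg_def by (simp add: exp_add[symmetric] algebra_simps)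
  also have "\<dots> = exp (- \<mu> * x) * exp ((- \<mu> * a)\<^sup>2 / 2)"
    using std_normal_exp[of "- \<mu> * a"] by (simp add: has_bochner_integral_iff)
  finally show ?thesis by (simp add: power_mult_distrib)
qed

lemma gavg_le_exp:
  assumes "f \<in> borel_measurable borel" "\<And>x. \<bar>f x\<bar> \<le> M" "\<And>x. f x \<le> k * exp (- \<mu> * x)"
  shows "gavg a f x \<le> k * nmgf \<mu> a * exp (- \<mu> * x)"
proof -
  have "gavg a f x \<le> gavg a (\<lambda>y. k * exp (- \<mu> * y)) x"
    unfolding gavg_def
    by (intro integral_mono gavg_integrable[of f M] integrable_mult_right gavg_exp_integrable assms)
  then show ?thesis by (simp only: gavg_cmult gavg_exp mult.assoc)
qed

lemma gavg_eq_density: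
  assumes "0 < a" and f: "f \<in> borel_measurable borel"
  shows "gavg a f x = (\<integral>y. normal_density 0 a (x - y) * f y \<partial>lborel)"
proof -
  have "(\<integral>y. normal_density 0 a (x - y) * f y \<partial>lborel)
      = \<bar>a\<bar> *\<^sub>R (\<integral>z. normal_density 0 a (x - (x + a * z)) * f (x + a * z) \<partial>lborel)"
    by (rule lborel_integral_real_affine) (use assms in simp)
  also have "\<dots> = (\<integral>z. a * (normal_density 0 a (x - (x + a * z)) * f (x + a * z)) \<partial>lborel)"
    using assms by simp
  also have "\<dots> = (\<integral>z. std_normal_density z *\<^sub>R f (x + a * z) \<partial>lborel)"
    using assms
    by (intro Bochner_Integration.integral_cong refl)
       (auto simp: normal_density_def real_sqrt_mult power_mult_distrib field_simps)
  also have "\<dots> = gavg a f x"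
    unfolding gavg_def by (rule integral_density[symmetric]) (use f in auto)
  finally show ?thesis by simp
qed

lemma gavg_integral_commute:
  assumes S: "finite_measure S"
    and H: "(\<lambda>(s, x). H s x) \<in> borel_measurable (S \<Otimes>\<^sub>M borel)"
    and bd: "\<And>s x. s \<in> space S \<Longrightarrow> \<bar>H s x\<bar> \<le> M"
  shows "gavg a (\<lambda>y. \<integral>s. H s y \<partial>S) x = (\<integral>s. gavg a (H s) x \<partial>S)"
proof -
  interpret S: finite_measure S by fact
  interpret P: pair_sigma_finite S stdN ..
  have fin: "finite_measure (S \<Otimes>\<^sub>M stdN)"
    by (rule finite_measure_pair_measure) (rule stdN.finite_measure_axioms, rule S)
  have "(\<lambda>q. (\<lambda>(s, x). H s x) (fst q, x + a * snd q)) \<in> borel_measurable (S \<Otimes>\<^sub>M stdN)"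
    by (rule measurable_compose[OF _ H]) measurable
  then have m: "(\<lambda>(s, z). H s (x + a * z)) \<in> borel_measurable (S \<Otimes>\<^sub>M stdN)"
    by (simp add: case_prod_beta')
  have "integrable (S \<Otimes>\<^sub>M stdN) (\<lambda>(s, z). H s (x + a * z))"
    by (rule finite_measure.integrable_const_bound[OF fin, of _ M])
       (use m bd in \<open>auto intro!: AE_I2 simp: space_pair_measure\<close>)
  then show ?thesis unfolding gavg_def by (rule P.Fubini_integral)
qed

lemma gavg_gavg:
  assumes f: "f \<in> borel_measurable borel" and bd: "\<And>x. \<bar>f x\<bar> \<le> M"
    and ab: "0 \<le> a" "0 \<le> b"
  shows "gavg a (gavg b f) x = gavg (sqrt (a\<^sup>2 + b\<^sup>2)) f x"
proof (cases "a = 0 \<or> b = 0")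
  case True
  then show ?thesis using ab by (auto simp: gavg_zero[abs_def])
next
  case False
  then have pos: "0 < a" "0 < b" using ab by auto
  let ?N = "\<lambda>a. density lborel (\<lambda>x. ennreal (normal_density 0 a x))"
  interpret A: prob_space "?N a" using pos by (rule_tac prob_space_normal_density)
  interpret B: prob_space "?N b" using pos by (rule_tac prob_space_normal_density)
  interpret P: pair_sigma_finite "?N a" "?N b" ..
  have eq: "gavg s g y = (\<integral>z. g (y + z) \<partial>?N s)" if "0 < s" "g \<in> borel_measurable borel" for s g y
  proof -
    have "gavg s g y = (\<integral>w. normal_density 0 s (y - w) * g w \<partial>lborel)"
      using that by (rule gavg_eq_density)
    also have "\<dots> = \<bar>1\<bar> *\<^sub>R (\<integral>z. normal_density 0 s (y - (y + 1 * z)) * g (y + 1 * z) \<partial>lborel)"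
      by (rule lborel_integral_real_affine) simp
    also have "\<dots> = (\<integral>z. normal_density 0 s z *\<^sub>R g (y + z) \<partial>lborel)"
      by (simp add: normal_density_def)
    also have "\<dots> = (\<integral>z. g (y + z) \<partial>?N s)"
      by (rule integral_density[symmetric]) (use that in auto)
    finally show ?thesis .
  qed
  have conv: "?N (sqrt (a\<^sup>2 + b\<^sup>2)) = convolution (?N a) (?N b)"
    by (subst convolution_density)
       (use pos in \<open>simp_all add: A.finite_measure_axioms B.finite_measure_axioms
          ennreal_mult[symmetric] conv_normal_density_zero_mean[symmetric]\<close>)
  have sq: "0 < sqrt (a\<^sup>2 + b\<^sup>2)" using pos by (simp add: add_pos_pos)
  have fin: "finite_measure (?N a \<Otimes>\<^sub>M ?N b)"
    by (intro finite_measure_pair_measure A.finite_measure_axioms B.finite_measure_axioms)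
  have int: "integrable (?N a \<Otimes>\<^sub>M ?N b) (\<lambda>p. f (x + (fst p + snd p)))"
    by (rule finite_measure.integrable_const_bound[OF fin, of _ M]) (use f bd in auto)
  have "gavg (sqrt (a\<^sup>2 + b\<^sup>2)) f x = (\<integral>z. f (x + z) \<partial>(convolution (?N a) (?N b)))"
    by (simp only: eq[OF sq f] conv)
  also have "\<dots> = (\<integral>p. f (x + (fst p + snd p)) \<partial>(?N a \<Otimes>\<^sub>M ?N b))"
    unfolding convolution_def using f by (subst integral_distr) (auto simp: case_prod_beta')
  also have "\<dots> = (\<integral>u. (\<integral>v. f (x + (u + v)) \<partial>?N b) \<partial>?N a)"
    using P.integral_fst'[OF int] by simp
  also have "\<dots> = gavg a (gavg b f) x"
    using pos by (simp add: eq gavg_measurable f add.assoc)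
  finally show ?thesis by simp
qed

section \<open>The yearly operator\<close>

definition bm :: "real \<Rightarrow> (real \<Rightarrow> real) \<Rightarrow> bool" where
  "bm M \<phi> \<longleftrightarrow> \<phi> \<in> borel_measurable borel \<and> (\<forall>x. 0 \<le> \<phi> x \<and> \<phi> x \<le> M)"

lemma bmD:
  assumes "bm M \<phi>"
  shows "\<phi> \<in> borel_measurable borel" "0 \<le> \<phi> x" "\<phi> x \<le> M" "\<bar>\<phi> x\<bar> \<le> M"
  using assms by (auto simp: bm_def)

lemma bm_nonneg: "bm M \<phi> \<Longrightarrow> 0 \<le> M"
  using bmD(2,3)[of M \<phi> 0] by linarith

lemma bm_const: "0 \<le> v \<Longrightarrow> v \<le> M \<Longrightarrow> bm M (\<lambda>_. v)"
  by (auto simp: bm_def)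

lemma bm_translate: "bm M \<phi> \<Longrightarrow> bm M (\<lambda>x. \<phi> (x + r))"
  by (auto simp: bm_def)

lemma bm_gavg:
  assumes "bm M \<phi>"
  shows "bm M (gavg a \<phi>)"
  using bmD[OF assms] by (auto simp: bm_def gavg_measurable intro: gavg_nonneg gavg_le_const)

lemma gavg_mono_bm: "bm M f \<Longrightarrow> bm M' g \<Longrightarrow> (\<And>x. f x \<le> g x) \<Longrightarrow> gavg a f x \<le> gavg a g x"
  by (rule gavg_mono[of f M g M']) (auto dest: bmD)

lemma gavg_tendsto_exp:
  assumes "\<And>n. f n \<in> borel_measurable borel" "g \<in> borel_measurable borel"
    and "\<And>n x. \<bar>f n x\<bar> \<le> k * exp (- \<mu> * x)" and "\<And>x. (\<lambda>n. f n x) \<longlonglongrightarrow> g x"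
  shows "(\<lambda>n. gavg a (f n) x) \<longlonglongrightarrow> gavg a g x"
  unfolding gavg_def
  by (rule integral_dominated_convergence[where w="\<lambda>z. k * exp (- \<mu> * (x + a * z))"])
     (use assms gavg_exp_integrable[of \<mu> x a] in auto)

definition nl :: "real \<Rightarrow> real \<Rightarrow> (real \<Rightarrow> real) \<Rightarrow> bool" where
  "nl M M' f \<longleftrightarrow> continuous_on UNIV f \<and> (\<forall>z. 0 \<le> z \<longrightarrow> z \<le> M \<longrightarrow> 0 \<le> f z \<and> f z \<le> M')"

lemma nl_meas: "nl M M' f \<Longrightarrow> f \<in> borel_measurable borel"
  by (simp add: nl_def borel_measurable_continuous_onI)

lemma bm_nl: "nl M M' f \<Longrightarrow> bm M g \<Longrightarrow> bm M' (\<lambda>y. f (g y))"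
  using nl_meas[of M M' f] by (auto simp: bm_def nl_def)

lemma nl_lin: "0 \<le> d \<Longrightarrow> nl M (d * M) (\<lambda>z. d * z)"
  by (auto simp: nl_def mult_left_mono intro!: continuous_intros)

locale season = finite_measure S for S :: "'s measure" +
  fixes a0 A0 :: real and W A B C E :: "'s \<Rightarrow> real" and Wm Am :: real
  assumes a0_nonneg: "0 \<le> a0"
    and meas [measurable]: "W \<in> borel_measurable S" "A \<in> borel_measurable S" "B \<in> borel_measurable S"
      "C \<in> borel_measurable S" "E \<in> borel_measurable S"
    and W_bounds: "\<And>s. s \<in> space S \<Longrightarrow> 0 \<le> W s" "\<And>s. s \<in> space S \<Longrightarrow> W s \<le> Wm"
    and E_bounds: "\<And>s. s \<in> space S \<Longrightarrow> 0 \<le> E s" "\<And>s. s \<in> space S \<Longrightarrow> E s \<le> 1"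
    and amp_bounds: "\<And>s. s \<in> space S \<Longrightarrow> \<bar>A s\<bar> \<le> Am" "\<And>s. s \<in> space S \<Longrightarrow> \<bar>B s\<bar> \<le> Am"
      "\<And>s. s \<in> space S \<Longrightarrow> \<bar>C s\<bar> \<le> Am"
begin

lemma Wm_nonneg: "s \<in> space S \<Longrightarrow> 0 \<le> Wm"
  using W_bounds[of s] by linarith

definition seas :: "(real \<Rightarrow> real) \<Rightarrow> (real \<Rightarrow> real) \<Rightarrow> 's \<Rightarrow> real \<Rightarrow> real" where
  "seas f \<phi> s = gavg (A s) (gavg (B s) (\<lambda>y. f (E s * gavg (C s) \<phi> y)))"

definition Op :: "(real \<Rightarrow> real) \<Rightarrow> (real \<Rightarrow> real) \<Rightarrow> real \<Rightarrow> real" where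
  "Op f \<phi> x = a0 * gavg A0 \<phi> x + (\<integral>s. W s * seas f \<phi> s x \<partial>S)"

lemma bm_arg: "bm M \<phi> \<Longrightarrow> s \<in> space S \<Longrightarrow> bm M (\<lambda>y. E s * gavg (C s) \<phi> y)"
  using bm_gavg[of M \<phi> "C s"] E_bounds[of s]
  by (auto simp: bm_def mult_le_one intro: order_trans[OF mult_left_le_one_le])

lemma bm_seas: "nl M M' f \<Longrightarrow> bm M \<phi> \<Longrightarrow> s \<in> space S \<Longrightarrow> bm M' (seas f \<phi> s)"
  unfolding seas_def by (intro bm_gavg bm_nl[of M M' f] bm_arg)

lemma seas_measurable_pair:
  assumes [measurable]: "f \<in> borel_measurable borel" "\<phi> \<in> borel_measurable borel"
  shows "(\<lambda>(s, x). seas f \<phi> s x) \<in> borel_measurable (S \<Otimes>\<^sub>M borel)"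
proof -
  have [measurable]: "(\<lambda>(s, x). gavg (C s) \<phi> x) \<in> borel_measurable (S \<Otimes>\<^sub>M borel)"
    by (rule gavg_measurable_pair) measurable
  have [measurable]: "(\<lambda>w. gavg (C (fst w)) \<phi> (snd w)) \<in> borel_measurable (S \<Otimes>\<^sub>M borel)"
    using \<open>(\<lambda>(s, x). gavg (C s) \<phi> x) \<in> _\<close> by (simp add: case_prod_beta')
  show ?thesis
    unfolding seas_def
    by (intro gavg_measurable_pair) (simp_all add: case_prod_beta')
qed

lemma seas_measurable:
  assumes "f \<in> borel_measurable borel" "\<phi> \<in> borel_measurable borel"
  shows "(\<lambda>s. seas f \<phi> s x) \<in> borel_measurable S"
  using measurable_compose[OF _ seas_measurable_pair[OF assms], of "\<lambda>s. (s, x)" S] by simp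

lemma seas_integrable:
  assumes "nl M M' f" "bm M \<phi>"
  shows "integrable S (\<lambda>s. W s * seas f \<phi> s x)"
proof (rule integrable_const_bound[of _ "Wm * M'"])
  note [measurable] = seas_measurable[OF nl_meas[OF assms(1)] bmD(1)[OF assms(2)]]
  show "(\<lambda>s. W s * seas f \<phi> s x) \<in> borel_measurable S" by measurable
  show "AE s in S. norm (W s * seas f \<phi> s x) \<le> Wm * M'"
    using W_bounds bmD[OF bm_seas[OF assms]]
    by (intro AE_I2) (auto simp: abs_mult intro!: mult_mono Wm_nonneg)
qed

lemma Op_bm:
  assumes "nl M M' f" "bm M \<phi>"
  shows "bm (a0 * M + measure S (space S) * (Wm * M')) (Op f \<phi>)"
  unfolding bm_def
proof (intro conjI allI)
  note bs = bmD[OF bm_seas[OF assms]] bmD[OF bm_gavg[OF assms(2)]]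
  have p: "(\<lambda>(s, x). seas f \<phi> s x) \<in> borel_measurable (S \<Otimes>\<^sub>M borel)"
    by (rule seas_measurable_pair[OF nl_meas[OF assms(1)] bmD(1)[OF assms(2)]])
  have [measurable]: "(\<lambda>w. seas f \<phi> (snd w) (fst w)) \<in> borel_measurable (borel \<Otimes>\<^sub>M S)"
    using measurable_compose[OF _ p, of "\<lambda>w. (snd w, fst w)" "borel \<Otimes>\<^sub>M S"] by simp
  have [measurable]: "(\<lambda>x. \<integral>s. W s * seas f \<phi> s x \<partial>S) \<in> borel_measurable borel"
    by (rule borel_measurable_lebesgue_integral) (simp add: case_prod_beta')
  show "Op f \<phi> \<in> borel_measurable borel"
    unfolding Op_def using bs(5) by measurable
  fix x
  show "0 \<le> Op f \<phi> x" unfolding Op_def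
    using a0_nonneg W_bounds bs by (auto intro!: add_nonneg_nonneg Bochner_Integration.integral_nonneg)
  have "(\<integral>s. W s * seas f \<phi> s x \<partial>S) \<le> (\<integral>s. Wm * M' \<partial>S)"
    using W_bounds bs
    by (intro integral_mono seas_integrable[OF assms]) (auto intro!: mult_mono Wm_nonneg)
  moreover have "a0 * gavg A0 \<phi> x \<le> a0 * M" using a0_nonneg bs by (simp add: mult_left_mono)
  ultimately show "Op f \<phi> x \<le> a0 * M + measure S (space S) * (Wm * M')"
    unfolding Op_def by simp
qed

lemma Op_translate: "Op f (\<lambda>y. \<phi> (y + r)) x = Op f \<phi> (x + r)"
proof -
  have g: "gavg a (\<lambda>y. \<psi> (y + r)) = (\<lambda>x. gavg a \<psi> (x + r))" for a \<psi>
    by (rule ext) (rule gavg_translate)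
  have "seas f (\<lambda>y. \<phi> (y + r)) s x = seas f \<phi> s (x + r)" for s
    unfolding seas_def g g[of _ "\<lambda>y. f (E s * gavg (C s) \<phi> y)"] ..
  then show ?thesis unfolding Op_def by (simp add: gavg_translate)
qed

lemma Op_mono:
  assumes f: "nl M M1 f" "bm M \<phi>" and g: "nl M M2 g" "bm M \<psi>"
    and le: "\<And>x. \<phi> x \<le> \<psi> x" and fg: "\<And>z w. 0 \<le> z \<Longrightarrow> z \<le> w \<Longrightarrow> w \<le> M \<Longrightarrow> f z \<le> g w"
  shows "Op f \<phi> x \<le> Op g \<psi> x"
proof -
  have "seas f \<phi> s x \<le> seas g \<psi> s x" if s: "s \<in> space S" for s
  proof -
    have 1: "E s * gavg (C s) \<phi> y \<le> E s * gavg (C s) \<psi> y" for y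
      using E_bounds[OF s] by (intro mult_left_mono gavg_mono_bm[OF f(2) g(2)] le)
    have 2: "f (E s * gavg (C s) \<phi> y) \<le> g (E s * gavg (C s) \<psi> y)" for y
      by (rule fg[OF _ 1]) (use bmD[OF bm_arg[OF f(2) s]] bmD[OF bm_arg[OF g(2) s]] in auto)
    have b: "bm M1 (\<lambda>y. f (E s * gavg (C s) \<phi> y))" "bm M2 (\<lambda>y. g (E s * gavg (C s) \<psi> y))"
      by (rule bm_nl[OF f(1) bm_arg[OF f(2) s]], rule bm_nl[OF g(1) bm_arg[OF g(2) s]])
    show ?thesis unfolding seas_def
      by (intro gavg_mono_bm[of M1 _ M2] bm_gavg b 2)
  qed
  then have "(\<integral>s. W s * seas f \<phi> s x \<partial>S) \<le> (\<integral>s. W s * seas g \<psi> s x \<partial>S)"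
    by (intro integral_mono seas_integrable[OF f] seas_integrable[OF g]) (auto intro!: mult_left_mono W_bounds)
  moreover have "a0 * gavg A0 \<phi> x \<le> a0 * gavg A0 \<psi> x"
    by (intro mult_left_mono a0_nonneg gavg_mono_bm[OF f(2) g(2)] le)
  ultimately show ?thesis unfolding Op_def by simp
qed

lemma Op_tendsto:
  assumes f: "nl M M' f" and b: "\<And>n. bm M (\<phi> n)" "bm M \<psi>"
    and D: "countable D" and lim: "\<And>x. x \<notin> D \<Longrightarrow> (\<lambda>n. \<phi> n x) \<longlonglongrightarrow> \<psi> x" and x: "x \<notin> D"
  shows "(\<lambda>n. Op f (\<phi> n) x) \<longlonglongrightarrow> Op f \<psi> x"
proof -
  have g: "(\<lambda>n. gavg a (\<phi>' n) x) \<longlonglongrightarrow> gavg a \<psi>' x"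
    if "\<And>n. bm M' (\<phi>' n)" "bm M' \<psi>'" "\<And>x. x \<notin> D \<Longrightarrow> (\<lambda>n. \<phi>' n x) \<longlonglongrightarrow> \<psi>' x" "x \<notin> D" for M' a \<phi>' \<psi>' x
    by (rule gavg_tendsto[of \<phi>' M' \<psi>' D]) (use that D in \<open>auto dest: bmD\<close>)
  have s: "(\<lambda>n. seas f (\<phi> n) s x) \<longlonglongrightarrow> seas f \<psi> s x" if s: "s \<in> space S" for s
  proof -
    have 1: "(\<lambda>n. f (E s * gavg (C s) (\<phi> n) y)) \<longlonglongrightarrow> f (E s * gavg (C s) \<psi> y)" if "y \<notin> D" for y
    proof -
      have "isCont f (E s * gavg (C s) \<psi> y)"
        using f by (auto simp: nl_def continuous_on_eq_continuous_at)
      then show ?thesis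
        by (rule isCont_tendsto_compose) (intro tendsto_intros g[OF b lim that])
    qed
    have b': "bm M' (\<lambda>y. f (E s * gavg (C s) (\<phi> n) y))" "bm M' (\<lambda>y. f (E s * gavg (C s) \<psi> y))" for n
      by (rule bm_nl[OF f bm_arg[OF b(1) s]], rule bm_nl[OF f bm_arg[OF b(2) s]])
    have 2: "(\<lambda>n. gavg (B s) (\<lambda>y. f (E s * gavg (C s) (\<phi> n) y)) y)
        \<longlonglongrightarrow> gavg (B s) (\<lambda>y. f (E s * gavg (C s) \<psi> y)) y" if "y \<notin> D" for y
      by (rule g[of M']) (use b' 1 that in auto)
    show ?thesis unfolding seas_def
      by (rule g[of M']) (use b' 2 x in \<open>auto intro: bm_gavg\<close>)
  qed
  note sm = seas_measurable[OF nl_meas[OF f]]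
  have [measurable]: "(\<lambda>s. seas f (\<phi> n) s x) \<in> borel_measurable S" "(\<lambda>s. seas f \<psi> s x) \<in> borel_measurable S" for n
    by (intro sm bmD[OF b(1)] bmD[OF b(2)])+
  have "(\<lambda>n. \<integral>s. W s * seas f (\<phi> n) s x \<partial>S) \<longlonglongrightarrow> (\<integral>s. W s * seas f \<psi> s x \<partial>S)"
  proof (rule integral_dominated_convergence[where w="\<lambda>_. Wm * M'"])
    show "AE s in S. (\<lambda>n. W s * seas f (\<phi> n) s x) \<longlonglongrightarrow> W s * seas f \<psi> s x"
      by (intro AE_I2 tendsto_intros s)
    show "AE s in S. norm (W s * seas f (\<phi> n) s x) \<le> Wm * M'" for n
      using W_bounds bmD[OF bm_seas[OF f b(1)]]
      by (intro AE_I2) (auto simp: abs_mult intro!: mult_mono Wm_nonneg)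
  qed auto
  then show ?thesis unfolding Op_def by (intro tendsto_intros g[OF b lim x])
qed

lemma Op_const: "Op f (\<lambda>_. v) x = a0 * v + (\<integral>s. W s * f (E s * v) \<partial>S)"
proof -
  have "gavg a (\<lambda>_. v) = (\<lambda>_. v)" for a v by (rule ext) simp
  then show ?thesis unfolding Op_def seas_def by simp
qed

lemma Op_left_cont:
  assumes f: "nl M M' f" and b: "bm M \<phi>" and lc: "\<And>x. (\<phi> \<longlongrightarrow> \<phi> x) (at_left x)"
  shows "(Op f \<phi> \<longlongrightarrow> Op f \<phi> x) (at_left x)"
proof (rule tendsto_at_left_sequentially[of "x - 1"])
  fix X :: "nat \<Rightarrow> real"
  assume X: "\<And>n. X n < x" "X \<longlonglongrightarrow> x"
  have "(\<lambda>n. Op f (\<lambda>y. \<phi> (y + (X n - x))) x) \<longlonglongrightarrow> Op f \<phi> x"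
  proof (rule Op_tendsto[OF f _ b, of _ "{}"])
    fix y
    have "(\<lambda>n. y + (X n - x)) \<longlonglongrightarrow> y + (x - x)" by (intro tendsto_intros X)
    then have "filterlim (\<lambda>n. y + (X n - x)) (at_left y) sequentially"
      using X(1) by (auto simp: filterlim_at intro!: always_eventually simp: less_imp_neq)
    then show "(\<lambda>n. \<phi> (y + (X n - x))) \<longlonglongrightarrow> \<phi> y" by (rule filterlim_compose[OF lc])
  qed (auto intro: bm_translate b)
  then show "(\<lambda>n. Op f \<phi> (X n)) \<longlonglongrightarrow> Op f \<phi> x" by (simp add: Op_translate)
qed simp

lemma Op_antimono:
  assumes f: "nl M M' f" "mono_on {0..M} f" and b: "bm M \<phi>" and am: "antimono \<phi>"
  shows "antimono (Op f \<phi>)"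
proof (rule antimonoI)
  fix x y :: real assume "x \<le> y"
  have "Op f (\<lambda>w. \<phi> (w + (y - x))) x \<le> Op f \<phi> x"
    using \<open>x \<le> y\<close> am f(2)
    by (intro Op_mono[OF f(1) bm_translate[OF b] f(1) b]) (auto simp: antimono_def mono_on_def)
  then show "Op f \<phi> y \<le> Op f \<phi> x" by (simp add: Op_translate)
qed

lemma Op_tendsto_at_top:
  assumes f: "nl M M' f" and b: "bm M \<phi>" and lim: "(\<phi> \<longlongrightarrow> v) at_top" "0 \<le> v" "v \<le> M"
  shows "(Op f \<phi> \<longlongrightarrow> Op f (\<lambda>_. v) 0) at_top"
proof (rule tendsto_at_topI_sequentially)
  fix X :: "nat \<Rightarrow> real" assume X: "filterlim X at_top sequentially"
  have "(\<lambda>n. Op f (\<lambda>y. \<phi> (y + X n)) 0) \<longlonglongrightarrow> Op f (\<lambda>_. v) 0"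
  proof (rule Op_tendsto[OF f bm_translate[OF b] bm_const[OF lim(2,3)], of "{}"])
    fix y
    have "filterlim (\<lambda>n. y + X n) at_top sequentially"
      by (rule filterlim_tendsto_add_at_top[OF tendsto_const X])
    then show "(\<lambda>n. \<phi> (y + X n)) \<longlonglongrightarrow> v" by (rule filterlim_compose[OF lim(1)])
  qed auto
  then show "(\<lambda>n. Op f \<phi> (X n)) \<longlonglongrightarrow> Op f (\<lambda>_. v) 0" by (simp add: Op_translate)
qed

lemma Op_tendsto_at_bot:
  assumes f: "nl M M' f" and b: "bm M \<phi>" and lim: "(\<phi> \<longlongrightarrow> v) at_bot" "0 \<le> v" "v \<le> M"
  shows "(Op f \<phi> \<longlongrightarrow> Op f (\<lambda>_. v) 0) at_bot"
  unfolding filterlim_at_bot_mirror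
proof (rule tendsto_at_topI_sequentially)
  fix X :: "nat \<Rightarrow> real" assume X: "filterlim X at_top sequentially"
  have "(\<lambda>n. Op f (\<lambda>y. \<phi> (y + - X n)) 0) \<longlonglongrightarrow> Op f (\<lambda>_. v) 0"
  proof (rule Op_tendsto[OF f bm_translate[OF b] bm_const[OF lim(2,3)], of "{}"])
    fix y
    have "filterlim (\<lambda>n. - y + X n) at_top sequentially"
      by (rule filterlim_tendsto_add_at_top[OF tendsto_const X])
    then have "filterlim (\<lambda>n. y + - X n) at_bot sequentially"
      by (simp add: filterlim_uminus_at_bot)
    then show "(\<lambda>n. \<phi> (y + - X n)) \<longlonglongrightarrow> v" by (rule filterlim_compose[OF lim(1)])
  qed auto
  then show "(\<lambda>n. Op f \<phi> (- X n)) \<longlonglongrightarrow> Op f (\<lambda>_. v) 0"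
    by (simp only: Op_translate add_0_left)
qed

abbreviation Lin :: "real \<Rightarrow> (real \<Rightarrow> real) \<Rightarrow> real \<Rightarrow> real" where
  "Lin d \<equiv> Op (\<lambda>z. d * z)"

abbreviation lseas :: "real \<Rightarrow> (real \<Rightarrow> real) \<Rightarrow> 's \<Rightarrow> real \<Rightarrow> real" where
  "lseas d \<equiv> seas (\<lambda>z. d * z)"

abbreviation tilt :: "real \<Rightarrow> real \<Rightarrow> 's \<Rightarrow> real" where
  "tilt d \<mu> s \<equiv> d * E s * nmgf \<mu> (A s) * nmgf \<mu> (B s) * nmgf \<mu> (C s)"

definition Kern :: "real \<Rightarrow> real \<Rightarrow> real" where
  "Kern d \<mu> = a0 * nmgf \<mu> A0
     + (\<integral>s. W s * tilt d \<mu> s \<partial>S)"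

lemma Kern_integrable:
  "integrable S (\<lambda>s. W s * tilt d \<mu> s)"
proof -
  let ?K = "Wm * (\<bar>d\<bar> * 1 * nmgf \<mu> Am * nmgf \<mu> Am * nmgf \<mu> Am)"
  show ?thesis
  proof (rule integrable_const_bound[of _ ?K])
    have "u\<^sup>2 \<le> Am\<^sup>2" if "\<bar>u\<bar> \<le> Am" for u using that by (simp add: abs_le_square_iff[symmetric])
    then have e: "nmgf \<mu> u \<le> nmgf \<mu> Am" if "\<bar>u\<bar> \<le> Am" for u
      using that by (simp add: mult_left_mono)
    show "AE s in S. norm (W s * tilt d \<mu> s) \<le> ?K"
    proof (rule AE_I2)
      fix s assume s: "s \<in> space S"
      have "norm (W s * tilt d \<mu> s)
        = W s * (\<bar>d\<bar> * E s * nmgf \<mu> (A s) * nmgf \<mu> (B s) * nmgf \<mu> (C s))"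
        using W_bounds[OF s] E_bounds[OF s] by (simp add: abs_mult)
      also have "\<dots> \<le> ?K"
        using W_bounds[OF s] E_bounds[OF s]
        by (intro mult_mono e amp_bounds[OF s]) auto
      finally show "norm (W s * tilt d \<mu> s) \<le> ?K" .
    qed
  qed measurable
qed

lemma seas_exp:
  "lseas d (\<lambda>y. exp (- \<mu> * y)) s x
     = tilt d \<mu> s * exp (- \<mu> * x)"
proof -
  have g: "gavg a (\<lambda>y. k * exp (- \<mu> * y)) = (\<lambda>x. (k * nmgf \<mu> a) * exp (- \<mu> * x))" for a k
    by (rule ext) (simp only: gavg_cmult gavg_exp mult.assoc)
  have g1: "gavg a (\<lambda>y. exp (- \<mu> * y)) = (\<lambda>x. nmgf \<mu> a * exp (- \<mu> * x))" for a
    by (rule ext) (rule gavg_exp)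
  show ?thesis unfolding seas_def g1 mult.assoc[symmetric] g by (simp add: mult_ac)
qed

lemma Lin_exp: "Lin d (\<lambda>y. exp (- \<mu> * y)) x = Kern d \<mu> * exp (- \<mu> * x)"
  unfolding Op_def seas_exp Kern_def gavg_exp mult.assoc[symmetric] integral_mult_left_zero
  by (simp add: algebra_simps)

lemma Op_le_exp:
  assumes f: "nl M M' f" "\<And>z. 0 \<le> z \<Longrightarrow> z \<le> M \<Longrightarrow> f z \<le> d * z" and b: "bm M \<phi>" and "0 \<le> d"
    and le: "\<And>x. \<phi> x \<le> k * exp (- \<mu> * x)"
  shows "Op f \<phi> x \<le> k * Kern d \<mu> * exp (- \<mu> * x)"
proof -
  note g = gavg_le_exp[OF bmD(1) bmD(4)]
  have "seas f \<phi> s x \<le> k * d * E s * nmgf \<mu> (A s) * nmgf \<mu> (B s) * nmgf \<mu> (C s) * exp (- \<mu> * x)"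
    if s: "s \<in> space S" for s
  proof -
    have 1: "gavg (C s) \<phi> y \<le> k * nmgf \<mu> (C s) * exp (- \<mu> * y)" for y
      by (rule g[OF b b le])
    have 2: "f (E s * gavg (C s) \<phi> y) \<le> (d * E s * k * nmgf \<mu> (C s)) * exp (- \<mu> * y)" for y
    proof -
      have "f (E s * gavg (C s) \<phi> y) \<le> d * (E s * gavg (C s) \<phi> y)"
        by (rule f(2)) (use bmD[OF bm_arg[OF b s]] in auto)
      also have "\<dots> \<le> d * (E s * (k * nmgf \<mu> (C s) * exp (- \<mu> * y)))"
        using E_bounds[OF s] \<open>0 \<le> d\<close> by (intro mult_left_mono 1) auto
      finally show ?thesis by (simp add: mult_ac)
    qed
    have b': "bm M' (\<lambda>y. f (E s * gavg (C s) \<phi> y))" by (rule bm_nl[OF f(1) bm_arg[OF b s]])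
    have 3: "gavg (B s) (\<lambda>y. f (E s * gavg (C s) \<phi> y)) y
        \<le> (d * E s * k * nmgf \<mu> (C s)) * nmgf \<mu> (B s) * exp (- \<mu> * y)" for y
      by (rule g[OF b' b' 2])
    show ?thesis unfolding seas_def
      using g[OF bm_gavg[OF b'] bm_gavg[OF b'] 3, of "A s" x] by (simp add: mult_ac)
  qed
  then have "W s * seas f \<phi> s x \<le> (k * exp (- \<mu> * x)) * (W s * tilt d \<mu> s)"
    if "s \<in> space S" for s
    using mult_left_mono[OF _ W_bounds(1)[OF that]] that by (fastforce simp: mult_ac)
  then have "(\<integral>s. W s * seas f \<phi> s x \<partial>S) \<le> (\<integral>s. (k * exp (- \<mu> * x)) * (W s * tilt d \<mu> s) \<partial>S)"
    by (intro integral_mono seas_integrable[OF f(1) b] integrable_mult_right Kern_integrable)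
  moreover have "a0 * gavg A0 \<phi> x \<le> a0 * (k * nmgf \<mu> A0 * exp (- \<mu> * x))"
    by (intro mult_left_mono a0_nonneg g[OF b b le])
  ultimately show ?thesis unfolding Op_def Kern_def integral_mult_right_zero
    by (simp only: distrib_left distrib_right mult_ac)
qed

lemma seas_lin:
  "lseas d f s = (\<lambda>x. d * (E s * gavg (A s) (gavg (B s) (gavg (C s) f)) x))"
  unfolding seas_def gavg_cmult_fun ..

lemma seas_lin_add:
  assumes "bm M \<phi>" "bm M \<psi>"
  shows "lseas d (\<lambda>y. \<phi> y + \<psi> y) s x = lseas d \<phi> s x + lseas d \<psi> s x"
proof -
  have g: "gavg a (\<lambda>y. f y + g y) = (\<lambda>y. gavg a f y + gavg a g y)" if "bm M f" "bm M g" for f g a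
    by (rule ext) (rule gavg_add[of f M g M]; use that in \<open>auto dest: bmD\<close>)
  show ?thesis unfolding seas_lin using assms
    by (simp add: g bm_gavg algebra_simps)
qed

lemma seas_lin_cmult: "lseas d (\<lambda>y. k * \<phi> y) s x = k * lseas d \<phi> s x"
  unfolding seas_lin by (simp add: gavg_cmult_fun)

lemma Lin_cmult: "Lin d (\<lambda>y. k * \<phi> y) x = k * Lin d \<phi> x"
  unfolding Op_def seas_lin_cmult gavg_cmult by (simp add: algebra_simps)

lemma Lin_add:
  assumes "0 \<le> d" "bm M \<phi>" "bm M \<psi>"
  shows "Lin d (\<lambda>y. \<phi> y + \<psi> y) x = Lin d \<phi> x + Lin d \<psi> x"
proof -
  have "gavg A0 (\<lambda>y. \<phi> y + \<psi> y) x = gavg A0 \<phi> x + gavg A0 \<psi> x"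
    by (rule gavg_add[of \<phi> M \<psi> M]; use assms in \<open>auto dest: bmD\<close>)
  moreover have "(\<integral>s. W s * lseas d (\<lambda>y. \<phi> y + \<psi> y) s x \<partial>S)
    = (\<integral>s. W s * lseas d \<phi> s x + W s * lseas d \<psi> s x \<partial>S)"
    using assms by (simp add: seas_lin_add distrib_left)
  moreover have "\<dots> = (\<integral>s. W s * lseas d \<phi> s x \<partial>S) + (\<integral>s. W s * lseas d \<psi> s x \<partial>S)"
    by (intro Bochner_Integration.integral_add seas_integrable[of M "d * M"] nl_lin assms)
  ultimately show ?thesis unfolding Op_def by (simp add: distrib_left)
qed

lemma Lin_sum:
  assumes "finite I" "0 \<le> d" "\<And>i. i \<in> I \<Longrightarrow> bm M (\<phi> i)" "0 \<le> M"
  shows "Lin d (\<lambda>y. \<Sum>i\<in>I. \<phi> i y) x = (\<Sum>i\<in>I. Lin d (\<phi> i) x)"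
  using assms(1,3)
proof (induction I)
  case empty
  show ?case using Op_const[of "\<lambda>z. d * z" 0 x] by simp
next
  case (insert i I)
  have b1: "bm (real (card I) * M) (\<lambda>y. \<Sum>i\<in>I. \<phi> i y)"
    using insert.prems sum_bounded_above[of I "\<lambda>i. \<phi> i y" M for y]
    unfolding bm_def by (auto intro!: sum_nonneg sum_bounded_above borel_measurable_sum)
  have b2: "bm (real (card I) * M + M) (\<lambda>y. \<Sum>i\<in>I. \<phi> i y)" "bm (real (card I) * M + M) (\<phi> i)"
    using b1 insert.prems[of i] \<open>0 \<le> M\<close> by (auto simp: bm_def intro: add_increasing add_increasing2)
  show ?case using insert by (simp add: Lin_add[OF \<open>0 \<le> d\<close> b2(2) b2(1)])
qed

lemma Lin_exp_truncated_tendsto: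
  assumes "0 \<le> d"
  shows "(\<lambda>n. Lin d (\<lambda>y. exp (- \<mu> * y) * indicator {- real n..real n} y) 0) \<longlonglongrightarrow> Kern d \<mu>"
proof -
  let ?f = "\<lambda>n y. exp (- \<mu> * y) * indicator {- real n..real n} y"
  let ?e = "\<lambda>y. exp (- \<mu> * y)"
  have nn: "0 \<le> ?f n y" "?f n y \<le> 1 * ?e y" for n y by (auto simp: indicator_def)
  have bf: "bm (exp (\<bar>\<mu>\<bar> * real n)) (?f n)" for n
  proof -
    have "\<bar>\<mu>\<bar> * \<bar>y\<bar> \<le> \<bar>\<mu>\<bar> * real n" if "y \<in> {- real n..real n}" for y
      using that by (intro mult_left_mono) auto
    then have "- \<mu> * y \<le> \<bar>\<mu>\<bar> * real n" if "y \<in> {- real n..real n}" for y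
      using that abs_ge_self[of "- \<mu> * y"] by (auto simp: abs_mult intro: order_trans)
    then show ?thesis by (auto simp: bm_def indicator_def)
  qed
  have lim: "(\<lambda>n. ?f n y) \<longlonglongrightarrow> ?e y" for y
  proof -
    obtain N where N: "\<bar>y\<bar> \<le> real N" using real_arch_simple by blast
    have "\<forall>\<^sub>F n in sequentially. ?f n y = ?e y"
      using eventually_ge_at_top[of N]
      by eventually_elim (use N in \<open>auto simp: indicator_def\<close>)
    then show ?thesis by (rule tendsto_eventually)
  qed
  have step: "(\<lambda>n. gavg a (g n) x) \<longlonglongrightarrow> gavg a g' x"
    if "\<And>n. bm (M n) (g n)" "g' \<in> borel_measurable borel" "\<And>n y. g n y \<le> k * ?e y" "\<And>y. (\<lambda>n. g n y) \<longlonglongrightarrow> g' y"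
    for a M g g' k x
    by (rule gavg_tendsto_exp[of g g' k \<mu>]) (use that in \<open>auto simp: bm_def\<close>)
  have em: "?e \<in> borel_measurable borel" by measurable
  note g = gavg_le_exp[OF bmD(1) bmD(4)]
  have s: "(\<lambda>n. lseas d (?f n) s 0) \<longlonglongrightarrow> lseas d ?e s 0"
    and sb: "\<And>n. lseas d (?f n) s 0 \<le> lseas d ?e s 0"
    if s: "s \<in> space S" for s
  proof -
    have 1: "gavg (C s) (?f n) y \<le> 1 * nmgf \<mu> (C s) * ?e y" for n y
      by (rule g[OF bf bf nn(2)])
    have 2: "gavg (B s) (gavg (C s) (?f n)) y \<le> (1 * nmgf \<mu> (C s)) * nmgf \<mu> (B s) * ?e y" for n y
      by (rule g[OF bm_gavg[OF bf] bm_gavg[OF bf] 1])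
    have 3: "gavg (A s) (gavg (B s) (gavg (C s) (?f n))) 0 \<le> ((1 * nmgf \<mu> (C s)) * nmgf \<mu> (B s)) * nmgf \<mu> (A s) * ?e 0" for n
      by (rule g[OF bm_gavg[OF bm_gavg[OF bf]] bm_gavg[OF bm_gavg[OF bf]] 2])
    have "(\<lambda>n. gavg (A s) (gavg (B s) (gavg (C s) (?f n))) 0) \<longlonglongrightarrow> gavg (A s) (gavg (B s) (gavg (C s) ?e)) 0"
      by (intro step[OF bm_gavg[OF bm_gavg[OF bf]] _ 2] step[OF bm_gavg[OF bf] _ 1] step[OF bf _ nn(2)] gavg_measurable em lim)
    then show "(\<lambda>n. lseas d (?f n) s 0) \<longlonglongrightarrow> lseas d ?e s 0"
      unfolding seas_lin by (intro tendsto_intros)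
    have "lseas d (?f n) s 0 \<le> d * (E s * (((1 * nmgf \<mu> (C s)) * nmgf \<mu> (B s)) * nmgf \<mu> (A s) * ?e 0))" for n
      unfolding seas_lin using E_bounds[OF s] \<open>0 \<le> d\<close> by (intro mult_left_mono 3) auto
    then show "lseas d (?f n) s 0 \<le> lseas d ?e s 0" for n
      unfolding seas_exp by (simp add: mult_ac)
  qed
  have [measurable]: "(\<lambda>s. lseas d (?f n) s 0) \<in> borel_measurable S" "(\<lambda>s. lseas d ?e s 0) \<in> borel_measurable S" for n
    by (rule seas_measurable; measurable)+
  have "(\<lambda>n. \<integral>s. W s * lseas d (?f n) s 0 \<partial>S) \<longlonglongrightarrow> (\<integral>s. W s * lseas d ?e s 0 \<partial>S)"
  proof (rule integral_dominated_convergence[where w="\<lambda>s. W s * lseas d ?e s 0"])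
    show "integrable S (\<lambda>s. W s * lseas d ?e s 0)"
      using Kern_integrable[of d \<mu>] unfolding seas_exp by simp
    show "AE s in S. norm (W s * lseas d (?f n) s 0) \<le> W s * lseas d ?e s 0" for n
    proof (rule AE_I2)
      fix s' assume s': "s' \<in> space S"
      have "0 \<le> lseas d (?f n) s' 0" by (rule bmD(2)[OF bm_seas[OF nl_lin[OF \<open>0 \<le> d\<close>] bf s']])
      then show "norm (W s' * lseas d (?f n) s' 0) \<le> W s' * lseas d ?e s' 0"
        using W_bounds[OF s'] sb[OF s', of n] by (simp add: abs_mult mult_left_mono)
    qed
    show "AE s in S. (\<lambda>n. W s * lseas d (?f n) s 0) \<longlonglongrightarrow> W s * lseas d ?e s 0"
      by (intro AE_I2 tendsto_intros s)
  qed measurable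
  moreover have "(\<lambda>n. gavg A0 (?f n) 0) \<longlonglongrightarrow> gavg A0 ?e 0"
    by (rule step[OF bf em nn(2) lim])
  ultimately have "(\<lambda>n. Lin d (?f n) 0) \<longlonglongrightarrow> Lin d ?e 0"
    unfolding Op_def by (intro tendsto_intros)
  then show ?thesis by (simp only: Lin_exp) simp
qed

end

section \<open>Existence of wave profiles\<close>

lemma antimono_limits:
  fixes b :: "real \<Rightarrow> real"
  assumes am: "antimono b" and bd: "\<And>x. 0 \<le> b x" "\<And>x. b x \<le> M"
  obtains l1 l2 where "(b \<longlongrightarrow> l1) at_bot" "(b \<longlongrightarrow> l2) at_top" "\<And>x. b x \<le> l1" "\<And>x. l2 \<le> b x"
proof -
  have "convergent (\<lambda>n. b (- real n))"
    using am bd by (intro Bseq_mono_convergent BseqI'[of _ M]) (auto simp: antimono_def monoI)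
  then obtain l1 where l1: "(\<lambda>n. b (- real n)) \<longlonglongrightarrow> l1" by (auto simp: convergent_def)
  have "((\<lambda>x. b (- x)) \<longlongrightarrow> l1) at_top"
    using am by (intro tendsto_at_topI_sequentially_real l1) (auto simp: antimono_def intro: monoI)
  then have L1: "(b \<longlongrightarrow> l1) at_bot" by (simp add: filterlim_at_bot_mirror)
  have "convergent (\<lambda>n. - b (real n))"
    using am bd by (intro Bseq_mono_convergent BseqI'[of _ M]) (auto simp: antimono_def monoI)
  then obtain l2 where l2: "(\<lambda>n. - b (real n)) \<longlonglongrightarrow> l2" by (auto simp: convergent_def)
  have "((\<lambda>x. - b x) \<longlongrightarrow> l2) at_top"
    using am by (intro tendsto_at_topI_sequentially_real l2) (auto simp: antimono_def intro: monoI)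
  then have L2: "(b \<longlongrightarrow> - l2) at_top" using tendsto_minus by fastforce
  have "b x \<le> l1" for x
    using am by (intro tendsto_lowerbound[OF L1] eventually_mono[OF eventually_le_at_bot[of x]])
      (auto simp: antimono_def)
  moreover have "- l2 \<le> b x" for x
    using am by (intro tendsto_upperbound[OF L2] eventually_mono[OF eventually_ge_at_top[of x]])
      (auto simp: antimono_def)
  ultimately show ?thesis using L1 L2 that by blast
qed

lemma left_cont_decreasing_limit:
  fixes g :: "nat \<Rightarrow> real \<Rightarrow> real"
  assumes lim: "\<And>x. (\<lambda>n. g n x) \<longlonglongrightarrow> a x" and ge: "\<And>n x. a x \<le> g n x" and am: "antimono a"
    and lc: "\<And>n x. (g n \<longlongrightarrow> g n x) (at_left x)"
  shows "(a \<longlongrightarrow> a x) (at_left x)"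
proof (rule order_tendstoI)
  fix y assume "y < a x"
  have "\<forall>\<^sub>F z in at_left x. z < x" by (simp add: eventually_at_filter)
  then show "\<forall>\<^sub>F z in at_left x. y < a z"
    by eventually_elim (use am \<open>y < a x\<close> in \<open>auto simp: antimono_def intro: less_le_trans\<close>)
next
  fix y assume "a x < y"
  then have "\<forall>\<^sub>F n in sequentially. g n x < y" using lim order_tendstoD(2) by blast
  then obtain n where "g n x < y" by (auto simp: eventually_sequentially)
  then have "\<forall>\<^sub>F z in at_left x. g n z < y" using lc order_tendstoD(2) by blast
  then show "\<forall>\<^sub>F z in at_left x. a z < y"
    by eventually_elim (use ge in \<open>auto intro: le_less_trans\<close>)
qed

lemma ex_real_notin_countable:
  assumes "countable D" "(x::real) < y"
  shows "\<exists>z. x < z \<and> z < y \<and> z \<notin> D"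
proof (rule ccontr)
  assume "\<not> ?thesis"
  then have "{x<..<y} \<subseteq> D" by auto
  then show False using assms countable_subset uncountable_open_interval by blast
qed

lemma at_left_translate: "filterlim (\<lambda>y. y + r) (at_left (x + r)) (at_left (x::real))"
proof -
  have "((\<lambda>y. y + r) \<longlongrightarrow> x + r) (at_left x)" by (intro tendsto_intros)
  moreover have "\<forall>\<^sub>F y in at_left x. y + r < x + r" by (simp add: eventually_at_filter)
  ultimately show ?thesis unfolding filterlim_at by (auto elim: eventually_mono)
qed

lemma moving_tendsto:
  fixes g :: "nat \<Rightarrow> real \<Rightarrow> real"
  assumes am: "\<And>n. antimono (g n)" and D: "countable D"
    and lim: "\<And>x. x \<notin> D \<Longrightarrow> (\<lambda>n. g n x) \<longlonglongrightarrow> b x" and cont: "isCont b x" and e: "e \<longlonglongrightarrow> 0"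
  shows "(\<lambda>n. g n (x + e n)) \<longlonglongrightarrow> b x"
proof (rule order_tendstoI)
  have xe: "(\<lambda>n. x + e n) \<longlonglongrightarrow> x" using tendsto_add[OF tendsto_const e, of x] by simp
  fix y assume "y < b x"
  then have "\<forall>\<^sub>F z in nhds x. y < b z"
    using cont by (simp add: continuous_within tendsto_at_iff_tendsto_nhds order_tendstoD)
  then obtain r where r: "0 < r" "\<And>z. dist z x < r \<Longrightarrow> y < b z" by (auto simp: eventually_nhds_metric)
  obtain z where z: "x < z" "z < x + r" "z \<notin> D" using ex_real_notin_countable[OF D, of x "x + r"] r by auto
  have "y < b z" using z by (intro r) (auto simp: dist_real_def)
  then have "\<forall>\<^sub>F n in sequentially. y < g n z" using lim[OF z(3)] order_tendstoD(1) by blast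
  moreover have "\<forall>\<^sub>F n in sequentially. x + e n < z" using xe z(1) order_tendstoD(2) by blast
  ultimately show "\<forall>\<^sub>F n in sequentially. y < g n (x + e n)"
    by eventually_elim (use am in \<open>auto simp: antimono_def intro: less_le_trans\<close>)
next
  have xe: "(\<lambda>n. x + e n) \<longlonglongrightarrow> x" using tendsto_add[OF tendsto_const e, of x] by simp
  fix y assume "b x < y"
  then have "\<forall>\<^sub>F z in nhds x. b z < y"
    using cont by (simp add: continuous_within tendsto_at_iff_tendsto_nhds order_tendstoD)
  then obtain r where r: "0 < r" "\<And>z. dist z x < r \<Longrightarrow> b z < y" by (auto simp: eventually_nhds_metric)
  obtain z where z: "x - r < z" "z < x" "z \<notin> D" using ex_real_notin_countable[OF D, of "x - r" x] r by auto
  have "b z < y" using z by (intro r) (auto simp: dist_real_def)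
  then have "\<forall>\<^sub>F n in sequentially. g n z < y" using lim[OF z(3)] order_tendstoD(2) by blast
  moreover have "\<forall>\<^sub>F n in sequentially. z < x + e n" using xe z(2) order_tendstoD(1) by blast
  ultimately show "\<forall>\<^sub>F n in sequentially. g n (x + e n) < y"
    by eventually_elim (rule le_less_trans[OF antimonoD[OF am]], auto)
qed

locale wave_setting = season +
  fixes f :: "real \<Rightarrow> real" and u d :: real
  assumes f_cont: "continuous_on UNIV f"
    and f_nonneg: "\<And>z. 0 \<le> z \<Longrightarrow> 0 \<le> f z"
    and f_mono: "mono_on {0..u} f"
    and f_le: "\<And>z. 0 \<le> z \<Longrightarrow> f z \<le> d * z"
    and f_ge: "\<And>e. 0 < e \<Longrightarrow> \<exists>z0>0. \<forall>z. 0 \<le> z \<longrightarrow> z \<le> z0 \<longrightarrow> (1 - e) * d * z \<le> f z"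
    and d_pos: "0 < d" and u_pos: "0 < u"
    and fix_u: "Op f (\<lambda>_. u) 0 = u"
    and no_fix: "\<And>v. 0 < v \<Longrightarrow> v < u \<Longrightarrow> Op f (\<lambda>_. v) 0 \<noteq> v"
    and Kern0: "1 < Kern d 0"
begin

lemma nl_f: "nl u (d * u) f"
  unfolding nl_def using f_cont f_nonneg f_le d_pos
  by (auto intro: order_trans[OF f_le] mult_left_mono)

lemma Op_f_mono: "bm u \<phi> \<Longrightarrow> bm u \<psi> \<Longrightarrow> (\<And>x. \<phi> x \<le> \<psi> x) \<Longrightarrow> Op f \<phi> x \<le> Op f \<psi> x"
  using f_mono by (intro Op_mono[OF nl_f _ nl_f]) (auto simp: mono_on_def)

lemma Op_f_const: "Op f (\<lambda>_. v) x = Op f (\<lambda>_. v) 0"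
  by (simp add: Op_const)

lemma Op_f_le: "bm u \<phi> \<Longrightarrow> Op f \<phi> x \<le> u"
  using Op_f_mono[of \<phi> "\<lambda>_. u" x] fix_u Op_f_const[of u x] bm_const[of u u] u_pos
  by (auto dest: bmD)

lemma Op_f_bm: "bm u \<phi> \<Longrightarrow> bm u (Op f \<phi>)"
  using Op_bm[OF nl_f, of \<phi>] Op_f_le by (auto simp: bm_def)

lemma q_cont: "continuous_on {0..u} (\<lambda>v. Op f (\<lambda>_. v) 0)"
  unfolding continuous_on_sequentially comp_def
proof (intro allI ballI impI)
  fix X and v assume "v \<in> {0..u}" "(\<forall>n. X n \<in> {0..u}) \<and> X \<longlonglongrightarrow> v"
  then show "(\<lambda>n. Op f (\<lambda>_. X n) 0) \<longlonglongrightarrow> Op f (\<lambda>_. v) 0"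
    by (intro Op_tendsto[OF nl_f, of _ _ "{}"] bm_const) auto
qed

lemma q_small: "\<exists>v0>0. \<forall>v. 0 < v \<longrightarrow> v \<le> v0 \<longrightarrow> v < Op f (\<lambda>_. v) 0"
proof -
  define k1 where "k1 = (\<integral>s. W s * (d * E s) \<partial>S)"
  have K: "Kern d 0 = a0 + k1" unfolding Kern_def k1_def by simp
  have k1: "0 \<le> k1" unfolding k1_def
    using W_bounds E_bounds d_pos by (auto intro!: Bochner_Integration.integral_nonneg)
  define e where "e = (Kern d 0 - 1) / (2 * (k1 + 1))"
  have e: "0 < e" using Kern0 k1 by (simp add: e_def)
  have "e * k1 \<le> e * (k1 + 1)" using e by simp
  also have "\<dots> = (Kern d 0 - 1) / 2" using k1 by (simp add: e_def divide_simps)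
  finally have gt: "1 < a0 + (1 - e) * k1" using K Kern0 by (simp add: algebra_simps)
  obtain z0 where z0: "0 < z0" "\<And>z. 0 \<le> z \<Longrightarrow> z \<le> z0 \<Longrightarrow> (1 - e) * d * z \<le> f z"
    using f_ge[OF e] by blast
  have "v < Op f (\<lambda>_. v) 0" if v: "0 < v" "v \<le> min z0 u" for v
  proof -
    have i1: "integrable S (\<lambda>s. W s * (d * E s))" using Kern_integrable[of d 0] by simp
    have i2: "integrable S (\<lambda>s. W s * f (E s * v))"
    proof -
      have "seas f (\<lambda>_. v) s 0 = f (E s * v)" for s
      proof -
        have "gavg a (\<lambda>_. w) = (\<lambda>_. w)" for a w by (rule ext) simp
        then show ?thesis unfolding seas_def by simp
      qed
      then show ?thesis using seas_integrable[OF nl_f bm_const[of v u], of 0] v by simp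
    qed
    have "(\<integral>s. ((1 - e) * v) * (W s * (d * E s)) \<partial>S) \<le> (\<integral>s. W s * f (E s * v) \<partial>S)"
    proof (intro integral_mono i2 integrable_mult_right i1)
      fix s assume s: "s \<in> space S"
      have "E s * v \<le> 1 * v" using E_bounds[OF s] v by (intro mult_right_mono) auto
      then have "E s * v \<le> z0" using v by linarith
      then have "(1 - e) * d * (E s * v) \<le> f (E s * v)"
        using E_bounds[OF s] v by (intro z0) auto
      then have "W s * ((1 - e) * d * (E s * v)) \<le> W s * f (E s * v)"
        by (intro mult_left_mono W_bounds[OF s])
      then show "((1 - e) * v) * (W s * (d * E s)) \<le> W s * f (E s * v)" by (simp add: mult_ac)
    qed
    then have "a0 * v + (1 - e) * v * k1 \<le> Op f (\<lambda>_. v) 0"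
      unfolding Op_const k1_def by simp
    moreover have "1 * v < (a0 + (1 - e) * k1) * v" using gt v by (intro mult_strict_right_mono)
    ultimately show ?thesis by (simp add: algebra_simps)
  qed
  then show ?thesis using z0(1) u_pos by (intro exI[of _ "min z0 u"]) auto
qed

lemma q_gt:
  assumes v: "0 < v" "v < u"
  shows "v < Op f (\<lambda>_. v) 0"
proof (rule ccontr)
  assume "\<not> v < Op f (\<lambda>_. v) 0"
  moreover obtain v0 where v0: "0 < v0" "\<And>v. 0 < v \<Longrightarrow> v \<le> v0 \<Longrightarrow> v < Op f (\<lambda>_. v) 0"
    using q_small by blast
  define v1 where "v1 = min v0 v"
  have v1: "0 < v1" "v1 \<le> v" "v1 < Op f (\<lambda>_. v1) 0" using v v0 by (auto simp: v1_def)
  have "continuous_on {v1..v} (\<lambda>v. v - Op f (\<lambda>_. v) 0)"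
    by (intro continuous_intros continuous_on_subset[OF q_cont]) (use v v1 in auto)
  ultimately have "\<exists>x\<ge>v1. x \<le> v \<and> x - Op f (\<lambda>_. x) 0 = 0"
    using v1 by (intro IVT') auto
  then obtain x where "v1 \<le> x" "x \<le> v" "Op f (\<lambda>_. x) 0 = x" by auto
  then show False using no_fix[of x] v v1 by simp
qed

lemma q_fix: "0 \<le> v \<Longrightarrow> v \<le> u \<Longrightarrow> Op f (\<lambda>_. v) 0 = v \<Longrightarrow> v = 0 \<or> v = u"
  using q_gt[of v] by fastforce

definition profile :: "(real \<Rightarrow> real) \<Rightarrow> bool" where
  "profile \<phi> \<longleftrightarrow> bm u \<phi> \<and> antimono \<phi> \<and> (\<forall>x. (\<phi> \<longlongrightarrow> \<phi> x) (at_left x))"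

lemma profile_Op: "profile \<phi> \<Longrightarrow> profile (Op f \<phi>)"
  unfolding profile_def using Op_f_bm Op_antimono[OF nl_f f_mono] Op_left_cont[OF nl_f] by blast

lemma profile_translate:
  assumes "profile \<phi>" shows "profile (\<lambda>x. \<phi> (x + r))"
proof -
  have "((\<lambda>x. \<phi> (x + r)) \<longlongrightarrow> \<phi> (x + r)) (at_left x)" for x
    by (rule filterlim_compose[OF _ at_left_translate]) (use assms in \<open>simp add: profile_def\<close>)
  moreover have "antimono (\<lambda>x. \<phi> (x + r))"
    using assms unfolding profile_def antimono_def by simp
  ultimately show ?thesis using assms bm_translate unfolding profile_def by blast
qed

lemma profile_max:
  assumes "profile \<phi>" "profile \<psi>" shows "profile (\<lambda>x. max (\<phi> x) (\<psi> x))"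
proof -
  have "antimono (\<lambda>x. max (\<phi> x) (\<psi> x))"
    using assms unfolding profile_def antimono_def by (intro allI impI max.mono) auto
  moreover have "bm u (\<lambda>x. max (\<phi> x) (\<psi> x))"
    using assms unfolding profile_def bm_def by (auto simp: le_max_iff_disj)
  moreover have "((\<lambda>x. max (\<phi> x) (\<psi> x)) \<longlongrightarrow> max (\<phi> x) (\<psi> x)) (at_left x)" for x
    using assms unfolding profile_def by (intro tendsto_max) auto
  ultimately show ?thesis unfolding profile_def by blast
qed

lemma profile_min_exp:
  assumes "0 < k" "0 < \<mu>"
  shows "profile (\<lambda>x. min u (k * exp (- \<mu> * x)))"
proof -
  have "((\<lambda>x. min u (k * exp (- \<mu> * x))) \<longlongrightarrow> min u (k * exp (- \<mu> * x))) (at_left x)" for x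
    by (intro tendsto_intros)
  moreover have "antimono (\<lambda>x. min u (k * exp (- \<mu> * x)))"
    using assms unfolding antimono_def by (intro allI impI min.mono order_refl mult_left_mono) auto
  ultimately show ?thesis unfolding profile_def bm_def using assms u_pos by auto
qed

lemma profile_step:
  assumes "0 < k" "k \<le> u"
  shows "profile (\<lambda>x. if x \<le> 0 then k else 0)"
proof -
  have "((\<lambda>x. if x \<le> 0 then k else 0) \<longlongrightarrow> (if x \<le> 0 then k else 0)) (at_left x)" for x :: real
  proof (rule tendsto_eventually)
    show "\<forall>\<^sub>F y in at_left x. (if y \<le> 0 then k else 0) = (if x \<le> 0 then k else 0)"
    proof (cases "x \<le> 0")
      case True
      have "\<forall>\<^sub>F y in at_left x. y < x" by (simp add: eventually_at_filter)
      then show ?thesis by eventually_elim (use True in auto)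
    next
      case False
      then have "\<forall>\<^sub>F y in at_left x. 0 < y"
        by (subst eventually_at_left[of 0]) (auto intro!: exI[of _ 0])
      then show ?thesis by eventually_elim (use False in auto)
    qed
  qed
  then show ?thesis unfolding profile_def bm_def using assms by (auto simp: antimono_def)
qed

text \<open>The obstacle keeps the decreasing iteration away from zero; it disappears later as \<open>k \<rightarrow> 0\<close>.\<close>
lemma obstacle_solution:
  assumes k: "0 < k" "k \<le> u" and \<mu>: "0 < \<mu>" and K: "Kern d \<mu> \<le> exp (\<mu> * c)"
  obtains a where "profile a" "\<And>s. a s = max (if s \<le> 0 then k else 0) (Op f a (s + c))"
    "\<And>s. a s \<le> k * exp (- \<mu> * s)"
proof -
  let ?o = "\<lambda>x::real. if x \<le> 0 then k else 0"
  define F where "F \<phi> = (\<lambda>s. max (?o s) (Op f \<phi> (s + c)))" for \<phi>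
  define it where "it n = (F ^^ n) (\<lambda>x. min u (k * exp (- \<mu> * x)))" for n
  have it0: "it 0 = (\<lambda>x. min u (k * exp (- \<mu> * x)))" and itS: "it (Suc n) = F (it n)" for n
    by (auto simp: it_def)
  have FP: "profile (F \<phi>)" if "profile \<phi>" for \<phi>
    unfolding F_def using k that by (intro profile_max profile_step profile_translate profile_Op)
  have P: "profile (it n)" for n
    by (induction n) (use FP in \<open>auto simp: itS it0 profile_min_exp[OF k(1) \<mu>, simplified]\<close>)
  have Fm: "F \<phi> s \<le> F \<psi> s" if "profile \<phi>" "profile \<psi>" "\<And>x. \<phi> x \<le> \<psi> x" for \<phi> \<psi> s
    unfolding F_def using that by (intro max.mono Op_f_mono) (auto simp: profile_def)
  have dec: "it (Suc n) s \<le> it n s" for n s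
  proof (induction n arbitrary: s)
    case 0
    have b0: "bm u (it 0)" using P by (auto simp: profile_def)
    have "Op f (it 0) (s + c) \<le> k * Kern d \<mu> * exp (- \<mu> * (s + c))"
      by (rule Op_le_exp[OF nl_f f_le b0]) (use d_pos in \<open>auto simp: it0\<close>)
    also have "\<dots> \<le> k * exp (\<mu> * c) * exp (- \<mu> * (s + c))"
      using k by (intro mult_right_mono mult_left_mono K) auto
    also have "\<dots> = k * exp (- \<mu> * s)" by (simp add: exp_add[symmetric] mult.assoc algebra_simps)
    finally have 1: "Op f (it 0) (s + c) \<le> k * exp (- \<mu> * s)" .
    have 2: "Op f (it 0) (s + c) \<le> u" by (rule Op_f_le[OF b0])
    have 3: "?o s \<le> k * exp (- \<mu> * s)" using k \<mu> by (auto simp: mult_le_0_iff)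
    show ?case unfolding itS F_def using 1 2 3 k by (auto simp: it0)
  next
    case (Suc n)
    show ?case unfolding itS[of "Suc n"] itS[of n] by (rule Fm) (use P Suc itS in metis)+
  qed
  have nn: "0 \<le> it n s" for n s using P by (auto simp: profile_def bm_def)
  have "convergent (\<lambda>n. it n s)" for s
  proof (rule Bseq_monoseq_convergent)
    have "decseq (\<lambda>n. it n s)" by (rule decseq_SucI) (rule dec)
    then show "monoseq (\<lambda>n. it n s)" by (rule decseq_imp_monoseq)
    show "Bseq (\<lambda>n. it n s)" by (rule BseqI'[of _ u]) (use P in \<open>auto simp: profile_def bm_def\<close>)
  qed
  then obtain a where lim: "\<And>s. (\<lambda>n. it n s) \<longlonglongrightarrow> a s" unfolding convergent_def by metis
  have ge: "a s \<le> it n s" for n s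
    by (rule decseq_ge[OF decseq_SucI lim]) (rule dec)
  have ba: "bm u a"
    unfolding bm_def
  proof (intro conjI allI)
    show "a \<in> borel_measurable borel"
      by (rule borel_measurable_LIMSEQ_real[OF lim]) (use P in \<open>auto simp: profile_def bm_def\<close>)
    show "0 \<le> a x" for x by (rule LIMSEQ_le_const[OF lim]) (use nn in auto)
    show "a x \<le> u" for x by (rule order_trans[OF ge[of x 0]]) (simp add: it0)
  qed
  have am: "antimono a"
  proof (rule antimonoI)
    fix x y :: real assume "x \<le> y"
    then show "a y \<le> a x"
      using P by (intro LIMSEQ_le[OF lim lim]) (auto simp: profile_def antimono_def)
  qed
  have Pa: "profile a"
    unfolding profile_def
  proof (intro conjI allI ba am)
    show "(a \<longlongrightarrow> a x) (at_left x)" for x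
      by (rule left_cont_decreasing_limit[of it]) (use lim ge am P in \<open>auto simp: profile_def\<close>)
  qed
  moreover have "a s = max (?o s) (Op f a (s + c))" for s
  proof (rule LIMSEQ_unique)
    show "(\<lambda>n. it (Suc n) s) \<longlonglongrightarrow> a s" using lim by (rule LIMSEQ_Suc)
    have "(\<lambda>n. Op f (it n) (s + c)) \<longlonglongrightarrow> Op f a (s + c)"
      by (rule Op_tendsto[OF nl_f, of _ _ "{}"]) (use P ba lim in \<open>auto simp: profile_def\<close>)
    then show "(\<lambda>n. it (Suc n) s) \<longlonglongrightarrow> max (?o s) (Op f a (s + c))"
      unfolding itS F_def by (intro tendsto_max tendsto_const)
  qed
  moreover have "a s \<le> k * exp (- \<mu> * s)" for s
    using ge[of s 0] by (simp add: it0)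
  ultimately show ?thesis using that by blast
qed

lemma approx_wave:
  assumes k: "0 < k" "k \<le> u" and \<mu>: "0 < \<mu>" and K: "Kern d \<mu> \<le> exp (\<mu> * c)"
  shows "\<exists>b. profile b \<and> (\<forall>s. \<bar>b s - Op f b (s + c)\<bar> \<le> k) \<and> u / 2 \<le> b 0 \<and> (\<forall>s>0. b s < u / 2)"
proof -
  obtain a where a: "profile a" "\<And>s. a s = max (if s \<le> 0 then k else 0) (Op f a (s + c))"
    "\<And>s. a s \<le> k * exp (- \<mu> * s)"
    using obstacle_solution[OF k \<mu> K] by blast
  have ba: "bm u a" and am: "antimono a" and lc: "\<And>x. (a \<longlongrightarrow> a x) (at_left x)"
    using a(1) by (auto simp: profile_def)
  obtain l1 l2 where l: "(a \<longlongrightarrow> l1) at_bot" "\<And>x. a x \<le> l1"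
    using antimono_limits[OF am bmD(2)[OF ba] bmD(3)[OF ba]] by metis
  have l1: "k \<le> l1" using l(2)[of 0] a(2)[of 0] by (simp add: max_def split: if_splits)
  have l1u: "l1 \<le> u"
    by (rule tendsto_upperbound[OF l(1)]) (auto simp: bmD[OF ba])
  have "l1 = u"
  proof (rule ccontr)
    assume "l1 \<noteq> u"
    then have "l1 < Op f (\<lambda>_. l1) 0" using q_gt l1 l1u k by auto
    moreover have "(Op f a \<longlongrightarrow> Op f (\<lambda>_. l1) 0) at_bot"
      using l1 l1u k by (intro Op_tendsto_at_bot[OF nl_f ba l(1)]) auto
    moreover have "Op f a x \<le> l1" for x
      using a(2)[of "x - c"] l(2)[of "x - c"] by simp
    then have "Op f (\<lambda>_. l1) 0 \<le> l1"
      by (intro tendsto_upperbound[OF calculation(2)]) auto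
    ultimately show False by simp
  qed
  define X where "X = {s. u / 2 \<le> a s}"
  have "\<forall>\<^sub>F s in at_bot. u / 2 < a s"
    using l(1) \<open>l1 = u\<close> u_pos order_tendstoD(1)[OF l(1), of "u / 2"] by simp
  then obtain s1 where "\<forall>s\<le>s1. u / 2 < a s" by (auto simp: eventually_at_bot_linorder)
  then have X1: "X \<noteq> {}" unfolding X_def using less_imp_le[of "u / 2" "a s1"] by blast
  have X2: "bdd_above X"
  proof (rule bdd_aboveI)
    fix s assume "s \<in> X"
    then have "u / 2 \<le> k * exp (- \<mu> * s)" using a(3)[of s] by (simp add: X_def)
    then have "ln (u / 2) \<le> ln (k * exp (- \<mu> * s))" using u_pos k by (subst ln_le_cancel_iff) auto
    also have "\<dots> = ln k - \<mu> * s" using k by (simp add: ln_mult)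
    finally show "s \<le> (ln k - ln (u / 2)) / \<mu>" using \<mu> by (simp add: field_simps)
  qed
  define s0 where "s0 = Sup X"
  have below: "u / 2 \<le> a s" if s: "s < s0" for s
  proof -
    obtain s' where "s' \<in> X" "s < s'" using less_cSup_iff[OF X1 X2, of s] s unfolding s0_def by blast
    then show ?thesis using am by (auto simp: X_def antimono_def intro: order_trans)
  qed
  have at: "u / 2 \<le> a s0"
  proof (rule tendsto_lowerbound[OF lc])
    have "\<forall>\<^sub>F y in at_left s0. y < s0" by (simp add: eventually_at_filter)
    then show "\<forall>\<^sub>F y in at_left s0. u / 2 \<le> a y" by eventually_elim (rule below)
  qed simp
  have above: "a s < u / 2" if "s0 < s" for s
    using cSup_upper[OF _ X2, of s] that by (force simp: X_def s0_def)
  let ?b = "\<lambda>s. a (s + s0)"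
  have "\<bar>?b s - Op f ?b (s + c)\<bar> \<le> k" for s
  proof -
    have "0 \<le> Op f a (s + s0 + c)" by (rule bmD(2)[OF Op_f_bm[OF ba]])
    then have "\<bar>a (s + s0) - Op f a (s + s0 + c)\<bar> \<le> k"
      using a(2)[of "s + s0"] k by (auto simp: max_def split: if_splits)
    then show ?thesis by (simp add: Op_translate add_ac)
  qed
  then show ?thesis using at above profile_translate[OF a(1), of s0] by (intro exI[of _ ?b]) auto
qed

theorem wave_exists:
  assumes cs: "cs \<longlonglongrightarrow> c" and \<mu>: "\<And>n. \<exists>\<mu>>0. Kern d \<mu> \<le> exp (\<mu> * cs n)"
  shows "\<exists>b. profile b \<and> (\<forall>s. Op f b (s + c) = b s) \<and> (b \<longlongrightarrow> u) at_bot \<and> (b \<longlongrightarrow> 0) at_top"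
proof -
  define k where "k n = u / (real n + 1)" for n
  have k: "0 < k n" "k n \<le> u" for n using u_pos by (auto simp: k_def field_simps)
  have k0: "k \<longlonglongrightarrow> 0" unfolding k_def by real_asymp
  have "\<exists>b. profile b \<and> (\<forall>s. \<bar>b s - Op f b (s + cs n)\<bar> \<le> k n) \<and> u / 2 \<le> b 0 \<and> (\<forall>s>0. b s < u / 2)" for n
    using \<mu>[of n] approx_wave[OF k] by blast
  then obtain g where g: "\<And>n. profile (g n)" "\<And>n s. \<bar>g n s - Op f (g n) (s + cs n)\<bar> \<le> k n"
    "\<And>n. u / 2 \<le> g n 0" "\<And>n s. 0 < s \<Longrightarrow> g n s < u / 2"
    by metis
  have gb: "bm u (g n)" and gam: "antimono (g n)" for n using g(1)[of n] by (auto simp: profile_def)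
  have "\<exists>r. strict_mono (r::nat \<Rightarrow> nat) \<and> (\<exists>F. (\<forall>x. continuous (at_right x) F) \<and> mono F \<and> (\<forall>x. \<bar>F x\<bar> \<le> u) \<and>
    (\<forall>x. continuous (at x) F \<longrightarrow> (\<lambda>n. g (r n) (- x)) \<longlonglongrightarrow> F x))"
  proof (rule Helly_selection[of "\<lambda>n x. g n (- x)"])
    fix n x
    show "mono (\<lambda>x. g n (- x))" using gam by (auto simp: antimono_def intro: monoI)
    show "\<bar>g n (- x)\<bar> \<le> u" using bmD(4)[OF gb] .
    have "(g n \<longlongrightarrow> g n (- x)) (at_left (- x))" using g(1) by (simp add: profile_def)
    then show "continuous (at_right x) (\<lambda>x. g n (- x))"
      by (simp add: continuous_within filterlim_at_left_to_right)
  qed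
  then obtain r F where r: "strict_mono r" and F: "\<And>x. continuous (at_right x) F" "mono F" "\<And>x. \<bar>F x\<bar> \<le> u"
    "\<And>x. isCont F x \<Longrightarrow> (\<lambda>n. g (r n) (- x)) \<longlonglongrightarrow> F x" by blast
  define b where "b x = F (- x)" for x
  have bam: "antimono b" using F(2) by (auto simp: b_def antimono_def mono_def)
  have blc: "(b \<longlongrightarrow> b x) (at_left x)" for x
    using F(1)[of "- x"] by (simp add: b_def[abs_def] continuous_within filterlim_at_left_to_right)
  define D where "D = uminus ` {x. \<not> isCont F x}"
  have D: "countable D" unfolding D_def by (intro countable_image mono_ctble_discont F)
  have FD: "isCont F (- x)" if "x \<notin> D" for x using that by (auto simp: D_def image_iff)
  have blim: "(\<lambda>n. g (r n) x) \<longlonglongrightarrow> b x" if "x \<notin> D" for x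
    using F(4)[OF FD[OF that]] by (simp add: b_def)
  have bcont: "isCont b x" if "x \<notin> D" for x
    unfolding b_def[abs_def] using isCont_o2[where f=uminus and g=F and a=x] FD[OF that] by simp
  have "0 \<le> b x" for x
  proof -
    obtain y where y: "x < y" "y \<notin> D" using ex_real_notin_countable[OF D, of x "x + 1"] by auto
    have "0 \<le> b y" by (rule LIMSEQ_le_const[OF blim[OF y(2)]]) (use bmD(2)[OF gb] in auto)
    then show ?thesis using bam y by (auto simp: antimono_def intro: order_trans)
  qed
  moreover have "b x \<le> u" for x using F(3)[of "- x"] by (simp add: b_def abs_le_iff)
  moreover have "b \<in> borel_measurable borel"
  proof -
    have [measurable]: "F \<in> borel_measurable borel" by (rule borel_measurable_mono[OF F(2)])
    show ?thesis unfolding b_def[abs_def] by measurable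
  qed
  ultimately have bb: "bm u b" by (auto simp: bm_def)
  have Pb: "profile b" unfolding profile_def using bb bam blc by auto
  have off: "b s = Op f b (s + c)" if s: "s \<notin> D" "s + c \<notin> D" for s
  proof -
    have cr: "(\<lambda>n. cs (r n) - c) \<longlonglongrightarrow> 0"
      using LIMSEQ_subseq_LIMSEQ[OF cs r] by (simp add: o_def LIM_zero_iff)
    have "(\<lambda>n. Op f (\<lambda>y. g (r n) (y + (cs (r n) - c))) (s + c)) \<longlonglongrightarrow> Op f b (s + c)"
    proof (rule Op_tendsto[OF nl_f bm_translate[OF gb] bb D])
      show "(\<lambda>n. g (r n) (x + (cs (r n) - c))) \<longlonglongrightarrow> b x" if "x \<notin> D" for x
        using moving_tendsto[of "\<lambda>n. g (r n)" D b x, OF gam D blim bcont[OF that] cr] .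
    qed (use s in auto)
    then have 1: "(\<lambda>n. Op f (g (r n)) (s + cs (r n))) \<longlonglongrightarrow> Op f b (s + c)"
      by (simp add: Op_translate)
    have "(\<lambda>n. g (r n) s - Op f (g (r n)) (s + cs (r n))) \<longlonglongrightarrow> 0"
    proof (rule Lim_null_comparison)
      show "(\<lambda>n. k (r n)) \<longlonglongrightarrow> 0" using LIMSEQ_subseq_LIMSEQ[OF k0 r] by (simp add: o_def)
    qed (use g(2) in auto)
    from LIMSEQ_unique[OF this tendsto_diff[OF blim[OF s(1)] 1]] show ?thesis by simp
  qed
  have eq: "b s = Op f b (s + c)" for s
  proof (rule ccontr)
    assume ne: "b s \<noteq> Op f b (s + c)"
    have "((\<lambda>y. Op f b (y + c)) \<longlongrightarrow> Op f b (s + c)) (at_left s)"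
      by (rule filterlim_compose[OF Op_left_cont[OF nl_f bb blc] at_left_translate])
    from tendsto_diff[OF blc this] have "((\<lambda>y. b y - Op f b (y + c)) \<longlongrightarrow> b s - Op f b (s + c)) (at_left s)" .
    then have "\<forall>\<^sub>F y in at_left s. b y - Op f b (y + c) \<noteq> 0"
      by (rule tendsto_imp_eventually_ne) (use ne in simp)
    then obtain y0 where y0: "y0 < s" "\<And>y. y0 < y \<Longrightarrow> y < s \<Longrightarrow> b y - Op f b (y + c) \<noteq> 0"
      using eventually_at_left[of "s - 1" s] by auto
    have "countable (D \<union> (\<lambda>x. x - c) ` D)" using D by simp
    from ex_real_notin_countable[OF this y0(1)] obtain y where y: "y0 < y" "y < s" "y \<notin> D" "y \<notin> (\<lambda>x. x - c) ` D" by auto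
    then have "y + c \<notin> D" by (metis add_diff_cancel_right' image_eqI)
    then show False using off[of y] y0(2)[of y] y by simp
  qed
  obtain l1 l2 where l: "(b \<longlongrightarrow> l1) at_bot" "(b \<longlongrightarrow> l2) at_top" "\<And>x. b x \<le> l1" "\<And>x. l2 \<le> b x"
    using antimono_limits[OF bam bmD(2)[OF bb] bmD(3)[OF bb]] by metis
  have lr: "0 \<le> l1" "l1 \<le> u" "0 \<le> l2" "l2 \<le> u"
  proof -
    show "0 \<le> l1" "l2 \<le> u" using l(3,4)[of 0] bmD(2,3)[OF bb, of 0] by linarith+
    show "l1 \<le> u" by (rule tendsto_upperbound[OF l(1)]) (auto simp: bmD(3)[OF bb])
    show "0 \<le> l2" by (rule tendsto_lowerbound[OF l(2)]) (auto simp: bmD(2)[OF bb])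
  qed
  have sh: "filterlim (\<lambda>s. s + c) at_bot at_bot" "filterlim (\<lambda>s. s + c) at_top at_top"
    by real_asymp+
  have q: "Op f (\<lambda>_. l1) 0 = l1" "Op f (\<lambda>_. l2) 0 = l2"
  proof -
    have "((\<lambda>s. Op f b (s + c)) \<longlongrightarrow> Op f (\<lambda>_. l1) 0) at_bot"
      by (rule filterlim_compose[OF Op_tendsto_at_bot[OF nl_f bb l(1) lr(1,2)] sh(1)])
    then have "(b \<longlongrightarrow> Op f (\<lambda>_. l1) 0) at_bot" by (simp only: eq[symmetric])
    from tendsto_unique[OF _ this l(1)] show "Op f (\<lambda>_. l1) 0 = l1" by simp
    have "((\<lambda>s. Op f b (s + c)) \<longlongrightarrow> Op f (\<lambda>_. l2) 0) at_top"
      by (rule filterlim_compose[OF Op_tendsto_at_top[OF nl_f bb l(2) lr(3,4)] sh(2)])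
    then have "(b \<longlongrightarrow> Op f (\<lambda>_. l2) 0) at_top" by (simp only: eq[symmetric])
    from tendsto_unique[OF _ this l(2)] show "Op f (\<lambda>_. l2) 0 = l2" by simp
  qed
  have "u / 2 \<le> l1"
  proof -
    obtain y where y: "y < 0" "y \<notin> D" using ex_real_notin_countable[OF D, of "-1" 0] by auto
    have "u / 2 \<le> g n y" for n
      using g(3)[of n] antimonoD[OF gam[of n], of y 0] y by linarith
    then have "u / 2 \<le> b y" by (intro LIMSEQ_le_const[OF blim[OF y(2)]]) auto
    then show ?thesis using l(3)[of y] by simp
  qed
  moreover have "l2 \<le> u / 2"
  proof -
    obtain y where y: "0 < y" "y \<notin> D" using ex_real_notin_countable[OF D, of 0 1] by auto
    have "b y \<le> u / 2" by (rule LIMSEQ_le_const2[OF blim[OF y(2)]]) (use g(4)[OF y(1)] in \<open>auto intro: less_imp_le\<close>)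
    then show ?thesis using l(4)[of y] by simp
  qed
  ultimately have "l1 = u" "l2 = 0" using q_fix[OF lr(1,2) q(1)] q_fix[OF lr(3,4) q(2)] u_pos by auto
  then show ?thesis using Pb eq l(1,2) by (intro exI[of _ b]) auto
qed

end

section \<open>Nonexistence below the critical speed\<close>

lemma exp_sum_ge:
  fixes p g :: "'i \<Rightarrow> real"
  assumes "finite I" "\<And>j. j \<in> I \<Longrightarrow> 0 \<le> p j" "(\<Sum>j\<in>I. p j) = 1"
  shows "exp (\<Sum>j\<in>I. p j * g j) \<le> (\<Sum>j\<in>I. p j * exp (g j))"
proof -
  define G where "G = (\<Sum>j\<in>I. p j * g j)"
  have "exp G = exp G * (\<Sum>j\<in>I. p j * (1 + (g j - G)))"
    using assms(3) by (simp add: algebra_simps sum.distrib sum_subtractf G_def flip: sum_distrib_left sum_distrib_right)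
  also have "\<dots> \<le> exp G * (\<Sum>j\<in>I. p j * exp (g j - G))"
    using assms by (intro mult_left_mono sum_mono exp_ge_add_one_self) auto
  also have "\<dots> = (\<Sum>j\<in>I. p j * exp (g j))"
    by (simp add: sum_distrib_left exp_diff mult_ac)
  finally show ?thesis by (simp add: G_def)
qed

lemma sum_shift_bound:
  fixes g :: "int \<Rightarrow> real"
  assumes C: "\<And>i. \<bar>i\<bar> \<le> int L \<Longrightarrow> \<bar>g i\<bar> \<le> C" "\<And>i. \<bar>i\<bar> \<le> int L \<Longrightarrow> \<bar>g (int N + i)\<bar> \<le> C"
    and k: "\<bar>k\<bar> \<le> int L"
  shows "\<bar>(\<Sum>i<N. g (int i - k)) - (\<Sum>i<N. g (int i))\<bar> \<le> 2 * real L * C"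
proof -
  have C0: "0 \<le> C" using C(1)[of 0] by simp
  have step: "(\<Sum>i<N. g (int i - (k + 1))) - (\<Sum>i<N. g (int i - k)) = g (- 1 - k) - g (int N - 1 - k)" for k
  proof (induction N)
    case (Suc N)
    then show ?case by (simp add: algebra_simps)
  qed simp
  have pos: "\<bar>(\<Sum>i<N. g (int i - int k)) - (\<Sum>i<N. g (int i))\<bar> \<le> 2 * real k * C" if "k \<le> L" for k
    using that
  proof (induction k)
    case (Suc k)
    have "\<bar>g (- 1 - int k)\<bar> \<le> C" by (rule C) (use Suc in auto)
    moreover have "\<bar>g (int N - 1 - int k)\<bar> \<le> C"
      using C(2)[of "- 1 - int k"] Suc.prems by (simp add: algebra_simps)
    moreover have "\<bar>(\<Sum>i<N. g (int i - int k)) - (\<Sum>i<N. g (int i))\<bar> \<le> 2 * real k * C"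
      using Suc by simp
    moreover have "(\<Sum>i<N. g (int i - int (Suc k))) - (\<Sum>i<N. g (int i - int k)) = g (- 1 - int k) - g (int N - 1 - int k)"
      using step[of "int k"] by (simp add: add.commute)
    ultimately have "\<bar>(\<Sum>i<N. g (int i - int (Suc k))) - (\<Sum>i<N. g (int i))\<bar> \<le> 2 * real k * C + 2 * C"
      by linarith
    then show ?case by (simp add: algebra_simps)
  qed simp
  have neg: "\<bar>(\<Sum>i<N. g (int i + int k)) - (\<Sum>i<N. g (int i))\<bar> \<le> 2 * real k * C" if "k \<le> L" for k
    using that
  proof (induction k)
    case (Suc k)
    have "\<bar>g (int k)\<bar> \<le> C" by (rule C) (use Suc in auto)
    moreover have "\<bar>g (int N + int k)\<bar> \<le> C" by (rule C) (use Suc in auto)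
    moreover have "\<bar>(\<Sum>i<N. g (int i + int k)) - (\<Sum>i<N. g (int i))\<bar> \<le> 2 * real k * C"
      using Suc by simp
    moreover have "(\<Sum>i<N. g (int i + int k)) - (\<Sum>i<N. g (int i + int (Suc k))) = g (int k) - g (int N + int k)"
      using step[of "- int (Suc k)"] by (simp add: algebra_simps)
    ultimately have "\<bar>(\<Sum>i<N. g (int i + int (Suc k))) - (\<Sum>i<N. g (int i))\<bar> \<le> 2 * real k * C + 2 * C"
      by linarith
    then show ?case by (simp add: algebra_simps)
  qed simp
  have "2 * real (nat \<bar>k\<bar>) * C \<le> 2 * real L * C"
    using k C0 by (intro mult_right_mono) auto
  moreover have "\<bar>(\<Sum>i<N. g (int i - k)) - (\<Sum>i<N. g (int i))\<bar> \<le> 2 * real (nat \<bar>k\<bar>) * C"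
  proof (cases "0 \<le> k")
    case True then show ?thesis using pos[of "nat k"] k by simp
  next
    case False then show ?thesis using neg[of "nat (- k)"] k by (simp add: nat_le_iff)
  qed
  ultimately show ?thesis by linarith
qed

text \<open>Tilting the kernel by its would-be decay rate \<open>a\<close> turns the inequality into one for
  \<open>g i = ln (b i) + a i\<close> with a constant gain at every site; summing over a long window, all
  contributions except boundary terms cancel.\<close>
lemma lattice_supersolution:
  fixes b \<kappa> :: "int \<Rightarrow> real" and m :: nat
  assumes pos: "\<And>i. 0 < b i" and am: "antimono b" and m: "0 < m"
    and \<theta>: "0 < \<theta>" "\<theta> \<le> 1" "\<And>i. 0 \<le> i \<Longrightarrow> \<theta> * b (i - int m) \<le> b i"
    and I: "finite I" "\<And>j. j \<in> I \<Longrightarrow> 0 \<le> \<kappa> j"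
    and sup: "\<And>i. 0 \<le> i \<Longrightarrow> (\<Sum>j\<in>I. \<kappa> j * b (i - j)) \<le> b (i - int m)"
    and rate: "\<And>e N0. 0 < e \<Longrightarrow> \<exists>N\<ge>N0. \<bar>ln (b (int N)) + a * real N\<bar> \<le> e * real N"
  shows "(\<Sum>j\<in>I. \<kappa> j * exp (a * of_int j)) \<le> exp (a * real m)"
proof (rule ccontr)
  define Z where "Z = (\<Sum>j\<in>I. \<kappa> j * exp (a * of_int j))"
  assume "\<not> ?thesis"
  then have Z: "exp (a * real m) < Z" by (simp add: Z_def)
  have Z0: "0 < Z" using Z exp_gt_zero[of "a * real m"] by linarith
  define \<eta> where "\<eta> = ln Z - a * real m"
  have "ln (exp (a * real m)) < ln Z" using Z Z0 by (subst ln_less_cancel_iff) auto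
  then have \<eta>: "0 < \<eta>" by (simp add: \<eta>_def)
  define g where "g i = ln (b i) + a * of_int i" for i
  have eg: "exp (g i) = b i * exp (a * of_int i)" for i using pos by (simp add: g_def exp_add)
  define p where "p j = \<kappa> j * exp (a * of_int j) / Z" for j
  have p: "\<And>j. j \<in> I \<Longrightarrow> 0 \<le> p j" "(\<Sum>j\<in>I. p j) = 1"
    using I Z0 by (auto simp: p_def Z_def simp flip: sum_divide_distrib)
  have key: "\<eta> + (\<Sum>j\<in>I. p j * g (i - j)) \<le> g (i - int m)" if i: "0 \<le> i" for i
  proof -
    have "Z * exp (\<Sum>j\<in>I. p j * g (i - j)) \<le> Z * (\<Sum>j\<in>I. p j * exp (g (i - j)))"
      using Z0 by (intro mult_left_mono exp_sum_ge I p) auto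
    also have "\<dots> = (\<Sum>j\<in>I. \<kappa> j * b (i - j)) * exp (a * of_int i)"
      unfolding sum_distrib_left sum_distrib_right
    proof (rule sum.cong)
      fix j
      have "exp (a * of_int j) * exp (a * of_int (i - j)) = exp (a * of_int i)"
        by (simp add: exp_add[symmetric] algebra_simps)
      then show "Z * (p j * exp (g (i - j))) = \<kappa> j * b (i - j) * exp (a * of_int i)"
        using Z0 by (simp add: p_def eg mult_ac)
    qed simp
    also have "\<dots> \<le> b (i - int m) * exp (a * of_int i)"
      by (intro mult_right_mono sup i) simp
    finally have "ln (Z * exp (\<Sum>j\<in>I. p j * g (i - j))) \<le> ln (b (i - int m) * exp (a * of_int i))"
      using Z0 pos by (subst ln_le_cancel_iff) auto
    then show ?thesis using Z0 pos[of "i - int m"] by (simp add: ln_mult g_def \<eta>_def algebra_simps)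
  qed
  define L where "L = m + nat (Max (insert 0 (abs ` I)))"
  have IL: "\<bar>j\<bar> \<le> int L" if "j \<in> I" for j
  proof -
    have "\<bar>j\<bar> \<le> Max (insert 0 (abs ` I))" using I that by (intro Max_ge) auto
    then show ?thesis unfolding L_def by linarith
  qed
  have mL: "m \<le> L" by (simp add: L_def)
  define R where "R = real L * (- ln \<theta>) + \<bar>a\<bar> * real L"
  define G0 where "G0 = (\<Sum>i\<in>{- int L..int L}. \<bar>g i\<bar>)"
  have G0: "\<bar>g i\<bar> \<le> G0" if "\<bar>i\<bar> \<le> int L" for i
    unfolding G0_def by (rule member_le_sum[of i _ "\<lambda>i. \<bar>g i\<bar>"]) (use that in auto)
  have G0nn: "0 \<le> G0" unfolding G0_def by (simp add: sum_nonneg)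
  have Rnn: "0 \<le> R" unfolding R_def using \<theta> by (intro add_nonneg_nonneg mult_nonneg_nonneg) auto
  have iter: "\<theta> ^ q * b (i - int q * int m) \<le> b i" if "int q * int m \<le> i" for q i
    using that
  proof (induction q arbitrary: i)
    case (Suc q)
    have "\<theta> ^ Suc q * b (i - int (Suc q) * int m) = \<theta> * (\<theta> ^ q * b ((i - int m) - int q * int m))"
      by (simp add: algebra_simps)
    also have "\<dots> \<le> \<theta> * b (i - int m)"
      using Suc.prems \<theta> by (intro mult_left_mono Suc.IH) (auto simp: algebra_simps)
    also have "\<dots> \<le> b i" using Suc.prems by (intro \<theta>) (auto intro: order_trans[rotated])
    finally show ?case .
  qed simp
  have osc: "\<bar>g (int N + l)\<bar> \<le> \<bar>g (int N)\<bar> + R" if N: "L * m \<le> N" and l: "\<bar>l\<bar> \<le> int L" for N l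
  proof -
    have LLm: "int L \<le> int L * int m" using m by (simp add: mult_le_cancel_left1)
    have N': "int L * int m \<le> int N" using N by (metis of_nat_le_iff of_nat_mult)
    have lnb: "ln (\<theta> ^ L * b i) = real L * ln \<theta> + ln (b i)" for i
      using \<theta> pos[of i] by (simp add: ln_mult ln_realpow)
    have "ln (b (int N)) + real L * ln \<theta> \<le> ln (b (int N + l))"
    proof -
      have "\<theta> ^ L * b (int N) \<le> \<theta> ^ L * b ((int N + l) - int L * int m)" if "0 \<le> l"
        using \<theta> l LLm by (intro mult_left_mono antimonoD[OF am]) auto
      also have "\<theta> ^ L * b ((int N + l) - int L * int m) \<le> b (int N + l)" if "0 \<le> l"
        by (rule iter) (use N' that in auto)
      finally have "ln (\<theta> ^ L * b (int N)) \<le> ln (b (int N + l))" if "0 \<le> l"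
        using that \<theta> pos by (subst ln_le_cancel_iff) auto
      then have 1: ?thesis if "0 \<le> l" using that by (simp add: lnb)
      have "ln (b (int N)) \<le> ln (b (int N + l))" if "l < 0"
        using pos that antimonoD[OF am, of "int N + l" "int N"] by (subst ln_le_cancel_iff) auto
      moreover have "real L * ln \<theta> \<le> 0" using \<theta> by (simp add: mult_nonneg_nonpos)
      ultimately have ?thesis if "l < 0" using that by linarith
      with 1 show ?thesis by linarith
    qed
    moreover have "ln (b (int N + l)) \<le> ln (b (int N)) - real L * ln \<theta>"
    proof -
      have "\<theta> ^ L * b (int N + l) \<le> \<theta> ^ L * b (int N - int L * int m)"
        using \<theta> l LLm by (intro mult_left_mono antimonoD[OF am]) auto
      also have "\<dots> \<le> b (int N)" by (rule iter) (use N' in auto)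
      finally have "ln (\<theta> ^ L * b (int N + l)) \<le> ln (b (int N))"
        using \<theta> pos by (subst ln_le_cancel_iff) auto
      then show ?thesis by (simp add: lnb)
    qed
    moreover have "\<bar>a * of_int l\<bar> \<le> \<bar>a\<bar> * real L"
    proof -
      have "\<bar>real_of_int l\<bar> \<le> real L" using l by linarith
      then show ?thesis by (simp add: abs_mult mult_left_mono)
    qed
    moreover have "g (int N + l) = ln (b (int N + l)) + (a * real N + a * of_int l)"
      and "g (int N) = ln (b (int N)) + a * real N" by (simp_all add: g_def algebra_simps)
    ultimately show ?thesis unfolding R_def by linarith
  qed
  have main: "\<eta> * real N \<le> 4 * real L * (G0 + R + \<bar>g (int N)\<bar>)" if N: "L * m \<le> N" for N
  proof -
    define C where "C = G0 + R + \<bar>g (int N)\<bar>"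
    define S where "S k = (\<Sum>i<N. g (int i - k))" for k
    have C: "\<bar>g i\<bar> \<le> C" "\<bar>g (int N + i)\<bar> \<le> C" if "\<bar>i\<bar> \<le> int L" for i
      using G0[OF that] osc[OF N that] Rnn G0nn by (auto simp: C_def)
    have S: "\<bar>S k - (\<Sum>i<N. g (int i))\<bar> \<le> 2 * real L * C" if "\<bar>k\<bar> \<le> int L" for k
      unfolding S_def by (rule sum_shift_bound[of L g C N k, OF C that])
    have "\<eta> * real N + (\<Sum>j\<in>I. p j * S j) = (\<Sum>i<N. \<eta> + (\<Sum>j\<in>I. p j * g (int i - j)))"
      by (simp add: S_def sum.distrib sum_distrib_left sum.swap[of _ "{..<N}" I] mult.commute)
    also have "\<dots> \<le> (\<Sum>i<N. g (int i - int m))" by (intro sum_mono key) simp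
    finally have "\<eta> * real N \<le> S (int m) - (\<Sum>j\<in>I. p j * S j)" by (simp add: S_def)
    also have "\<dots> = (\<Sum>j\<in>I. p j * (S (int m) - S j))"
      using p(2) by (simp add: right_diff_distrib sum_subtractf flip: sum_distrib_right)
    also have "\<dots> \<le> (\<Sum>j\<in>I. p j * (4 * real L * C))"
    proof (intro sum_mono mult_left_mono p)
      fix j assume "j \<in> I"
      show "S (int m) - S j \<le> 4 * real L * C"
        using S[of "int m"] S[OF IL[OF \<open>j \<in> I\<close>]] mL by simp
    qed
    also have "\<dots> = 4 * real L * C" using p(2) by (simp flip: sum_distrib_right)
    finally show ?thesis by (simp add: C_def)
  qed
  have L0: "0 < real L" using m mL by simp
  define e where "e = \<eta> / (16 * real L)"
  have e: "0 < e" using \<eta> L0 by (simp add: e_def)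
  obtain N1 :: nat where N1: "8 * real L * (G0 + R) / \<eta> < real N1" using reals_Archimedean2 by blast
  obtain N where N: "max (max (L * m) N1) 1 \<le> N" "\<bar>ln (b (int N)) + a * real N\<bar> \<le> e * real N"
    using rate[OF e] by blast
  have "\<bar>g (int N)\<bar> \<le> e * real N" using N by (simp add: g_def)
  then have "4 * real L * \<bar>g (int N)\<bar> \<le> 4 * real L * (e * real N)" using L0 by (intro mult_left_mono) auto
  also have "\<dots> = \<eta> * real N / 4" using L0 by (simp add: e_def)
  finally have 1: "4 * real L * \<bar>g (int N)\<bar> \<le> \<eta> * real N / 4" .
  have "8 * real L * (G0 + R) < real N1 * \<eta>" using N1 \<eta> by (simp add: divide_less_eq)
  also have "\<dots> \<le> real N * \<eta>" using N \<eta> by (intro mult_right_mono) auto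
  finally have 2: "4 * real L * (G0 + R) < \<eta> * real N / 2" by (simp add: mult_ac)
  have "\<eta> * real N \<le> 4 * real L * (G0 + R) + 4 * real L * \<bar>g (int N)\<bar>"
    using main[of N] N by (simp add: algebra_simps)
  with 1 2 have "\<eta> * real N < 3 / 4 * (\<eta> * real N)" by linarith
  moreover have "0 < \<eta> * real N" using \<eta> N by simp
  ultimately show False by linarith
qed

context season
begin

lemma Kern_mult_le: "0 \<le> e \<Longrightarrow> e \<le> 1 \<Longrightarrow> (1 - e) * Kern d \<mu> \<le> Kern ((1 - e) * d) \<mu>"
proof -
  assume e: "0 \<le> e" "e \<le> 1"
  define J where "J = (\<integral>s. W s * tilt d \<mu> s \<partial>S)"
  have "(\<integral>s. W s * tilt ((1 - e) * d) \<mu> s \<partial>S) = (1 - e) * J"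
    unfolding J_def by (subst integral_mult_right_zero[symmetric]) (simp only: mult_ac)
  moreover have "(1 - e) * (a0 * nmgf \<mu> A0) \<le> 1 * (a0 * nmgf \<mu> A0)"
    using e a0_nonneg by (intro mult_right_mono) auto
  ultimately show ?thesis unfolding Kern_def J_def[symmetric] by (simp add: distrib_left)
qed

lemma Lin_mono: "0 \<le> d \<Longrightarrow> bm M \<phi> \<Longrightarrow> bm M \<psi> \<Longrightarrow> (\<And>x. \<phi> x \<le> \<psi> x) \<Longrightarrow> Lin d \<phi> x \<le> Lin d \<psi> x"
  by (rule Op_mono[OF nl_lin _ nl_lin, of d M]) (auto simp: mult_left_mono)

lemma Lin_scale_le:
  assumes "0 \<le> d" "bm M \<phi>"
  shows "(1/2) * Lin d \<phi> x \<le> Lin ((1/2 * d)) \<phi> x"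
proof -
  have "lseas (1/2 * d) \<phi> s x = (1/2) * lseas d \<phi> s x" for s
  proof -
    show ?thesis unfolding seas_def gavg_cmult_fun by simp
  qed
  then have i1: "(\<integral>s. W s * lseas (1/2 * d) \<phi> s x \<partial>S) = (1/2) * (\<integral>s. W s * lseas d \<phi> s x \<partial>S)"
    by (simp only: mult.left_commute[of _ "1/2"] integral_mult_right_zero)
  have "0 \<le> a0 * gavg A0 \<phi> x"
    using a0_nonneg bmD(2)[OF bm_gavg[OF assms(2)]] by simp
  then show ?thesis unfolding Op_def i1 distrib_left by simp
qed

theorem no_slow_wave:
  assumes c: "0 < c" and d: "0 < d"
    and f: "continuous_on UNIV f" "\<And>z. 0 < z \<Longrightarrow> 0 < f z" "f 0 = 0"
    and f_ge: "\<And>e. 0 < e \<Longrightarrow> \<exists>z0>0. \<forall>z. 0 \<le> z \<longrightarrow> z \<le> z0 \<longrightarrow> (1 - e) * d * z \<le> f z"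
    and \<phi>: "bm M \<phi>" "\<And>x. Op f \<phi> x = \<phi> (x - c)"
    and lim: "(\<phi> \<longlongrightarrow> l) at_bot" "0 < l" "(\<phi> \<longlongrightarrow> 0) at_top"
    and spread: "\<And>y. 0 < Lin d (indicator {..y}) 0"
    and fast: "\<And>\<mu>. 0 \<le> \<mu> \<Longrightarrow> exp (\<mu> * c) < Kern d \<mu>"
  shows False
proof -

  have fnn: "0 \<le> f z" if "0 \<le> z" for z using f(2)[of z] f(3) that by (cases "z = 0") auto
  have cont: "continuous_on X f" for X using f(1) continuous_on_subset by blast
  obtain M' where nlf: "nl M M' f"
  proof -
    have "compact (f ` {0..M})" by (intro compact_continuous_image cont) simp
    then obtain M' where "\<forall>y\<in>f ` {0..M}. \<bar>y\<bar> \<le> M'" using compact_imp_bounded bounded_real by blast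
    then have "nl M M' f" unfolding nl_def using f(1) fnn by force
    then show ?thesis by (rule that)
  qed
  have low: "\<exists>\<epsilon>>0. (\<forall>z. 0 \<le> z \<longrightarrow> z \<le> M \<longrightarrow> (1 - e) * d * min z \<epsilon> \<le> f z)" if e: "0 < e" "e < 1" for e
  proof -
    obtain z0 where z0: "0 < z0" "\<And>z. 0 \<le> z \<Longrightarrow> z \<le> z0 \<Longrightarrow> (1 - e) * d * z \<le> f z"
      using f_ge[OF e(1)] by blast
    obtain m where m: "0 < m" "\<And>z. z0 \<le> z \<Longrightarrow> z \<le> M \<Longrightarrow> m \<le> f z"
    proof (cases "z0 \<le> M")
      case True
      then obtain y where y: "y \<in> {z0..M}" "\<And>z. z \<in> {z0..M} \<Longrightarrow> f y \<le> f z"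
        using continuous_attains_inf[of "{z0..M}" f] cont by auto
      show ?thesis by (rule that[of "f y"]) (use y f(2) z0 in auto)
    next
      case False then show ?thesis by (intro that[of 1]) auto
    qed
    define \<epsilon> where "\<epsilon> = min (min z0 (m / d)) 1"
    have \<epsilon>: "0 < \<epsilon>" "\<epsilon> \<le> z0" "\<epsilon> * d \<le> m" "\<epsilon> \<le> 1"
    proof -
      have "\<epsilon> \<le> m / d" unfolding \<epsilon>_def by linarith
      then show "\<epsilon> * d \<le> m" using d by (simp add: le_divide_eq)
    qed (use m z0 d in \<open>auto simp: \<epsilon>_def\<close>)
    have "(1 - e) * d * min z \<epsilon> \<le> f z" if z: "0 \<le> z" "z \<le> M" for z
    proof (cases "z \<le> z0")
      case True
      have "(1 - e) * d * min z \<epsilon> \<le> (1 - e) * d * z" using e d by (intro mult_left_mono) auto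
      then show ?thesis using z0(2)[OF z(1) True] by linarith
    next
      case False
      have "(1 - e) * d * min z \<epsilon> \<le> 1 * d * \<epsilon>" using e d \<epsilon> z by (intro mult_mono) auto
      also have "\<dots> \<le> m" using \<epsilon> by (simp add: mult.commute)
      finally show ?thesis using m(2)[of z] False z by linarith
    qed
    then show ?thesis using \<epsilon> by (intro exI[of _ \<epsilon>]) auto
  qed
  define v where "v x = Inf (\<phi> ` {..x})" for x
  have bdd: "bdd_below (\<phi> ` X)" for X by (rule bdd_belowI[of _ 0]) (use bmD(2)[OF \<phi>(1)] in auto)
  have vle: "v x \<le> \<phi> y" if "y \<le> x" for x y
    unfolding v_def by (rule cInf_lower[OF _ bdd]) (use that in auto)
  have vge: "k \<le> v x" if "\<And>y. y \<le> x \<Longrightarrow> k \<le> \<phi> y" for k x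
    unfolding v_def by (rule cInf_greatest) (use that in auto)
  have vnn: "0 \<le> v x" for x by (rule vge) (rule bmD(2)[OF \<phi>(1)])
  have vam: "antimono v" by (rule antimonoI, rule vge, rule vle) simp
  have vm: "v \<in> borel_measurable borel"
  proof -
    have "mono (\<lambda>x. - v x)" using vam by (auto simp: antimono_def mono_def)
    then have "(\<lambda>x. - v x) \<in> borel_measurable borel" by (rule borel_measurable_mono)
    then show ?thesis by simp
  qed
  have vM: "v x \<le> M" for x using vle[of x x] bmD(3)[OF \<phi>(1), of x] by simp
  have v0: "(v \<longlongrightarrow> 0) at_top"
    by (rule tendsto_sandwich[OF _ _ tendsto_const lim(3)]) (use vnn vle in auto)
  have bw: "bm \<epsilon> (\<lambda>x. min (v x) \<epsilon>)" "bm M (\<lambda>x. min (v x) \<epsilon>)" if "0 < \<epsilon>" for \<epsilon>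
    using vm vnn vM that by (auto simp: bm_def min_le_iff_disj)
  have sup: "Lin ((1 - e) * d) (\<lambda>x. min (v x) \<epsilon>) x \<le> v (x - c)"
    if e: "0 < e" "e < 1" and \<epsilon>: "0 < \<epsilon>" "\<And>z. 0 \<le> z \<Longrightarrow> z \<le> M \<Longrightarrow> (1 - e) * d * min z \<epsilon> \<le> f z" for e \<epsilon> x
  proof (rule vge)
    fix y assume y: "y \<le> x - c"
    let ?w = "\<lambda>x. min (v x) \<epsilon>" and ?k = "(1 - e) * d"
    have k: "0 \<le> ?k" using e d by simp
    have wam: "antimono ?w" using vam unfolding antimono_def by (intro allI impI min.mono) auto
    have nl1: "nl K (?k * \<epsilon>) (\<lambda>z. ?k * min z \<epsilon>)" for K
      using k \<epsilon>(1) unfolding nl_def by (auto intro!: continuous_intros mult_left_mono mult_nonneg_nonneg)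
    have "antimono (Lin ?k ?w)"
      using k by (intro Op_antimono[OF nl_lin _ bw(1)[OF \<epsilon>(1)] wam]) (auto simp: mono_on_def mult_left_mono)
    then have "Lin ?k ?w x \<le> Lin ?k ?w (y + c)"
      by (rule antimonoD) (use y in simp)
    also have "\<dots> \<le> Op (\<lambda>z. ?k * min z \<epsilon>) ?w (y + c)"
      using k by (intro Op_mono[OF nl_lin[OF k] bw(1)[OF \<epsilon>(1)] nl1 bw(1)[OF \<epsilon>(1)]] mult_left_mono) auto
    also have "\<dots> \<le> Op f \<phi> (y + c)"
    proof (rule Op_mono[OF nl1 bw(2)[OF \<epsilon>(1)] nlf \<phi>(1)])
      show "min (v x) \<epsilon> \<le> \<phi> x" for x using vle[of x x] by simp
      show "?k * min z \<epsilon> \<le> f w" if "0 \<le> z" "z \<le> w" "w \<le> M" for z w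
      proof -
        have "?k * min z \<epsilon> \<le> ?k * min w \<epsilon>" using k that by (intro mult_left_mono) auto
        then show ?thesis using \<epsilon>(2)[of w] that by linarith
      qed
    qed
    also have "\<dots> = \<phi> y" by (simp add: \<phi>(2))
    finally show "Lin ?k ?w x \<le> \<phi> y" .
  qed
  have ind: "indicator {..y} (w + r) = (indicator {..y - r} w :: real)" for y w r :: real
    by (auto simp: indicator_def)
  have Li: "Lin k (\<lambda>w. q * indicator {..y} w) x = q * Lin k (indicator {..y - x}) 0" for k q y x
    using Op_translate[of "\<lambda>z. k * z" "indicator {..y}" x 0] unfolding Lin_cmult ind by simp
  have bi: "bm q (\<lambda>w. q * indicator {..y} w)" if "0 \<le> q" for q y :: real
    using that by (auto simp: bm_def indicator_def)
  have spread2: "0 < Lin ((1 - 1/2) * d) (indicator {..y}) 0" for y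
  proof -
    have "bm 1 (indicator {..y})" using bi[of 1 y] by simp
    from Lin_scale_le[OF _ this, of d 0] spread[of y] d show ?thesis by simp
  qed
  obtain \<epsilon>1 where \<epsilon>1: "0 < \<epsilon>1" "\<And>z. 0 \<le> z \<Longrightarrow> z \<le> M \<Longrightarrow> (1 - 1/2) * d * min z \<epsilon>1 \<le> f z"
    using low[of "1/2"] by auto
  have half: "0 \<le> (1 - 1/2) * d" using d by simp
  have low_half: "q * Lin ((1 - 1/2) * d) (indicator {..y - x}) 0 \<le> v (x - c)"
    if q: "0 \<le> q" "q \<le> \<epsilon>1" "q \<le> v y" for q x y
  proof -
    have "Lin ((1 - 1/2) * d) (\<lambda>w. q * indicator {..y} w) x \<le> Lin ((1 - 1/2) * d) (\<lambda>x. min (v x) \<epsilon>1) x"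
    proof (rule Lin_mono[OF half _ bw(1)[OF \<epsilon>1(1)]])
      show "bm \<epsilon>1 (\<lambda>w. q * indicator {..y} w)" using q(1,2) by (auto simp: bm_def indicator_def)
      show "q * indicator {..y} w \<le> min (v w) \<epsilon>1" for w
        using q vnn[of w] \<epsilon>1(1) antimonoD[OF vam, of w y] by (auto simp: indicator_def)
    qed
    also have "\<dots> \<le> v (x - c)" by (rule sup) (use \<epsilon>1 in auto)
    finally show ?thesis unfolding Li .
  qed
  have vpos: "0 < v x" for x
  proof -
    have "\<forall>\<^sub>F y in at_bot. l / 2 < \<phi> y" using lim order_tendstoD(1)[OF lim(1), of "l / 2"] by simp
    then obtain y where y: "\<And>z. z \<le> y \<Longrightarrow> l / 2 < \<phi> z" by (auto simp: eventually_at_bot_linorder)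
    have "l / 2 \<le> v y" by (rule vge) (use y in \<open>auto intro: less_imp_le\<close>)
    then have "min (l / 2) \<epsilon>1 * Lin ((1 - 1/2) * d) (indicator {..y - (x + c)}) 0 \<le> v (x + c - c)"
      using lim \<epsilon>1 by (intro low_half) auto
    moreover have "0 < min (l / 2) \<epsilon>1 * Lin ((1 - 1/2) * d) (indicator {..y - (x + c)}) 0"
      using lim \<epsilon>1 spread2 by (intro mult_pos_pos) auto
    ultimately show ?thesis by simp
  qed
  have small: "\<exists>X. \<forall>x\<ge>X. v x < k" if "0 < k" for k
    using order_tendstoD(2)[OF v0 that] by (auto simp: eventually_at_top_linorder)
  define \<theta> where "\<theta> = min 1 (Lin ((1 - 1/2) * d) (indicator {..- 2 * c}) 0)"
  have \<theta>: "0 < \<theta>" "\<theta> \<le> 1" using spread2 by (auto simp: \<theta>_def)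
  obtain X1 where X1: "\<And>x. X1 \<le> x \<Longrightarrow> v x < \<epsilon>1" using small[OF \<epsilon>1(1)] by blast
  have decay: "\<theta> * v (x - c) \<le> v x" if "X1 + c \<le> x" for x
  proof -
    have "\<theta> * v (x - c) \<le> v (x - c) * Lin ((1 - 1/2) * d) (indicator {..- 2 * c}) 0"
      unfolding \<theta>_def by (subst mult.commute, rule mult_left_mono[OF min.cobounded2 vnn])
    also have "- 2 * c = (x - c) - (x + c)" by simp
    also have "v (x - c) * Lin ((1 - 1/2) * d) (indicator {..(x - c) - (x + c)}) 0 \<le> v (x + c - c)"
      using X1[of "x - c"] that vnn by (intro low_half) auto
    finally show ?thesis by simp
  qed
  define lv where "lv n = ln (v (real n * c))" for n
  obtain n0 :: nat where n0: "X1 + c \<le> real n0 * c" "\<And>x. real n0 * c \<le> x \<Longrightarrow> v x < 1" "0 < n0"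
  proof -
    obtain X where X: "\<And>x. X \<le> x \<Longrightarrow> v x < 1" using small[of 1] by auto
    obtain n :: nat where n: "max (X1 + c) X / c < real n" using reals_Archimedean2 by blast
    then have n': "max (X1 + c) X < real n * c" using c by (simp add: divide_less_eq)
    then have "max (X1 + c) X \<le> real (Suc n) * c" using c by (simp add: algebra_simps)
    then show ?thesis by (intro that[of "Suc n"]) (use X in auto)
  qed
  have lvstep: "lv n + ln \<theta> \<le> lv (Suc n)" if "n0 \<le> n" for n
  proof -
    have "real n0 * c \<le> real (Suc n) * c" using that c by (intro mult_right_mono) auto
    then have "\<theta> * v (real (Suc n) * c - c) \<le> v (real (Suc n) * c)" using n0 by (intro decay) simp
    then have "\<theta> * v (real n * c) \<le> v (real (Suc n) * c)" by (simp add: algebra_simps)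
    then have "ln (\<theta> * v (real n * c)) \<le> lv (Suc n)"
      unfolding lv_def using \<theta> vpos by (subst ln_le_cancel_iff) auto
    then show ?thesis using \<theta> vpos[of "real n * c"] by (simp add: ln_mult lv_def)
  qed
  have lvlow: "lv n0 + real k * ln \<theta> \<le> lv (n0 + k)" for k
  proof (induction k)
    case (Suc k)
    then show ?case using lvstep[of "n0 + k"] by (simp add: algebra_simps)
  qed simp
  have lvneg: "lv n < 0" if "n0 \<le> n" for n
  proof -
    have "v (real n * c) < 1" using that c by (intro n0 mult_right_mono) auto
    then show ?thesis unfolding lv_def using vpos by simp
  qed
  define C where "C = - lv n0 - ln \<theta>"
  have seqb: "- lv (n0 + k) / real (n0 + k) \<in> {0..C}" for k
  proof -
    have pos: "0 < real (n0 + k)" using n0 by simp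
    have "1 * (- lv n0) \<le> real (n0 + k) * (- lv n0)" "real k * (- ln \<theta>) \<le> real (n0 + k) * (- ln \<theta>)"
      using lvneg[of n0] \<theta> n0(3) by (intro mult_right_mono; simp)+
    then have "- lv (n0 + k) \<le> real (n0 + k) * C" using lvlow[of k] by (simp add: C_def algebra_simps)
    then have "- lv (n0 + k) / real (n0 + k) \<le> C" using pos unfolding pos_divide_le_eq[OF pos] by (simp only: mult.commute)
    moreover have "0 \<le> - lv (n0 + k) / real (n0 + k)" using lvneg[of "n0 + k"] pos by (intro divide_nonneg_nonneg) auto
    ultimately show ?thesis by simp
  qed
  obtain \<nu> r where \<nu>: "\<nu> \<in> {0..C}" "strict_mono (r :: nat \<Rightarrow> nat)"
    "((\<lambda>k. - lv (n0 + k) / real (n0 + k)) \<circ> r) \<longlonglongrightarrow> \<nu>"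
    using seq_compactE[OF compact_imp_seq_compact[OF compact_Icc[of 0 C]], of "\<lambda>k. - lv (n0 + k) / real (n0 + k)"] seqb by blast
  define \<mu> where "\<mu> = \<nu> / c"
  have \<mu>: "0 \<le> \<mu>" "\<nu> = \<mu> * c" using \<nu>(1) c by (auto simp: \<mu>_def)
  have near: "\<exists>n\<ge>N0. \<bar>lv n + \<mu> * c * real n\<bar> \<le> e * real n" if e: "0 < e" for e and N0 :: nat
  proof -
    obtain k0 where k0: "\<And>k. k0 \<le> k \<Longrightarrow> \<bar>- lv (n0 + r k) / real (n0 + r k) - \<nu>\<bar> < e"
      using LIMSEQ_D[OF \<nu>(3) e] by auto
    define n where "n = n0 + r (max k0 N0)"
    have "max k0 N0 \<le> r (max k0 N0)" by (rule seq_suble[OF \<nu>(2)])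
    then have nN: "N0 \<le> n" by (simp add: n_def)
    have np: "0 < real n" using n0 by (simp add: n_def)
    have "\<bar>- lv n / real n - \<nu>\<bar> \<le> e" using k0[of "max k0 N0"] by (simp add: n_def)
    then have "\<bar>- lv n / real n - \<nu>\<bar> * real n \<le> e * real n" using np by (intro mult_right_mono) auto
    moreover have "\<bar>- lv n / real n - \<nu>\<bar> * real n = \<bar>lv n + \<mu> * c * real n\<bar>"
    proof -
      have "\<bar>- lv n / real n - \<nu>\<bar> * real n = \<bar>(- lv n / real n - \<nu>) * real n\<bar>" using np by (simp add: abs_mult)
      also have "(- lv n / real n - \<nu>) * real n = - (lv n + \<mu> * c * real n)"
        using np by (simp add: left_diff_distrib \<mu>(2))
      finally show ?thesis by simp
    qed
    ultimately show ?thesis using nN by auto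
  qed
  have K: "exp (\<mu> * c) < Kern d \<mu>" by (rule fast[OF \<mu>(1)])
  define Kd where "Kd = Kern d \<mu>"
  have Kd: "0 < Kd" "exp (\<mu> * c) < Kd" using K exp_gt_zero[of "\<mu> * c"] unfolding Kd_def by linarith+
  have "((\<lambda>e. (1 - e) * Kd) \<longlongrightarrow> (1 - 0) * Kd) (at_right 0)" by (intro tendsto_intros)
  then have "\<forall>\<^sub>F e in at_right 0. exp (\<mu> * c) < (1 - e) * Kd" using Kd by (intro order_tendstoD) auto
  moreover have "\<forall>\<^sub>F e in at_right (0::real). 0 < e" by (simp add: eventually_at_filter)
  moreover have "\<forall>\<^sub>F e in at_right (0::real). e < 1" by (subst eventually_at_right[of 0 1]) (auto intro: exI[of _ 1])
  ultimately have "\<forall>\<^sub>F e in at_right 0. exp (\<mu> * c) < (1 - e) * Kd \<and> 0 < e \<and> e < 1"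
    by eventually_elim auto
  then obtain e where e: "exp (\<mu> * c) < (1 - e) * Kd" "0 < e" "e < 1"
    using eventually_happens'[OF trivial_limit_at_right_real] by blast
  define k where "k = (1 - e) * d"
  have k: "0 \<le> k" using e d by (simp add: k_def)
  have Kk: "exp (\<mu> * c) < Kern k \<mu>" using Kern_mult_le[of e d \<mu>] e by (simp add: k_def Kd_def)
  have "(\<lambda>m. exp (\<mu> * (c / real (Suc m))) * exp (\<mu> * c)) \<longlonglongrightarrow> exp (\<mu> * 0) * exp (\<mu> * c)"
    by (intro tendsto_intros LIMSEQ_Suc[of "\<lambda>n. c / real n"] lim_const_over_n)
  then have "\<forall>\<^sub>F m in sequentially. exp (\<mu> * (c / real (Suc m))) * exp (\<mu> * c) < Kern k \<mu>"
    using Kk by (intro order_tendstoD) auto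
  then obtain m' where m': "exp (\<mu> * (c / real (Suc m'))) * exp (\<mu> * c) < Kern k \<mu>"
    by (auto simp: eventually_sequentially)
  define m where "m = Suc m'"
  define \<Delta> where "\<Delta> = c / real m"
  have \<Delta>: "0 < \<Delta>" "real m * \<Delta> = c" "exp (\<mu> * \<Delta>) * exp (\<mu> * c) < Kern k \<mu>"
    using c m' by (auto simp: \<Delta>_def m_def)
  have "\<forall>\<^sub>F n in sequentially. exp (\<mu> * \<Delta>) * exp (\<mu> * c)
      < Lin k (\<lambda>y. exp (- \<mu> * y) * indicator {- real n..real n} y) 0"
    by (rule order_tendstoD(1)[OF Lin_exp_truncated_tendsto[OF k] \<Delta>(3)])
  then obtain n where n: "exp (\<mu> * \<Delta>) * exp (\<mu> * c)
      < Lin k (\<lambda>y. exp (- \<mu> * y) * indicator {- real n..real n} y) 0"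
    by (auto simp: eventually_sequentially)
  obtain J :: nat where J: "real n / \<Delta> < real J" using reals_Archimedean2 by blast
  have J': "real n < real J * \<Delta>" using J \<Delta> by (simp add: divide_less_eq)
  define I where "I = {- int J..int J}"
  define cell where "cell j = {- (of_int j + 1) * \<Delta><..- of_int j * \<Delta>}" for j :: int
  define \<kappa> where "\<kappa> j = Lin k (indicator (cell j)) 0" for j
  have bc: "bm 1 (indicator (cell j))" for j by (auto simp: bm_def indicator_def cell_def)
  have \<kappa>nn: "0 \<le> \<kappa> j" for j unfolding \<kappa>_def by (rule bmD(2)[OF Op_bm[OF nl_lin[OF k] bc]])
  have cell: "y \<in> cell j \<longleftrightarrow> j = \<lfloor>- y / \<Delta>\<rfloor>" for y j
  proof -
    have "y \<in> cell j \<longleftrightarrow> of_int j \<le> - y / \<Delta> \<and> - y / \<Delta> < of_int j + 1"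
      unfolding cell_def using \<Delta>(1) by (auto simp: field_simps)
    also have "\<dots> \<longleftrightarrow> j = \<lfloor>- y / \<Delta>\<rfloor>" using floor_eq_iff[of "- y / \<Delta>" j] by auto
    finally show ?thesis .
  qed
  have csum: "(\<Sum>j\<in>I. q j * indicator (cell j) y) = (if \<lfloor>- y / \<Delta>\<rfloor> \<in> I then q \<lfloor>- y / \<Delta>\<rfloor> else 0)" for q :: "int \<Rightarrow> real" and y
  proof -
    have "(\<Sum>j\<in>I. q j * indicator (cell j) y) = (\<Sum>j\<in>I. if j = \<lfloor>- y / \<Delta>\<rfloor> then q j else 0)"
      by (intro sum.cong) (auto simp: indicator_def cell)
    then show ?thesis by (simp add: I_def)
  qed
  have Lsum: "Lin k (\<lambda>y. \<Sum>j\<in>I. q j * indicator (cell j) y) 0 = (\<Sum>j\<in>I. q j * \<kappa> j)"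
    if q: "\<And>j. 0 \<le> q j" "\<And>j. j \<in> I \<Longrightarrow> q j \<le> K" "0 \<le> K" for q K
  proof -
    have "bm K (\<lambda>y. q j * indicator (cell j) y)" if "j \<in> I" for j
      using q(1)[of j] q(2)[OF that] q(3) by (auto simp: bm_def indicator_def cell_def)
    then show ?thesis
      using q(3) k by (subst Lin_sum[of I k K "\<lambda>j y. q j * indicator (cell j) y"]) (auto simp: I_def Lin_cmult \<kappa>_def)
  qed
  have bq: "bm (Max (q ` I)) (\<lambda>y. \<Sum>j\<in>I. q j * indicator (cell j) y)" if q: "\<And>j. 0 \<le> q j" for q :: "int \<Rightarrow> real"
  proof -
    have "(\<lambda>y. \<Sum>j\<in>I. q j * indicator (cell j) y) \<in> borel_measurable borel"
      unfolding cell_def by measurable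
    moreover have "q j \<le> Max (q ` I)" if "j \<in> I" for j using that by (simp add: I_def)
    moreover have "0 \<le> Max (q ` I)"
      by (rule order_trans[OF q[of 0] calculation(2)]) (simp add: I_def)
    ultimately show ?thesis unfolding bm_def csum using q by auto
  qed
  have Z: "exp (\<mu> * c) < (\<Sum>j\<in>I. \<kappa> j * exp (\<mu> * \<Delta> * of_int j))"
  proof -
    let ?q = "\<lambda>j::int. exp (\<mu> * \<Delta>) * exp (\<mu> * \<Delta> * of_int j)"
    have qI: "?q j \<le> Max (?q ` I)" if "j \<in> I" for j using that by (intro Max_ge) (auto simp: I_def)
    have le: "exp (- \<mu> * y) * indicator {- real n..real n} y \<le> (\<Sum>j\<in>I. ?q j * indicator (cell j) y)" for y
    proof (cases "y \<in> {- real n..real n}")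
      case True
      have "\<bar>- y / \<Delta>\<bar> < real J"
      proof -
        have "\<bar>y\<bar> < real J * \<Delta>" using True J' by auto
        then show ?thesis using \<Delta>(1) by (simp add: abs_divide divide_less_eq)
      qed
      then have "- real J < - y / \<Delta>" "- y / \<Delta> < real J" by linarith+
      then have fI: "\<lfloor>- y / \<Delta>\<rfloor> \<in> I" unfolding I_def by (auto simp: le_floor_iff floor_le_iff)
      have "- y / \<Delta> \<le> of_int \<lfloor>- y / \<Delta>\<rfloor> + 1" by linarith
      then have "- y \<le> (of_int \<lfloor>- y / \<Delta>\<rfloor> + 1) * \<Delta>" by (simp only: pos_divide_le_eq[OF \<Delta>(1)])
      then have "\<mu> * (- y) \<le> \<mu> * ((of_int \<lfloor>- y / \<Delta>\<rfloor> + 1) * \<Delta>)" by (intro mult_left_mono \<mu>)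
      then have "exp (- \<mu> * y) \<le> ?q \<lfloor>- y / \<Delta>\<rfloor>" by (simp add: exp_add[symmetric] algebra_simps)
      then show ?thesis using True fI unfolding csum by simp
    next
      case False
      then show ?thesis by (auto intro!: sum_nonneg)
    qed
    define K where "K = max (Max (?q ` I)) (exp (\<mu> * real n))"
    have K0: "0 \<le> K" by (simp add: K_def le_max_iff_disj)
    have b1: "bm K (\<lambda>y. exp (- \<mu> * y) * indicator {- real n..real n} y)"
    proof -
      have "exp (- \<mu> * y) \<le> exp (\<mu> * real n)" if "- real n \<le> y" for y
        using mult_left_mono[OF that \<mu>(1)] by simp
      then have "exp (- \<mu> * y) * indicator {- real n..real n} y \<le> exp (\<mu> * real n)" for y
        by (auto simp: indicator_def)
      then show ?thesis unfolding bm_def K_def by (auto simp: le_max_iff_disj)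
    qed
    have b2: "bm K (\<lambda>y. \<Sum>j\<in>I. ?q j * indicator (cell j) y)"
      using bq[of ?q] unfolding bm_def K_def by (auto simp: le_max_iff_disj)
    have "Lin k (\<lambda>y. exp (- \<mu> * y) * indicator {- real n..real n} y) 0
        \<le> Lin k (\<lambda>y. \<Sum>j\<in>I. ?q j * indicator (cell j) y) 0"
      by (rule Lin_mono[OF k b1 b2 le])
    also have "\<dots> = (\<Sum>j\<in>I. ?q j * \<kappa> j)" by (rule Lsum[of _ K]) (use qI K0 in \<open>auto simp: K_def le_max_iff_disj\<close>)
    also have "\<dots> = exp (\<mu> * \<Delta>) * (\<Sum>j\<in>I. \<kappa> j * exp (\<mu> * \<Delta> * of_int j))"
      by (simp add: sum_distrib_left mult_ac)
    finally have "exp (\<mu> * \<Delta>) * exp (\<mu> * c) < exp (\<mu> * \<Delta>) * (\<Sum>j\<in>I. \<kappa> j * exp (\<mu> * \<Delta> * of_int j))"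
      using n by linarith
    then show ?thesis by simp
  qed
  obtain \<epsilon> where \<epsilon>: "0 < \<epsilon>" "\<And>z. 0 \<le> z \<Longrightarrow> z \<le> M \<Longrightarrow> (1 - e) * d * min z \<epsilon> \<le> f z"
    using low[OF e(2,3)] by auto
  obtain X2 where X2: "\<And>x. X2 \<le> x \<Longrightarrow> v x < \<epsilon>" using small[OF \<epsilon>(1)] by blast
  have super: "(\<Sum>j\<in>I. \<kappa> j * v (x - of_int j * \<Delta>)) \<le> v (x - c)" if x: "X2 + real J * \<Delta> \<le> x" for x
  proof -
    have vI: "v (x - of_int j * \<Delta>) < \<epsilon>" if "j \<in> I" for j
    proof (rule X2)
      have "of_int j * \<Delta> \<le> real J * \<Delta>" using that \<Delta>(1) by (intro mult_right_mono) (auto simp: I_def)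
      then show "X2 \<le> x - of_int j * \<Delta>" using x by linarith
    qed
    let ?q = "\<lambda>j. v (x - of_int j * \<Delta>)"
    have le: "(\<Sum>j\<in>I. ?q j * indicator (cell j) y) \<le> min (v (y + x)) \<epsilon>" for y
    proof (cases "\<lfloor>- y / \<Delta>\<rfloor> \<in> I")
      case True
      have "of_int \<lfloor>- y / \<Delta>\<rfloor> \<le> - y / \<Delta>" by linarith
      then have "of_int \<lfloor>- y / \<Delta>\<rfloor> * \<Delta> \<le> - y" by (simp only: pos_le_divide_eq[OF \<Delta>(1)])
      then have "?q \<lfloor>- y / \<Delta>\<rfloor> \<le> v (y + x)" by (intro antimonoD[OF vam]) linarith
      then show ?thesis unfolding csum using True vI[OF True] by simp
    next
      case False then show ?thesis unfolding csum using vnn \<epsilon> by simp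
    qed
    have "(\<Sum>j\<in>I. \<kappa> j * v (x - of_int j * \<Delta>)) = Lin k (\<lambda>y. \<Sum>j\<in>I. ?q j * indicator (cell j) y) 0"
      by (subst Lsum[of _ \<epsilon>]) (use vnn vI \<epsilon> in \<open>auto simp: mult.commute intro: less_imp_le\<close>)
    also have "\<dots> \<le> Lin k (\<lambda>y. min (v (y + x)) \<epsilon>) 0"
    proof (rule Lin_mono[OF k _ bm_translate[OF bw(1)[OF \<epsilon>(1)]] le])
      show "bm \<epsilon> (\<lambda>y. \<Sum>j\<in>I. ?q j * indicator (cell j) y)"
        using bq[of ?q, OF vnn] unfolding bm_def csum using vI \<epsilon>(1) by (auto intro: less_imp_le)
    qed
    also have "\<dots> = Lin k (\<lambda>y. min (v y) \<epsilon>) x"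
      using Op_translate[of "\<lambda>z. k * z" "\<lambda>y. min (v y) \<epsilon>" x 0] by simp
    also have "\<dots> \<le> v (x - c)" unfolding k_def by (rule sup[OF e(2,3) \<epsilon>])
    finally show ?thesis .
  qed
  obtain n1 :: nat where n1: "n0 \<le> n1" "X2 + real J * \<Delta> \<le> real n1 * c"
  proof -
    obtain n :: nat where "(X2 + real J * \<Delta>) / c < real n" using reals_Archimedean2 by blast
    then have "X2 + real J * \<Delta> < real n * c" using c by (simp add: divide_less_eq)
    also have "\<dots> \<le> real (max n n0) * c" using c by (intro mult_right_mono) auto
    finally show ?thesis by (intro that[of "max n n0"]) auto
  qed
  define b where "b i = v (real n1 * c + of_int i * \<Delta>)" for i :: int
  have bm': "b (i - int m) = v (real n1 * c + of_int i * \<Delta> - c)" for i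
    unfolding b_def using \<Delta>(2) by (simp add: algebra_simps)
  have "(\<Sum>j\<in>I. \<kappa> j * exp (\<mu> * \<Delta> * of_int j)) \<le> exp (\<mu> * \<Delta> * real m)"
  proof (rule lattice_supersolution[of b m \<theta> I \<kappa>])
    show "0 < b i" for i by (simp add: b_def vpos)
    show "antimono b"
      using \<Delta>(1) by (intro antimonoI) (auto simp: b_def intro!: antimonoD[OF vam])
    show "0 < m" by (simp add: m_def)
    show "finite I" by (simp add: I_def)
    show "\<theta> * b (i - int m) \<le> b i" if "0 \<le> i" for i
    proof -
      have "real n0 * c \<le> real n1 * c" using n1 c by (intro mult_right_mono) auto
      moreover have "0 \<le> of_int i * \<Delta>" using that \<Delta>(1) by simp
      ultimately show ?thesis unfolding bm' unfolding b_def using n0(1) by (intro decay) linarith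
    qed
    show "(\<Sum>j\<in>I. \<kappa> j * b (i - j)) \<le> b (i - int m)" if "0 \<le> i" for i
    proof -
      have "0 \<le> of_int i * \<Delta>" using that \<Delta>(1) by simp
      then have "X2 + real J * \<Delta> \<le> real n1 * c + of_int i * \<Delta>" using n1 by linarith
      from super[OF this] show ?thesis unfolding bm' unfolding b_def by (simp add: algebra_simps)
    qed
    show "\<exists>N\<ge>N0. \<bar>ln (b (int N)) + \<mu> * \<Delta> * real N\<bar> \<le> e * real N" if "0 < e" for e and N0 :: nat
    proof -
      define Y where "Y = \<mu> * c * real n1"
      have Y: "0 \<le> Y" using \<mu> c by (simp add: Y_def)
      obtain N1 :: nat where N1: "2 * Y / e < real N1" using reals_Archimedean2 by blast
      obtain n where n: "2 * n1 + N0 + N1 \<le> n" "\<bar>lv n + \<mu> * c * real n\<bar> \<le> e / 4 * real n"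
        using near[of "e / 4" "2 * n1 + N0 + N1"] \<open>0 < e\<close> by auto
      define N where "N = (n - n1) * m"
      have Nn: "n - n1 \<le> N" by (simp add: N_def m_def)
      have N0: "N0 \<le> N" "N1 \<le> N" "n \<le> 2 * N" using Nn n(1) by linarith+
      have rN: "real N * \<Delta> = (real n - real n1) * c"
        using n(1) \<Delta>(2) by (simp add: N_def of_nat_diff mult.assoc)
      have "b (int N) = v (real n * c)" unfolding b_def using rN by (simp add: algebra_simps)
      moreover have "\<mu> * \<Delta> * real N = \<mu> * c * real n - Y"
        unfolding Y_def using arg_cong[OF rN, of "\<lambda>t. \<mu> * t"] by (simp add: algebra_simps)
      ultimately have "ln (b (int N)) + \<mu> * \<Delta> * real N = (lv n + \<mu> * c * real n) - Y"
        unfolding lv_def by simp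
      then have "\<bar>ln (b (int N)) + \<mu> * \<Delta> * real N\<bar> \<le> e / 4 * real n + Y" using n(2) Y by linarith
      also have "e / 4 * real n \<le> e / 4 * (2 * real N)" using N0(3) \<open>0 < e\<close> by (intro mult_left_mono) auto
      also have "Y \<le> e / 2 * real N"
      proof -
        have "2 * Y < real N1 * e" using N1 \<open>0 < e\<close> by (simp add: divide_less_eq)
        also have "\<dots> \<le> real N * e" using N0 \<open>0 < e\<close> by (intro mult_right_mono) auto
        finally show ?thesis by (simp add: mult.commute)
      qed
      finally show ?thesis using N0(1) by (intro exI[of _ N]) (auto simp: algebra_simps)
    qed
  qed (use \<theta> \<kappa>nn in auto)
  moreover have "\<mu> * \<Delta> * real m = \<mu> * c" using \<Delta>(2) by (simp add: mult_ac)
  ultimately show False using Z by simp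
qed

end

section \<open>The seasonal model\<close>

lemma ex_primitive:
  fixes D :: "real \<Rightarrow> real"
  assumes "continuous_on UNIV D"
  shows "\<exists>F. continuous_on UNIV F \<and> (\<forall>s t. 0 \<le> s \<longrightarrow> s \<le> t \<longrightarrow> integral {s..t} D = F t - F s)"
proof (intro exI conjI allI impI)
  have int: "D integrable_on {a..b}" for a b
    by (rule integrable_continuous_real[OF continuous_on_subset[OF assms]]) simp
  let ?F = "\<lambda>x. integral {0..max 0 x} D"
  show "continuous_on UNIV ?F"
  proof (rule continuous_at_imp_continuous_on, rule ballI)
    fix x :: real
    have "continuous_on {..\<bar>x\<bar> + 1} ?F"
      by (rule continuous_on_compose2[OF indefinite_integral_continuous_1[OF int[of 0 "\<bar>x\<bar> + 1"]]])
         (auto intro!: continuous_intros)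
    then show "isCont ?F x"
      by (rule continuous_on_interior) (simp add: interior_Iic[of "\<bar>x\<bar> + 2"])
  qed
  fix s t :: real assume "0 \<le> s" "s \<le> t"
  then show "integral {s..t} D = ?F t - ?F s"
    using Henstock_Kurzweil_Integration.integral_combine[of 0 s t D] int by simp
qed

lemma heatop_eq_gavg:
  assumes D: "continuous_on UNIV D" "\<And>t. 0 \<le> D t" and \<phi>: "\<phi> \<in> borel_measurable borel"
  shows "heatop D d t s \<phi> x = exp (- integral {s..t} d) * gavg (sqrt (2 * integral {s..t} D)) \<phi> x"
proof (cases "integral {s..t} D > 0")
  case True
  define v where "v = integral {s..t} D"
  have v: "0 < v" "0 < sqrt (2 * v)" using True by (auto simp: v_def)
  have "green D d t s z = exp (- integral {s..t} d) * normal_density 0 (sqrt (2 * v)) z" for z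
  proof -
    have "green D d t s z = exp (- z\<^sup>2 / (4 * v) + - integral {s..t} d) / sqrt (4 * pi * v)"
      by (simp add: green_def v_def)
    also have "\<dots> = exp (- integral {s..t} d) * normal_density 0 (sqrt (2 * v)) z"
      using v unfolding exp_add by (simp add: normal_density_def mult_ac)
    finally show ?thesis .
  qed
  then have "(LINT y|lborel. green D d t s (x - y) * \<phi> y)
      = exp (- integral {s..t} d) * (LINT y|lborel. normal_density 0 (sqrt (2 * v)) (x - y) * \<phi> y)"
    by (simp add: mult.assoc)
  then show ?thesis using True v gavg_eq_density[OF v(2) \<phi>, of x] by (simp add: heatop_def v_def)
next
  case False
  have "0 \<le> integral {s..t} D"
    by (intro integral_nonneg integrable_continuous_real continuous_on_subset[OF D(1)]) (auto simp: D)
  then have "integral {s..t} D = 0" using False by simp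
  then show ?thesis by (simp add: heatop_def)
qed

lemma heatop_translate: "heatop D d t s (\<lambda>y. \<psi> (y - r)) x = heatop D d t s \<psi> (x - r)"
proof -
  have "(LINT y|lborel. green D d t s (x - y) * \<psi> (y - r))
    = \<bar>1\<bar> *\<^sub>R (LINT y|lborel. green D d t s (x - (r + 1 * y)) * \<psi> (r + 1 * y - r))"
    by (rule lborel_integral_real_affine) simp
  then show ?thesis by (simp add: heatop_def algebra_simps)
qed

lemma heatop_zero: "heatop D d t s (\<lambda>_. 0) x = 0"
  by (simp add: heatop_def)

lemma gavg_pos:
  assumes f: "bm M f" and pos: "\<And>x. x \<le> y \<Longrightarrow> 0 < f x" and a: "a \<noteq> 0"
  shows "0 < gavg a f x"
proof -
  have "0 \<le> gavg a f x" by (rule gavg_nonneg) (rule bmD(2)[OF f])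
  moreover have "gavg a f x \<noteq> 0"
  proof
    assume "gavg a f x = 0"
    then have "AE z in stdN. f (x + a * z) = 0"
      unfolding gavg_def
      by (subst (asm) integral_nonneg_eq_0_iff_AE) (use bmD[OF f] gavg_integrable[of f M x a] in auto)
    then have "AE z in lborel. f (x + a * z) = 0"
      by (subst (asm) AE_density) (auto simp: normal_density_pos)
    then obtain N where N: "{z \<in> space lborel. f (x + a * z) \<noteq> 0} \<subseteq> N" "emeasure lborel N = 0" "N \<in> sets lborel"
      by (rule AE_E)
    define q where "q = (y - x) / a"
    define X where "X = (if 0 < a then {q - 1..q} else {q..q + 1})"
    have "X \<subseteq> N"
    proof
      fix z assume z: "z \<in> X"
      have "a * z \<le> a * q"
        using z a by (auto simp: X_def mult_left_mono mult_left_mono_neg split: if_splits)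
      then have "x + a * z \<le> y" using a by (simp add: q_def)
      then have "f (x + a * z) \<noteq> 0" using pos by force
      then show "z \<in> N" using N(1) by auto
    qed
    then have "emeasure lborel X \<le> 0" using emeasure_mono[OF _ N(3)] N(2) by metis
    then show False by (auto simp: X_def split: if_splits)
  qed
  ultimately show ?thesis by linarith
qed

locale model =
  fixes T alpha beta ta tb zs ustar :: real
    and DM DI dM dI tau p h hd :: "real \<Rightarrow> real"
  assumes T_pos: "T > 0"
    and coef_sign: "\<forall>t. DM t \<ge> 0 \<and> DI t \<ge> 0 \<and> dM t > 0 \<and> dI t > 0 \<and> tau t > 0 \<and> p t \<ge> 0"
    and coef_C1: "DM C1_differentiable_on UNIV" "DI C1_differentiable_on UNIV"
      "dM C1_differentiable_on UNIV" "dI C1_differentiable_on UNIV"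
      "tau C1_differentiable_on UNIV" "p C1_differentiable_on UNIV"
    and coef_per: "\<forall>t. DM (t + T) = DM t \<and> DI (t + T) = DI t \<and> dM (t + T) = dM t
      \<and> dI (t + T) = dI t \<and> tau (t + T) = tau t \<and> p (t + T) = p t"
    and h_C1: "\<forall>z\<ge>0. (h has_real_derivative hd z) (at z within {0..})"
    and h_nonneg: "\<forall>z\<ge>0. h z \<ge> 0"
    and times: "0 < alpha" "alpha \<le> beta" "beta < ta" "ta \<le> tb" "tb < T"
    and ta_def: "ta - tau ta = alpha" and tb_def: "tb - tau tb = beta"
    and tau_deriv: "\<forall>t. deriv tau t < 1"
    and h_zero: "h 0 = 0"
    and zs_pos: "0 < zs"
    and h_incr: "strict_mono_on {0..<zs} h"
    and h_decr: "\<forall>x y. zs \<le> x \<longrightarrow> x < y \<longrightarrow> h y < h x"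
    and h_subhom: "\<forall>lam z. 0 < lam \<longrightarrow> lam < 1 \<longrightarrow> 0 \<le> z \<longrightarrow> h (lam * z) \<ge> lam * h z"
    and L_gt1: "Lconst dM dI tau p (hd 0) T ta tb > 1"
    and ustar_pos: "0 < ustar"
    and ustar_fix: "Qmap DM dM DI dI tau p h T ta tb (\<lambda>_. ustar) = (\<lambda>_. ustar)"
    and ustar_min: "\<forall>v. 0 < v \<longrightarrow> v < ustar \<longrightarrow> Qmap DM dM DI dI tau p h T ta tb (\<lambda>_. v) \<noteq> (\<lambda>_. v)"
    and h_mono_ustar: "mono_on {0..ustar} h"
    and cstar_pos: "spreading_speed DM dM DI dI tau p (hd 0) T ta tb > 0"
begin

lemma C1_continuous: "f C1_differentiable_on UNIV \<Longrightarrow> continuous_on X (f :: real \<Rightarrow> real)"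
  by (metis C1_differentiable_imp_continuous_on continuous_on_subset subset_UNIV)

lemmas conts = coef_C1[THEN C1_continuous]

lemma tau_DERIV: "(tau has_real_derivative deriv tau t) (at t)"
  and deriv_tau_cont: "continuous_on X (deriv tau)"
proof -
  obtain D where D: "\<And>x. (tau has_vector_derivative D x) (at x)" "continuous_on UNIV D"
    using coef_C1(5) unfolding C1_differentiable_on_def by auto
  then have "(tau has_real_derivative D x) (at x)" for x
    by (simp add: has_real_derivative_iff_has_vector_derivative)
  then have "deriv tau = D" by (auto intro: DERIV_imp_deriv)
  then show "(tau has_real_derivative deriv tau t) (at t)" "continuous_on X (deriv tau)"
    using D \<open>\<And>x. (tau has_real_derivative D x) (at x)\<close> continuous_on_subset[OF D(2)] by auto
qed

lemma coef_nonneg: "0 \<le> DM t" "0 \<le> DI t" "0 < dM t" "0 < dI t" "0 < tau t" "0 \<le> p t"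
  using coef_sign by auto

lemma lag_le: "t - tau t \<le> t"
  using coef_nonneg(5)[of t] by simp

lemma lag_mono: "s \<le> t \<Longrightarrow> s - tau s \<le> t - tau t"
proof (rule DERIV_nonneg_imp_nondecreasing[of s t "\<lambda>t. t - tau t"])
  fix x
  have "((\<lambda>t. t - tau t) has_real_derivative 1 - deriv tau x) (at x)"
    by (intro derivative_intros tau_DERIV)
  then show "\<exists>y. ((\<lambda>t. t - tau t) has_real_derivative y) (at x) \<and> 0 \<le> y"
    using tau_deriv[rule_format, of x] by (intro exI[of _ "1 - deriv tau x"]) simp
qed

lemma lag_bounds: "s \<in> {ta..tb} \<Longrightarrow> alpha \<le> s - tau s \<and> s - tau s \<le> beta"
  using lag_mono[of ta s] lag_mono[of s tb] ta_def tb_def by auto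

definition hh :: "real \<Rightarrow> real" where "hh z = h (max 0 z)"

lemma hh_eq: "0 \<le> z \<Longrightarrow> hh z = h z" by (simp add: hh_def)

lemma hh_cont: "continuous_on UNIV hh"
proof -
  have "continuous_on {0..} h"
    using h_C1 by (auto intro!: DERIV_continuous_on)
  then show ?thesis unfolding hh_def[abs_def]
    by (rule continuous_on_compose2) (auto intro!: continuous_intros)
qed

lemma h_pos: "0 < z \<Longrightarrow> 0 < h z"
proof -
  assume z: "0 < z"
  show ?thesis
  proof (cases "z < zs")
    case True
    then have "h 0 < h z" using z by (intro strict_mono_onD[OF h_incr]) auto
    then show ?thesis by (simp add: h_zero)
  next
    case False
    then have "h (z + 1) < h z" using h_decr by simp
    then show ?thesis using h_nonneg z by (smt (verit))
  qed
qed

lemma h_quot: "0 < e \<Longrightarrow> \<exists>\<delta>>0. \<forall>y. 0 < y \<longrightarrow> y < \<delta> \<longrightarrow> \<bar>h y / y - hd 0\<bar> < e"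
proof -
  assume e: "0 < e"
  have "((\<lambda>y. (h y - h 0) / (y - 0)) \<longlongrightarrow> hd 0) (at 0 within {0..})"
    using h_C1[rule_format, of 0] by (simp only: has_field_derivative_iff)
  then have "\<forall>\<^sub>F y in at 0 within {0..}. dist (h y / y) (hd 0) < e"
    using e by (auto simp: h_zero dest!: tendstoD)
  then show ?thesis by (auto simp: eventually_at dist_real_def)
qed

lemma h_le: "0 \<le> z \<Longrightarrow> h z \<le> hd 0 * z"
proof (cases "z = 0")
  case False
  assume "0 \<le> z"
  then have z: "0 < z" using False by simp
  have "h z / z \<le> hd 0"
  proof (rule field_le_epsilon)
    fix e :: real assume "0 < e"
    then obtain \<delta> where \<delta>: "0 < \<delta>" "\<And>y. 0 < y \<Longrightarrow> y < \<delta> \<Longrightarrow> \<bar>h y / y - hd 0\<bar> < e" using h_quot by blast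
    define lam where "lam = min (1/2) (\<delta> / (2 * z))"
    have lam: "0 < lam" "lam < 1" using \<delta> z by (auto simp: lam_def)
    have "lam * z \<le> \<delta> / (2 * z) * z" using z by (intro mult_right_mono) (auto simp: lam_def)
    also have "\<dots> < \<delta>" using z \<delta> by simp
    finally have "\<bar>h (lam * z) / (lam * z) - hd 0\<bar> < e" using lam z by (intro \<delta>) auto
    moreover have "h z / z \<le> h (lam * z) / (lam * z)"
      using h_subhom[rule_format, OF lam, of z] lam z by (simp add: field_simps)
    ultimately show "h z / z \<le> hd 0 + e" by linarith
  qed
  then show ?thesis using z by (simp add: divide_le_eq)
qed (simp add: h_zero)

lemma hd0_pos: "0 < hd 0"
  using h_pos[of 1] h_le[of 1] by simp

lemma hh_le: "0 \<le> z \<Longrightarrow> hh z \<le> hd 0 * z" by (simp add: hh_eq h_le)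

lemma hh_ge: "0 < e \<Longrightarrow> \<exists>z0>0. \<forall>z. 0 \<le> z \<longrightarrow> z \<le> z0 \<longrightarrow> (1 - e) * hd 0 * z \<le> hh z"
proof -
  assume e: "0 < e"
  then have "0 < e * hd 0" using hd0_pos by simp
  from h_quot[OF this] obtain \<delta> where \<delta>: "0 < \<delta>" "\<And>y. 0 < y \<Longrightarrow> y < \<delta> \<Longrightarrow> \<bar>h y / y - hd 0\<bar> < e * hd 0" by blast
  have "(1 - e) * hd 0 * z \<le> hh z" if "0 \<le> z" "z \<le> \<delta> / 2" for z
  proof (cases "z = 0")
    case False
    then have z: "0 < z" "z < \<delta>" using that \<delta> by auto
    then have "hd 0 - e * hd 0 \<le> h z / z" using \<delta>(2)[OF z] by linarith
    then show ?thesis using z by (simp add: le_divide_eq hh_eq algebra_simps)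
  qed (simp add: hh_eq h_zero)
  then show ?thesis using \<delta>(1) by (intro exI[of _ "\<delta> / 2"]) auto
qed

definition S :: "real measure" where "S = restrict_space lborel {ta..tb}"
definition a0 where "a0 t = exp (- integral {0..t} dM)"
definition A0 where "A0 t = sqrt (2 * integral {0..t} DM)"
definition \<rho> where "\<rho> s = (1 - deriv tau s) * p (s - tau s) * exp (- integral {s - tau s..s} dI)"
definition W where "W t s = (if s \<le> t then exp (- integral {s..t} dM) * \<rho> s else 0)"
definition A where "A t s = sqrt (2 * integral {s..t} DM)"
definition B where "B s = sqrt (2 * integral {s - tau s..s} DI)"
definition C where "C s = sqrt (2 * integral {0..s - tau s} DM)"
definition E where "E s = exp (- integral {0..s - tau s} dM)"

lemma space_S: "space S = {ta..tb}" by (simp add: S_def space_restrict_space)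

lemma meas_S: "f \<in> borel_measurable borel \<Longrightarrow> f \<in> borel_measurable S"
  unfolding S_def by (rule measurable_restrict_space1) simp

lemma fin_S: "finite_measure S"
  by (rule finite_measureI) (simp add: S_def space_restrict_space emeasure_restrict_space emeasure_lborel_Icc_eq)

lemma S_has_integral:
  fixes f :: "real \<Rightarrow> real"
  assumes "integrable S f"
  shows "(f has_integral (\<integral>s. f s \<partial>S)) {ta..tb}"
proof -
  have si: "set_integrable lborel {ta..tb} f"
    using assms integrable_restrict_space[of "{ta..tb}" lborel f] unfolding S_def by (simp add: set_integrable_def)
  have "(\<integral>s. f s \<partial>S) = (LINT s:{ta..tb}|lborel. f s)"
    unfolding S_def set_lebesgue_integral_def by (rule integral_restrict_space) simp
  then show ?thesis using set_borel_integral_eq_integral[OF si] by (simp add: has_integral_integrable_integral)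
qed

lemma int_nonneg: "0 \<le> integral {s..t} DM" "0 \<le> integral {s..t} DI" "0 \<le> integral {s..t} dM" "0 \<le> integral {s..t} dI"
  by (intro integral_nonneg integrable_continuous_real conts; simp add: coef_nonneg less_imp_le)+

lemma int_mono: "s' \<le> s \<Longrightarrow> t \<le> t' \<Longrightarrow> integral {s..t} DM \<le> integral {s'..t'} DM"
  "s' \<le> s \<Longrightarrow> t \<le> t' \<Longrightarrow> integral {s..t} DI \<le> integral {s'..t'} DI"
  by (intro integral_subset_le integrable_continuous_real conts; simp add: coef_nonneg)+

lemma int_split: "s \<le> r \<Longrightarrow> r \<le> t \<Longrightarrow> integral {s..t} DM = integral {s..r} DM + integral {r..t} DM"
  "s \<le> r \<Longrightarrow> r \<le> t \<Longrightarrow> integral {s..t} dM = integral {s..r} dM + integral {r..t} dM"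
  by (intro Henstock_Kurzweil_Integration.integral_combine[symmetric] integrable_continuous_real conts; simp)+

lemma rho_nonneg: "0 \<le> \<rho> s"
  unfolding \<rho>_def using tau_deriv[rule_format, of s] coef_nonneg by (intro mult_nonneg_nonneg) auto

lemma heatopM: "\<phi> \<in> borel_measurable borel \<Longrightarrow>
    heatop DM dM t s \<phi> x = exp (- integral {s..t} dM) * gavg (sqrt (2 * integral {s..t} DM)) \<phi> x"
  by (rule heatop_eq_gavg[OF conts(1)]) (auto simp: coef_nonneg)

lemma heatopI: "\<phi> \<in> borel_measurable borel \<Longrightarrow>
    heatop DI dI t s \<phi> x = exp (- integral {s..t} dI) * gavg (sqrt (2 * integral {s..t} DI)) \<phi> x"
  by (rule heatop_eq_gavg[OF conts(2)]) (auto simp: coef_nonneg)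

lemma season_ex: "\<exists>Wm Am. season S (a0 t) (W t) (A t) B C E Wm Am"
proof -
  obtain FM where FM: "continuous_on UNIV FM" "\<And>s t. 0 \<le> s \<Longrightarrow> s \<le> t \<Longrightarrow> integral {s..t} DM = FM t - FM s"
    using ex_primitive[OF conts(1)] by blast
  obtain FI where FI: "continuous_on UNIV FI" "\<And>s t. 0 \<le> s \<Longrightarrow> s \<le> t \<Longrightarrow> integral {s..t} DI = FI t - FI s"
    using ex_primitive[OF conts(2)] by blast
  obtain fM where fM: "continuous_on UNIV fM" "\<And>s t. 0 \<le> s \<Longrightarrow> s \<le> t \<Longrightarrow> integral {s..t} dM = fM t - fM s"
    using ex_primitive[OF conts(3)] by blast
  obtain fI where fI: "continuous_on UNIV fI" "\<And>s t. 0 \<le> s \<Longrightarrow> s \<le> t \<Longrightarrow> integral {s..t} dI = fI t - fI s"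
    using ex_primitive[OF conts(4)] by blast
  note [measurable] = borel_measurable_continuous_onI[OF FM(1)] borel_measurable_continuous_onI[OF FI(1)]
    borel_measurable_continuous_onI[OF fM(1)] borel_measurable_continuous_onI[OF fI(1)]
    borel_measurable_continuous_onI[OF conts(5)] borel_measurable_continuous_onI[OF conts(6)]
    borel_measurable_continuous_onI[OF deriv_tau_cont]
  have sp: "0 \<le> s - tau s" "s - tau s \<le> s" "0 \<le> s" "s \<le> T" if "s \<in> space S" for s
    using lag_bounds[of s] lag_le[of s] times that by (auto simp: space_S)
  have cong: "f \<in> borel_measurable S" if "g \<in> borel_measurable borel" "\<And>s. s \<in> space S \<Longrightarrow> f s = g s" for f g :: "real \<Rightarrow> real"
    using meas_S[OF that(1)] measurable_cong[of S f g borel] that(2) by blast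
  have rho: "\<rho> s = (1 - deriv tau s) * p (s - tau s) * exp (- (fI s - fI (s - tau s)))" if "s \<in> space S" for s
    unfolding \<rho>_def using fI(2)[OF sp(1,2)[OF that]] by simp
  have "continuous_on {ta..tb} (\<lambda>s. (1 - deriv tau s) * p (s - tau s))"
    by (intro continuous_intros deriv_tau_cont continuous_on_compose2[OF conts(6)] conts) auto
  then have "bounded ((\<lambda>s. (1 - deriv tau s) * p (s - tau s)) ` {ta..tb})"
    by (intro compact_imp_bounded compact_continuous_image) auto
  then obtain Wm where Wm': "\<forall>y\<in>(\<lambda>s. (1 - deriv tau s) * p (s - tau s)) ` {ta..tb}. \<bar>y\<bar> \<le> Wm"
    unfolding bounded_real by blast
  have Wm: "\<bar>(1 - deriv tau s) * p (s - tau s)\<bar> \<le> Wm" if "s \<in> {ta..tb}" for s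
    using bspec[OF Wm' imageI[OF that]] .
  define Am where "Am = max (sqrt (2 * integral {0..t} DM)) (max (sqrt (2 * integral {0..T} DM)) (sqrt (2 * integral {0..T} DI)))"
  have "season S (a0 t) (W t) (A t) B C E Wm Am"
  proof (rule season.intro[OF fin_S], unfold_locales)
    show "0 \<le> a0 t" by (simp add: a0_def)
    show "W t \<in> borel_measurable S"
      by (rule cong[of "\<lambda>s. if s \<le> t then exp (- (fM t - fM s)) * ((1 - deriv tau s) * p (s - tau s) * exp (- (fI s - fI (s - tau s)))) else 0"])
         (measurable, use rho sp fM in \<open>auto simp: W_def\<close>)
    show "A t \<in> borel_measurable S"
      by (rule cong[of "\<lambda>s. sqrt (2 * (if s \<le> t then FM t - FM s else 0))"])
         (measurable, use sp FM in \<open>auto simp: A_def\<close>)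
    show "B \<in> borel_measurable S"
      by (rule cong[of "\<lambda>s. sqrt (2 * (FI s - FI (s - tau s)))"])
         (measurable, use sp FI in \<open>auto simp: B_def\<close>)
    show "C \<in> borel_measurable S"
      by (rule cong[of "\<lambda>s. sqrt (2 * (FM (s - tau s) - FM 0))"])
         (measurable, use sp FM in \<open>auto simp: C_def\<close>)
    show "E \<in> borel_measurable S"
      by (rule cong[of "\<lambda>s. exp (- (fM (s - tau s) - fM 0))"])
         (measurable, use sp fM in \<open>auto simp: E_def\<close>)
    fix s assume s: "s \<in> space S"
    show "0 \<le> W t s" using rho_nonneg[of s] by (simp add: W_def)
    show "0 \<le> E s" by (simp add: E_def)
    show "E s \<le> 1" using int_nonneg by (simp add: E_def)
    have W0: "0 \<le> Wm" using Wm[of s] s by (simp add: space_S)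
    have "\<rho> s \<le> Wm * 1" unfolding \<rho>_def
      using Wm[of s] s int_nonneg W0 by (intro mult_mono) (auto simp: space_S)
    then have "exp (- integral {s..t} dM) * \<rho> s \<le> 1 * Wm"
      using int_nonneg rho_nonneg W0 by (intro mult_mono) auto
    then show "W t s \<le> Wm" using W0 by (simp add: W_def)
    have "A t s \<le> sqrt (2 * integral {0..t} DM)" unfolding A_def
      using int_mono(1)[of 0 s t t] sp[OF s] by simp
    then show "\<bar>A t s\<bar> \<le> Am" using int_nonneg(1)[of s t] by (simp add: Am_def A_def le_max_iff_disj)
    have "B s \<le> sqrt (2 * integral {0..T} DI)" unfolding B_def
      using int_mono(2)[of 0 "s - tau s" s T] sp[OF s] by simp
    then show "\<bar>B s\<bar> \<le> Am" using int_nonneg by (simp add: Am_def B_def le_max_iff_disj)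
    have "C s \<le> sqrt (2 * integral {0..T} DM)" unfolding C_def
      using int_mono(1)[of 0 0 "s - tau s" T] sp[OF s] by simp
    then show "\<bar>C s\<bar> \<le> Am" using int_nonneg by (simp add: Am_def C_def le_max_iff_disj)
  qed
  then show ?thesis by blast
qed

definition Wm where "Wm t = fst (SOME w. season S (a0 t) (W t) (A t) B C E (fst w) (snd w))"
definition Am where "Am t = snd (SOME w. season S (a0 t) (W t) (A t) B C E (fst w) (snd w))"

lemma season_t: "season S (a0 t) (W t) (A t) B C E (Wm t) (Am t)"
proof -
  obtain x y where "season S (a0 t) (W t) (A t) B C E x y" using season_ex by blast
  then have "\<exists>w. season S (a0 t) (W t) (A t) B C E (fst w) (snd w)" by (intro exI[of _ "(x, y)"]) simp
  then show ?thesis unfolding Wm_def Am_def by (rule someI_ex)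
qed

sublocale yr: season S "a0 t" "A0 t" "W t" "A t" B C E "Wm t" "Am t" for t
  by (rule season_t)

lemma nl_hh:
  assumes "0 \<le> M" shows "nl M (hd 0 * M) hh"
  unfolding nl_def
proof (intro conjI allI impI hh_cont)
  fix z :: real assume z: "0 \<le> z" "z \<le> M"
  show "0 \<le> hh z" using h_nonneg z by (simp add: hh_eq)
  have "hd 0 * z \<le> hd 0 * M" using z hd0_pos by (intro mult_left_mono) auto
  then show "hh z \<le> hd 0 * M" using hh_le[OF z(1)] by linarith
qed

definition act :: "real \<Rightarrow> bool" where
  "act s \<longleftrightarrow> (\<exists>k::int. ta + of_int k * T \<le> s \<and> s \<le> tb + of_int k * T)"

lemma act_first:
  assumes "0 \<le> s" "s \<le> T"
  shows "act s \<longleftrightarrow> s \<in> {ta..tb}"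
proof
  assume "act s"
  then obtain k :: int where k: "ta + of_int k * T \<le> s" "s \<le> tb + of_int k * T" by (auto simp: act_def)
  have "k = 0"
  proof (rule ccontr)
    assume "k \<noteq> 0"
    then consider "1 \<le> k" | "k \<le> -1" by linarith
    then show False
    proof cases
      case 1
      then have "1 * T \<le> of_int k * T" using T_pos by (intro mult_right_mono) auto
      then show False using k assms times by linarith
    next
      case 2
      then have "of_int k * T \<le> of_int (-1) * T" using T_pos by (intro mult_right_mono) linarith+
      then show False using k assms times by simp
    qed
  qed
  then show "s \<in> {ta..tb}" using k by simp
next
  assume "s \<in> {ta..tb}" then show "act s" unfolding act_def by (intro exI[of _ 0]) auto
qed

lemma act_shift: "act (s + T) \<longleftrightarrow> act s"
proof
  assume "act (s + T)"
  then obtain k :: int where "ta + of_int k * T \<le> s + T \<and> s + T \<le> tb + of_int k * T" by (auto simp: act_def)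
  then show "act s" unfolding act_def by (intro exI[of _ "k - 1"]) (auto simp: algebra_simps)
next
  assume "act s"
  then obtain k :: int where "ta + of_int k * T \<le> s \<and> s \<le> tb + of_int k * T" by (auto simp: act_def)
  then show "act (s + T)" unfolding act_def by (intro exI[of _ "k + 1"]) (auto simp: algebra_simps)
qed

abbreviation Rp :: "real \<Rightarrow> (real \<Rightarrow> real) \<Rightarrow> real \<Rightarrow> real" where
  "Rp \<equiv> Rop DI dI tau p h T ta tb"
abbreviation HM :: "real \<Rightarrow> real \<Rightarrow> (real \<Rightarrow> real) \<Rightarrow> real \<Rightarrow> real" where
  "HM \<equiv> heatop DM dM"
abbreviation mild :: "(real \<Rightarrow> real \<Rightarrow> real) \<Rightarrow> bool" where
  "mild \<equiv> mild_solution DM dM DI dI tau p h T ta tb"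

lemma Rp_inactive: "\<not> act s \<Longrightarrow> Rp s \<psi> = (\<lambda>_. 0)"
  unfolding act_def Rop_def[abs_def] by (rule ext) (rule if_not_P)

lemma Rp_active: "act s \<Longrightarrow> bm M \<psi> \<Longrightarrow> Rp s \<psi> = (\<lambda>x. \<rho> s * gavg (B s) (\<lambda>y. hh (\<psi> y)) x)"
proof (rule ext)
  fix x assume a: "act s" and b: "bm M \<psi>"
  have "(\<lambda>y. h (\<psi> y)) = (\<lambda>y. hh (\<psi> y))" using bmD(2)[OF b] by (simp add: hh_eq)
  moreover have "(\<lambda>y. hh (\<psi> y)) \<in> borel_measurable borel"
    using bmD(1)[OF b] borel_measurable_continuous_onI[OF hh_cont] by measurable
  ultimately show "Rp s \<psi> x = \<rho> s * gavg (B s) (\<lambda>y. hh (\<psi> y)) x"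
    using a by (simp add: Rop_def act_def heatopI \<rho>_def B_def)
qed

lemma HM_start: "bm M \<phi> \<Longrightarrow> HM t 0 \<phi> = (\<lambda>x. a0 t * gavg (A0 t) \<phi> x)"
  by (rule ext) (simp add: heatopM bmD a0_def A0_def)

lemma bm_HM_start: "bm M \<phi> \<Longrightarrow> bm M (HM t 0 \<phi>)"
proof -
  assume b: "bm M \<phi>"
  have "0 \<le> a0 t" "a0 t \<le> 1" using int_nonneg by (auto simp: a0_def)
  moreover have "0 \<le> M" by (rule bm_nonneg[OF b])
  ultimately have "a0 t * gavg (A0 t) \<phi> x \<le> 1 * M" for x
    using bmD(2,3)[OF bm_gavg[OF b]] by (intro mult_mono) auto
  then show ?thesis unfolding HM_start[OF b] using bmD(1,2)[OF bm_gavg[OF b]] \<open>0 \<le> a0 t\<close>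
    by (auto simp: bm_def)
qed

lemma seas_eq:
  assumes b: "bm M \<phi>" and s: "s \<in> {ta..tb}" and t: "s \<le> t"
  shows "HM t s (Rp s (HM (s - tau s) 0 \<phi>)) x = W t s * yr.seas t hh \<phi> s x"
proof -
  note M = bm_nonneg[OF b]
  have a: "act s" using s times by (intro act_first[THEN iffD2]) auto
  have "HM (s - tau s) 0 \<phi> = (\<lambda>y. E s * gavg (C s) \<phi> y)"
    using HM_start[OF b] by (simp add: a0_def A0_def E_def C_def)
  with Rp_active[OF a bm_HM_start[OF b, of "s - tau s"]]
  have R: "Rp s (HM (s - tau s) 0 \<phi>) = (\<lambda>x. \<rho> s * gavg (B s) (\<lambda>y. hh (E s * gavg (C s) \<phi> y)) x)"
    by simp
  have "bm (hd 0 * M) (\<lambda>y. hh (E s * gavg (C s) \<phi> y))"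
    using s by (intro bm_nl[OF nl_hh[OF M]] yr.bm_arg b) (simp add: space_S)
  then have m: "gavg (B s) (\<lambda>y. hh (E s * gavg (C s) \<phi> y)) \<in> borel_measurable borel"
    by (rule gavg_measurable[OF bmD(1)])
  show ?thesis unfolding R using t m
    by (simp add: heatopM gavg_cmult W_def yr.seas_def A_def)
qed

lemma year_has_integral:
  assumes b: "bm M \<phi>" and t: "0 \<le> t"
  shows "((\<lambda>s. HM t s (Rp s (HM (s - tau s) 0 \<phi>)) x) has_integral (\<integral>s. W t s * yr.seas t hh \<phi> s x \<partial>S)) {0..min t T}"
proof -
  note M = bm_nonneg[OF b]
  have "((\<lambda>s. W t s * yr.seas t hh \<phi> s x) has_integral (\<integral>s. W t s * yr.seas t hh \<phi> s x \<partial>S)) {ta..tb}"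
    by (intro S_has_integral yr.seas_integrable[OF nl_hh[OF M] b])
  then have "((\<lambda>s. if s \<in> {ta..tb} then W t s * yr.seas t hh \<phi> s x else 0) has_integral (\<integral>s. W t s * yr.seas t hh \<phi> s x \<partial>S)) UNIV"
    by (simp only: has_integral_restrict_UNIV)
  moreover have "(\<lambda>s. if s \<in> {ta..tb} then W t s * yr.seas t hh \<phi> s x else 0)
    = (\<lambda>s. if s \<in> {0..min t T} then HM t s (Rp s (HM (s - tau s) 0 \<phi>)) x else 0)"
  proof
    fix s
    consider "s \<in> {ta..tb}" "s \<le> t" | "s \<in> {ta..tb}" "t < s" | "s \<notin> {ta..tb}" by fastforce
    then show "(if s \<in> {ta..tb} then W t s * yr.seas t hh \<phi> s x else 0)
      = (if s \<in> {0..min t T} then HM t s (Rp s (HM (s - tau s) 0 \<phi>)) x else 0)"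
    proof cases
      case 1 then show ?thesis using seas_eq[OF b 1] times by auto
    next
      case 2 then show ?thesis by (auto simp: W_def)
    next
      case 3
      then have "\<not> act s" if "s \<in> {0..min t T}" using act_first[of s] that by auto
      then show ?thesis using 3 Rp_inactive heatop_zero by auto
    qed
  qed
  ultimately show ?thesis by (simp only: has_integral_restrict_UNIV)
qed

lemma Op_eq_year:
  assumes b: "bm M \<phi>" and t: "0 \<le> t"
  shows "yr.Op t hh \<phi> x = HM t 0 \<phi> x + integral {0..min t T} (\<lambda>s. HM t s (Rp s (HM (s - tau s) 0 \<phi>)) x)"
  unfolding yr.Op_def integral_unique[OF year_has_integral[OF b t]] by (simp add: HM_start[OF b])

lemma Qmap_eq:
  assumes b: "bm M \<phi>"
  shows "Qmap DM dM DI dI tau p h T ta tb \<phi> x = yr.Op T hh \<phi> x"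
proof -
  note M = bm_nonneg[OF b]
  have "integral {ta..tb} (\<lambda>s. HM T s (Rp s (HM (s - tau s) 0 \<phi>)) x) = integral {ta..tb} (\<lambda>s. W T s * yr.seas T hh \<phi> s x)"
    by (rule integral_cong) (use seas_eq[OF b] times in auto)
  also have "\<dots> = (\<integral>s. W T s * yr.seas T hh \<phi> s x \<partial>S)"
    by (intro integral_unique S_has_integral yr.seas_integrable[OF nl_hh[OF M] b])
  finally show ?thesis by (simp add: Qmap_def yr.Op_def HM_start[OF b])
qed

lemma linQ_exp: "linQ DM dM DI dI tau p (hd 0) T ta tb (\<lambda>y. exp (- \<mu> * y)) 0 = yr.Kern T (hd 0) \<mu>"
proof -
  let ?e = "\<lambda>y. exp (- \<mu> * y)"
  have em: "?e \<in> borel_measurable borel" by measurable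
  have "integral {ta..tb} (\<lambda>s. (1 - deriv tau s) * p (s - tau s) * hd 0 *
          HM T s (heatop DI dI s (s - tau s) (HM (s - tau s) 0 ?e)) 0)
      = integral {ta..tb} (\<lambda>s. W T s * yr.lseas T (hd 0) ?e s 0)"
  proof (rule integral_cong)
    fix s assume s: "s \<in> {ta..tb}"
    have 1: "HM (s - tau s) 0 ?e = (\<lambda>y. E s * gavg (C s) ?e y)"
      using em by (auto simp: heatopM E_def C_def)
    have m1: "gavg (C s) ?e \<in> borel_measurable borel" by (rule gavg_measurable[OF em])
    have 2: "heatop DI dI s (s - tau s) (HM (s - tau s) 0 ?e)
        = (\<lambda>x. exp (- integral {s - tau s..s} dI) * (E s * gavg (B s) (gavg (C s) ?e) x))"
      unfolding 1 using m1 by (auto simp: heatopI B_def gavg_cmult_fun)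
    have m2: "gavg (B s) (gavg (C s) ?e) \<in> borel_measurable borel" by (rule gavg_measurable[OF m1])
    show "(1 - deriv tau s) * p (s - tau s) * hd 0 *
          HM T s (heatop DI dI s (s - tau s) (HM (s - tau s) 0 ?e)) 0 = W T s * yr.lseas T (hd 0) ?e s 0"
      unfolding 2 using m2 s times by (simp add: heatopM gavg_cmult_fun yr.seas_def W_def \<rho>_def A_def)
  qed
  also have "\<dots> = (\<integral>s. W T s * yr.lseas T (hd 0) ?e s 0 \<partial>S)"
    by (intro integral_unique S_has_integral)
       (unfold yr.seas_exp, use yr.Kern_integrable[of T "hd 0" \<mu>] in simp)
  finally have "linQ DM dM DI dI tau p (hd 0) T ta tb ?e 0 = yr.Lin T (hd 0) ?e 0"
    unfolding linQ_def yr.Op_def using em by (simp add: heatopM a0_def A0_def)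
  then show ?thesis using yr.Lin_exp[of T "hd 0" \<mu> 0] by simp
qed

abbreviation cstar :: real where
  "cstar \<equiv> spreading_speed DM dM DI dI tau p (hd 0) T ta tb"

lemma cstar_eq: "cstar = Inf ((\<lambda>\<mu>. ln (yr.Kern T (hd 0) \<mu>) / \<mu>) ` {0<..})"
  unfolding spreading_speed_def linQ_exp ..

lemma Kern0: "1 < yr.Kern T (hd 0) 0"
proof -
  define k where "k = a0 T"
  have "0 < integral {0..T} dM"
  proof -
    have "continuous_on {0..T} dM" by (rule conts)
    moreover have "\<exists>s\<in>{0..T}. dM s \<noteq> 0" using coef_nonneg(3)[of 0] T_pos by (intro bexI[of _ 0]) auto
    ultimately have "integral {0..T} dM \<noteq> 0"
      using integral_eq_0_iff[of 0 T dM] T_pos coef_nonneg(3) by (auto simp: less_imp_le)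
    then show ?thesis using int_nonneg(3)[of 0 T] by simp
  qed
  then have k: "0 < k" "k < 1" by (auto simp: k_def a0_def)
  have "(\<integral>s. W T s * (hd 0 * E s) \<partial>S) = integral {ta..tb} (\<lambda>s. W T s * (hd 0 * E s))"
    by (intro integral_unique[symmetric] S_has_integral) (use yr.Kern_integrable[of T "hd 0" 0] in simp)
  also have "\<dots> = integral {ta..tb} (\<lambda>s. k * (dR0 dI tau p (hd 0) s / kbar dM s (s - tau s)))"
  proof (rule integral_cong)
    fix s assume s: "s \<in> {ta..tb}"
    have "0 \<le> s - tau s" "s - tau s \<le> s" "s \<le> T" using lag_bounds[OF s] lag_le[of s] s times by auto
    then have "integral {0..T} dM = integral {0..s - tau s} dM + integral {s - tau s..s} dM + integral {s..T} dM"
      using int_split(2)[of 0 "s - tau s" T] int_split(2)[of "s - tau s" s T] by simp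
    then have "k = E s * kbar dM s (s - tau s) * exp (- integral {s..T} dM)"
      by (simp add: k_def a0_def E_def kbar_def exp_add[symmetric])
    then show "W T s * (hd 0 * E s) = k * (dR0 dI tau p (hd 0) s / kbar dM s (s - tau s))"
      using \<open>s \<le> T\<close> by (simp add: W_def \<rho>_def dR0_def kbar_def)
  qed
  also have "\<dots> = k * integral {ta..tb} (\<lambda>s. dR0 dI tau p (hd 0) s / kbar dM s (s - tau s))"
    by (rule integral_mult_right)
  finally have K: "yr.Kern T (hd 0) 0 = k + k * integral {ta..tb} (\<lambda>s. dR0 dI tau p (hd 0) s / kbar dM s (s - tau s))"
    by (simp add: yr.Kern_def k_def)
  have kb: "kbar dM T 0 = k" by (simp add: kbar_def k_def a0_def)
  have "1 - k < k * integral {ta..tb} (\<lambda>s. dR0 dI tau p (hd 0) s / kbar dM s (s - tau s))"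
    using L_gt1 k unfolding Lconst_def kb by (simp add: field_simps)
  then show ?thesis using K by simp
qed

lemma Kern_ge: "yr.Kern T (hd 0) 0 \<le> yr.Kern T (hd 0) \<mu>"
proof -
  have i1: "integrable S (\<lambda>s. W T s * (hd 0 * E s))" using yr.Kern_integrable[of T "hd 0" 0] by simp
  have "(\<integral>s. W T s * (hd 0 * E s) \<partial>S) \<le> (\<integral>s. W T s * yr.tilt T (hd 0) \<mu> s \<partial>S)"
  proof (intro integral_mono i1 yr.Kern_integrable mult_left_mono yr.W_bounds)
    fix s assume s: "s \<in> space S"
    have "hd 0 * E s * 1 * 1 * 1 \<le> yr.tilt T (hd 0) \<mu> s"
      using yr.E_bounds[OF s] hd0_pos by (intro mult_mono) auto
    then show "hd 0 * E s \<le> yr.tilt T (hd 0) \<mu> s"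
      by simp
  qed
  moreover have "a0 T * 1 \<le> a0 T * nmgf \<mu> (A0 T)" by (intro mult_left_mono) (auto simp: a0_def)
  ultimately show ?thesis by (simp add: yr.Kern_def)
qed

lemma Kern_gt1: "1 < yr.Kern T (hd 0) \<mu>"
  using Kern0 Kern_ge[of \<mu>] by linarith

lemma cstar_bdd: "bdd_below ((\<lambda>\<mu>. ln (yr.Kern T (hd 0) \<mu>) / \<mu>) ` {0<..})"
  by (rule bdd_belowI[of _ 0]) (use Kern_gt1 in \<open>auto intro!: divide_nonneg_nonneg simp: less_imp_le\<close>)

lemma cstar_le: "0 < \<mu> \<Longrightarrow> cstar \<le> ln (yr.Kern T (hd 0) \<mu>) / \<mu>"
  unfolding cstar_eq by (rule cInf_lower[OF _ cstar_bdd]) auto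

text \<open>Without any diffusion the kernel would be a point mass and \<open>cstar\<close> would vanish.\<close>
lemma spread_pos: "0 < yr.Lin T (hd 0) (indicator {..y}) 0"
proof -
  let ?i = "indicator {..y} :: real \<Rightarrow> real"
  have bi: "bm 1 ?i" by (auto simp: bm_def indicator_def)
  note nl1 = nl_lin[of "hd 0" 1, OF less_imp_le[OF hd0_pos]]
  have nn: "0 \<le> yr.Lin T (hd 0) ?i 0" by (rule bmD(2)[OF yr.Op_bm[OF nl1 bi]])
  have sn: "0 \<le> W T s * yr.lseas T (hd 0) ?i s 0" if "s \<in> space S" for s
    by (intro mult_nonneg_nonneg yr.W_bounds that bmD(2)[OF yr.bm_seas[OF nl1 bi that]])
  have gp: "0 < gavg a f x" if "bm 1 f" "\<And>x. x \<le> y \<Longrightarrow> 0 < f x" "x \<le> y" for a f x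
    using gavg_pos[OF that(1), of y a x] that(2,3) by (cases "a = 0") auto
  have gp': "0 < gavg a f x" if "bm 1 f" "\<And>x. 0 < f x" for a f x
    using gavg_pos[OF that(1), of y a x] that(2) by (cases "a = 0") auto
  have "yr.Lin T (hd 0) ?i 0 \<noteq> 0"
  proof
    assume "yr.Lin T (hd 0) ?i 0 = 0"
    moreover have "0 \<le> a0 T * gavg (A0 T) ?i 0" using bmD(2)[OF bm_gavg[OF bi]] by (simp add: a0_def)
    moreover have "0 \<le> (\<integral>s. W T s * yr.lseas T (hd 0) ?i s 0 \<partial>S)"
      by (intro Bochner_Integration.integral_nonneg sn)
    ultimately have z1: "a0 T * gavg (A0 T) ?i 0 = 0" and z2: "(\<integral>s. W T s * yr.lseas T (hd 0) ?i s 0 \<partial>S) = 0"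
      unfolding yr.Op_def by linarith+
    have A00: "A0 T = 0"
    proof (rule ccontr)
      assume "A0 T \<noteq> 0"
      then have "0 < gavg (A0 T) ?i 0" by (intro gavg_pos[OF bi, of y]) auto
      then show False using z1 by (simp add: a0_def)
    qed
    have "AE s in S. W T s * yr.lseas T (hd 0) ?i s 0 = 0"
      using z2 sn by (subst (asm) integral_nonneg_eq_0_iff_AE) (auto intro: yr.seas_integrable[OF nl1 bi])
    then have ae: "AE s in S. W T s * yr.tilt T (hd 0) \<mu> s
      = W T s * (hd 0 * E s)" for \<mu>
    proof eventually_elim
      fix s assume z: "W T s * yr.lseas T (hd 0) ?i s 0 = 0"
      show "W T s * yr.tilt T (hd 0) \<mu> s
        = W T s * (hd 0 * E s)"
      proof (cases "W T s = 0 \<or> (A T s = 0 \<and> B s = 0 \<and> C s = 0)")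
        case False
        have "yr.lseas T (hd 0) ?i s 0 = hd 0 * (E s * gavg (A T s) (gavg (B s) (gavg (C s) ?i)) 0)"
          unfolding yr.seas_def gavg_cmult_fun ..
        moreover have "0 < gavg (A T s) (gavg (B s) (gavg (C s) ?i)) 0"
        proof -
          have p0: "0 < ?i x" if "x \<le> y" for x using that by simp
          consider "C s \<noteq> 0" | "B s \<noteq> 0" | "A T s \<noteq> 0" using False by blast
          then show ?thesis
          proof cases
            case 1
            have "0 < gavg (C s) ?i x" for x by (rule gavg_pos[OF bi p0 1])
            from gp'[OF bm_gavg[OF bm_gavg[OF bi]] gp'[OF bm_gavg[OF bi] this]] show ?thesis .
          next
            case 2
            have "0 < gavg (C s) ?i x" if "x \<le> y" for x by (rule gp[OF bi p0 that])
            then have "0 < gavg (B s) (gavg (C s) ?i) x" for x by (intro gavg_pos[OF bm_gavg[OF bi] _ 2, of y]) auto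
            from gp'[OF bm_gavg[OF bm_gavg[OF bi]] this] show ?thesis .
          next
            case 3
            have "0 < gavg (C s) ?i x" if "x \<le> y" for x by (rule gp[OF bi p0 that])
            then have "0 < gavg (B s) (gavg (C s) ?i) x" if "x \<le> y" for x by (intro gp[OF bm_gavg[OF bi] _ that]) auto
            then show ?thesis by (intro gavg_pos[OF bm_gavg[OF bm_gavg[OF bi]] _ 3, of y]) auto
          qed
        qed
        ultimately have "0 < yr.lseas T (hd 0) ?i s 0" using hd0_pos by (simp add: E_def)
        then show ?thesis using z False by simp
      qed auto
    qed
    have [measurable]: "W T \<in> borel_measurable S" "A T \<in> borel_measurable S" "B \<in> borel_measurable S"
      "C \<in> borel_measurable S" "E \<in> borel_measurable S" by (rule yr.meas)+
    have Kc: "yr.Kern T (hd 0) \<mu> = yr.Kern T (hd 0) 0" for \<mu>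
    proof -
      have "(\<integral>s. W T s * yr.tilt T (hd 0) \<mu> s \<partial>S)
        = (\<integral>s. W T s * (hd 0 * E s) \<partial>S)"
        by (rule integral_cong_AE[OF _ _ ae]) measurable
      then show ?thesis unfolding yr.Kern_def by (simp add: A00)
    qed
    define K where "K = ln (yr.Kern T (hd 0) 0)"
    have K: "0 < K" using Kern0 by (simp add: K_def)
    define m where "m = 2 * K / cstar"
    have m: "0 < m" using K cstar_pos by (simp add: m_def)
    have "cstar \<le> K / m" using cstar_le[OF m] unfolding Kc[of m] K_def .
    also have "\<dots> = cstar / 2" using K cstar_pos by (simp add: m_def)
    finally show False using cstar_pos by simp
  qed
  then show ?thesis using nn by simp
qed

end

section \<open>Mild solutions and travelling waves\<close>

context model
begin

lemma integral_shift_T: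
  assumes "\<And>t. f (t + T) = (f t :: real)"
  shows "integral {s + T..t + T} f = integral {s..t} f"
proof -
  have "f \<circ> (+) T = f" using assms by (auto simp: add.commute)
  then show ?thesis using integral_shift_Icc_real[of s t f T] by simp
qed

lemma per: "DM (t + T) = DM t" "DI (t + T) = DI t" "dM (t + T) = dM t" "dI (t + T) = dI t"
  "tau (t + T) = tau t" "p (t + T) = p t"
  using coef_per by auto

lemma heatop_shift: "HM (t + T) (s + T) \<psi> x = HM t s \<psi> x"
  "heatop DI dI (t + T) (s + T) \<psi> x = heatop DI dI t s \<psi> x"
  unfolding heatop_def green_def by (simp_all add: integral_shift_T per)

lemma deriv_tau_shift: "deriv tau (t + T) = deriv tau t"
proof -
  have "((\<lambda>x. tau (x + T)) has_real_derivative deriv tau (t + T)) (at t)"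
    using tau_DERIV[of "t + T"] by (simp add: DERIV_shift)
  then have "(tau has_real_derivative deriv tau (t + T)) (at t)" by (simp add: per)
  then show ?thesis using DERIV_unique[OF _ tau_DERIV] by blast
qed

lemma Rp_shift: "Rp (s + T) \<psi> x = Rp s \<psi> x"
proof -
  have lag: "s + T - tau (s + T) = (s - tau s) + T" by (simp add: per)
  have "(\<exists>k::int. ta + of_int k * T \<le> s + T \<and> s + T \<le> tb + of_int k * T)
      \<longleftrightarrow> (\<exists>k::int. ta + of_int k * T \<le> s \<and> s \<le> tb + of_int k * T)"
    using act_shift[of s] unfolding act_def .
  then show ?thesis unfolding Rop_def deriv_tau_shift unfolding lag unfolding per heatop_shift by (simp only:)
qed

lemma Rp_translate: "Rp s (\<lambda>y. \<psi> (y - r)) x = Rp s \<psi> (x - r)"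
  unfolding Rop_def heatop_translate[of DI dI s "s - tau s" "\<lambda>y. h (\<psi> y)" r x] ..

lemma Op_early:
  assumes b: "bm M \<phi>" and r: "0 \<le> r" "r < ta"
  shows "yr.Op r hh \<phi> = HM r 0 \<phi>"
proof
  fix x
  have "(\<integral>s. W r s * yr.seas r hh \<phi> s x \<partial>S) = (\<integral>s. 0 \<partial>S)"
    by (intro Bochner_Integration.integral_cong) (use r in \<open>auto simp: space_S W_def\<close>)
  then show "yr.Op r hh \<phi> x = HM r 0 \<phi> x" unfolding yr.Op_def HM_start[OF b] by simp
qed

lemma Op_semigroup:
  assumes b: "bm M \<phi>" and t: "T \<le> t"
  shows "HM t T (yr.Op T hh \<phi>) x = yr.Op t hh \<phi> x"
proof -
  note M = bm_nonneg[OF b]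
  note nlh = nl_hh[OF M]
  define e a where "e = exp (- integral {T..t} dM)" and "a = sqrt (2 * integral {T..t} DM)"
  have a: "0 \<le> a" "a\<^sup>2 = 2 * integral {T..t} DM" using int_nonneg(1)[of T t] by (auto simp: a_def)
  have bO: "yr.Op T hh \<phi> \<in> borel_measurable borel" by (rule bmD(1)[OF yr.Op_bm[OF nlh b]])
  have bI: "bm (measure S (space S) * (Wm T * (hd 0 * M))) (\<lambda>x. \<integral>s. W T s * yr.seas T hh \<phi> s x \<partial>S)"
  proof -
    have "bm (0 * M + measure S (space S) * (Wm T * (hd 0 * M))) (season.Op S 0 (A0 T) (W T) (A T) B C E hh \<phi>)"
    proof -
      interpret z: season S 0 "A0 T" "W T" "A T" B C E "Wm T" "Am T"
        using season_t[of T] unfolding season_def season_axioms_def by auto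
      show ?thesis by (rule z.Op_bm[OF nlh b])
    qed
    moreover have "season.Op S 0 (A0 T) (W T) (A T) B C E hh \<phi> = (\<lambda>x. \<integral>s. W T s * yr.seas T hh \<phi> s x \<partial>S)"
    proof -
      interpret z: season S 0 "A0 T" "W T" "A T" B C E "Wm T" "Am T"
        using season_t[of T] unfolding season_def season_axioms_def by auto
      show ?thesis by (rule ext) (simp add: z.Op_def)
    qed
    ultimately show ?thesis by simp
  qed
  have b0: "bm (a0 T * M) (\<lambda>x. a0 T * gavg (A0 T) \<phi> x)"
    using bmD[OF bm_gavg[OF b]] by (auto simp: bm_def a0_def)
  have "gavg a (yr.Op T hh \<phi>) x = gavg a (\<lambda>x. a0 T * gavg (A0 T) \<phi> x) x + gavg a (\<lambda>x. \<integral>s. W T s * yr.seas T hh \<phi> s x \<partial>S) x"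
    unfolding yr.Op_def[abs_def] by (rule gavg_add[OF bmD(1,4)[OF b0] bmD(1,4)[OF bI]])
  also have "gavg a (\<lambda>x. a0 T * gavg (A0 T) \<phi> x) x = a0 T * gavg (A0 t) \<phi> x"
  proof -
    have "gavg a (gavg (A0 T) \<phi>) x = gavg (sqrt (a\<^sup>2 + (A0 T)\<^sup>2)) \<phi> x"
      by (rule gavg_gavg[OF bmD(1,4)[OF b] a(1)]) (simp add: A0_def int_nonneg)
    moreover have "sqrt (a\<^sup>2 + (A0 T)\<^sup>2) = A0 t"
      using int_split(1)[of 0 T t] t T_pos int_nonneg(1)[of 0 T] a(2) by (simp add: A0_def)
    ultimately show ?thesis by (simp add: gavg_cmult)
  qed
  also have "gavg a (\<lambda>x. \<integral>s. W T s * yr.seas T hh \<phi> s x \<partial>S) x = (\<integral>s. gavg a (\<lambda>x. W T s * yr.seas T hh \<phi> s x) x \<partial>S)"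
  proof (rule gavg_integral_commute[OF fin_S, of _ "Wm T * (hd 0 * M)"])
    have [measurable]: "W T \<in> borel_measurable S" by (rule yr.meas)
    have "(\<lambda>(s, x). yr.seas T hh \<phi> s x) \<in> borel_measurable (S \<Otimes>\<^sub>M borel)"
      by (rule yr.seas_measurable_pair[OF nl_meas[OF nlh] bmD(1)[OF b]])
    then have [measurable]: "(\<lambda>w. yr.seas T hh \<phi> (fst w) (snd w)) \<in> borel_measurable (S \<Otimes>\<^sub>M borel)"
      by (simp add: case_prod_beta')
    show "(\<lambda>(s, x). W T s * yr.seas T hh \<phi> s x) \<in> borel_measurable (S \<Otimes>\<^sub>M borel)"
      unfolding case_prod_beta' by measurable
    show "\<bar>W T s * yr.seas T hh \<phi> s x\<bar> \<le> Wm T * (hd 0 * M)" if "s \<in> space S" for s x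
      using yr.W_bounds[OF that] bmD[OF yr.bm_seas[OF nlh b that]] yr.Wm_nonneg[OF that]
      unfolding abs_mult by (intro mult_mono) auto
  qed
  also have "\<dots> = (\<integral>s. W T s * yr.seas t hh \<phi> s x \<partial>S)"
  proof (rule Bochner_Integration.integral_cong[OF refl])
    fix s assume s: "s \<in> space S"
    then have sT: "s \<le> T" using times by (simp add: space_S)
    have bb: "bm (hd 0 * M) (gavg (B s) (\<lambda>y. hh (E s * gavg (C s) \<phi> y)))"
      by (intro bm_gavg bm_nl[OF nlh] yr.bm_arg b s)
    have "gavg a (yr.seas T hh \<phi> s) x = gavg (sqrt (a\<^sup>2 + (A T s)\<^sup>2)) (gavg (B s) (\<lambda>y. hh (E s * gavg (C s) \<phi> y))) x"
      unfolding yr.seas_def by (rule gavg_gavg[OF bmD(1,4)[OF bb] a(1)]) (simp add: A_def int_nonneg)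
    moreover have "sqrt (a\<^sup>2 + (A T s)\<^sup>2) = A t s"
      using int_split(1)[of s T t] t sT int_nonneg(1)[of s T] a(2) by (simp add: A_def)
    ultimately show "gavg a (\<lambda>x. W T s * yr.seas T hh \<phi> s x) x = W T s * yr.seas t hh \<phi> s x"
      by (simp add: gavg_cmult yr.seas_def)
  qed
  finally have g: "gavg a (yr.Op T hh \<phi>) x = a0 T * gavg (A0 t) \<phi> x + (\<integral>s. W T s * yr.seas t hh \<phi> s x \<partial>S)" .
  have ea: "e * a0 T = a0 t"
  proof -
    have "- integral {0..t} dM = - integral {T..t} dM + - integral {0..T} dM"
      using int_split(2)[of 0 T t] t T_pos by simp
    then show ?thesis by (simp only: e_def a0_def exp_add)
  qed
  have eW: "e * (\<integral>s. W T s * yr.seas t hh \<phi> s x \<partial>S) = (\<integral>s. W t s * yr.seas t hh \<phi> s x \<partial>S)"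
  proof -
    have "e * (\<integral>s. W T s * yr.seas t hh \<phi> s x \<partial>S) = (\<integral>s. e * (W T s * yr.seas t hh \<phi> s x) \<partial>S)" by simp
    also have "\<dots> = (\<integral>s. W t s * yr.seas t hh \<phi> s x \<partial>S)"
    proof (rule Bochner_Integration.integral_cong[OF refl])
      fix s assume "s \<in> space S"
      then have sT: "s \<le> T" using times by (simp add: space_S)
      have "- integral {s..t} dM = - integral {T..t} dM + - integral {s..T} dM"
        using int_split(2)[of s T t] t sT by simp
      then have "exp (- integral {s..t} dM) = e * exp (- integral {s..T} dM)" by (simp only: e_def exp_add)
      then have "e * W T s = W t s" using sT t by (simp add: W_def)
      then show "e * (W T s * yr.seas t hh \<phi> s x) = W t s * yr.seas t hh \<phi> s x" by (simp flip: mult.assoc)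
    qed
    finally show ?thesis .
  qed
  have "HM t T (yr.Op T hh \<phi>) x = e * gavg a (yr.Op T hh \<phi>) x"
    using bO by (simp add: heatopM e_def a_def)
  then show ?thesis unfolding g distrib_left eW mult.assoc[symmetric] ea yr.Op_def .
qed

lemma mildD:
  "mild u \<Longrightarrow> 0 \<le> t \<Longrightarrow> u t x = HM t 0 (u 0) x + integral {0..t} (\<lambda>s. HM t s (Rp s (u (s - tau s))) x)"
  unfolding mild_solution_def by blast

lemma mild_early:
  assumes m: "mild u" and r: "0 \<le> r" "r < ta"
  shows "u r = HM r 0 (u 0)"
proof
  fix x
  have "integral {0..r} (\<lambda>s. HM r s (Rp s (u (s - tau s))) x) = integral {0..r} (\<lambda>s. 0)"
  proof (rule integral_cong)
    fix s assume "s \<in> {0..r}"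
    then have "\<not> act s" using r times by (subst act_first) auto
    then show "HM r s (Rp s (u (s - tau s))) x = 0" by (simp add: Rp_inactive heatop_zero)
  qed
  then show "u r x = HM r 0 (u 0) x" using mildD[OF m r(1), of x] by simp
qed

lemma integrand_first_year:
  assumes early: "\<And>r. 0 \<le> r \<Longrightarrow> r < ta \<Longrightarrow> u r = HM r 0 (u 0)" and s: "0 \<le> s" "s \<le> T"
  shows "Rp s (u (s - tau s)) = Rp s (HM (s - tau s) 0 (u 0))"
proof (cases "act s")
  case True
  then have "s \<in> {ta..tb}" using act_first s by simp
  then have "u (s - tau s) = HM (s - tau s) 0 (u 0)" using lag_bounds[of s] times by (intro early) auto
  then show ?thesis by simp
qed (simp add: Rp_inactive)

lemma mild_unique:
  assumes m: "mild u" "mild v" and eq: "u 0 = v 0" and t: "0 \<le> t"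
  shows "u t = v t"
proof -
  have "\<forall>t. 0 \<le> t \<longrightarrow> t < real n * T + ta \<longrightarrow> u t = v t" for n
  proof (induction n)
    case 0
    have "u t = v t" if "0 \<le> t" "t < ta" for t
      unfolding mild_early[OF m(1) that] mild_early[OF m(2) that] eq ..
    then show ?case by simp
  next
    case (Suc n)
    show ?case
    proof (intro allI impI ext)
      fix t x assume t: "0 \<le> t" "t < real (Suc n) * T + ta"
      have "integral {0..t} (\<lambda>s. HM t s (Rp s (u (s - tau s))) x) = integral {0..t} (\<lambda>s. HM t s (Rp s (v (s - tau s))) x)"
      proof (rule integral_cong)
        fix s assume s: "s \<in> {0..t}"
        have "Rp s (u (s - tau s)) = Rp s (v (s - tau s))"
        proof (cases "act s")
          case True
          then obtain k :: int where k: "ta + of_int k * T \<le> s" "s \<le> tb + of_int k * T" by (auto simp: act_def)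
          have k0: "0 \<le> k"
          proof (rule ccontr)
            assume "\<not> 0 \<le> k"
            then have "of_int k * T \<le> of_int (-1) * T" using T_pos by (intro mult_right_mono) linarith+
            then show False using k s times by simp
          qed
          have "of_int k * T < real (Suc n) * T" using k s t by simp
          then have kn: "k \<le> int n" using T_pos by simp
          then have knT: "of_int k * T \<le> real n * T" using T_pos by (intro mult_right_mono) auto
          have tauk: "tau (r + real j * T) = tau r" for r j
          proof (induction j)
            case (Suc j)
            have "r + real (Suc j) * T = (r + real j * T) + T" by (simp add: algebra_simps)
            then show ?case by (simp only: per Suc)
          qed simp
          define r where "r = s - of_int k * T"
          have r: "r \<in> {ta..tb}" using k by (simp add: r_def)
          have "tau s = tau r" using tauk[of r "nat k"] k0 by (simp add: r_def)
          then have lag: "s - tau s = (r - tau r) + of_int k * T" by (simp add: r_def)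
          have "0 \<le> of_int k * T" using k0 T_pos by simp
          then have "0 \<le> s - tau s" "s - tau s < real n * T + ta"
            using lag lag_bounds[OF r] times knT by linarith+
          then show ?thesis using Suc by simp
        qed (simp add: Rp_inactive)
        then show "HM t s (Rp s (u (s - tau s))) x = HM t s (Rp s (v (s - tau s))) x" by simp
      qed
      then show "u t x = v t x" unfolding mildD[OF m(1) t(1), of x] mildD[OF m(2) t(1), of x] eq by simp
    qed
  qed
  moreover obtain n :: nat where "t / T < real n" using reals_Archimedean2 by blast
  then have "t < real n * T + ta" using T_pos times by (simp add: divide_less_eq)
  ultimately show ?thesis using t by blast
qed

lemma mild_year:
  assumes m: "mild u" and b: "bm M (u 0)"
  shows "u T x = yr.Op T hh (u 0) x"
proof -
  have "u T x = HM T 0 (u 0) x + integral {0..T} (\<lambda>s. HM T s (Rp s (u (s - tau s))) x)"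
    by (rule mildD[OF m]) (use T_pos in simp)
  also have "integral {0..T} (\<lambda>s. HM T s (Rp s (u (s - tau s))) x)
      = integral {0..T} (\<lambda>s. HM T s (Rp s (HM (s - tau s) 0 (u 0))) x)"
    by (rule integral_cong) (use integrand_first_year[OF mild_early[OF m]] in auto)
  finally show ?thesis using Op_eq_year[OF b, of T x] T_pos by simp
qed

definition phase :: "real \<Rightarrow> real" where "phase t = t - of_int \<lfloor>t / T\<rfloor> * T"

lemma phase_shift: "phase (t + T) = phase t"
proof -
  have "(t + T) / T = t / T + 1" using T_pos by (simp add: add_divide_distrib)
  then have "\<lfloor>(t + T) / T\<rfloor> = \<lfloor>t / T\<rfloor> + 1" by simp
  then show ?thesis unfolding phase_def by (simp add: algebra_simps)
qed

lemma phase_id: "0 \<le> t \<Longrightarrow> t < T \<Longrightarrow> phase t = t"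
proof -
  assume "0 \<le> t" "t < T"
  then have "\<lfloor>t / T\<rfloor> = 0" using T_pos by (simp add: floor_eq_iff)
  then show ?thesis by (simp add: phase_def)
qed

lemma bm_Op: "bm M \<phi> \<Longrightarrow> \<exists>K. bm K (yr.Op t hh \<phi>)"
  using yr.Op_bm[OF nl_hh, of M] bmD(2,3)[of M \<phi> 0] by (meson order_trans)

lemma periodic_mild:
  assumes b: "bm M \<phi>" and w: "\<And>x. yr.Op T hh \<phi> x = \<phi> (x - c * T)"
  defines "U \<equiv> \<lambda>t \<xi>. yr.Op (phase t) hh \<phi> (\<xi> + c * phase t)"
  shows "mild (\<lambda>t x. U t (x - c * t))"
proof -
  define u where "u t x = U t (x - c * t)" for t x
  have u_eq: "u t x = yr.Op (phase t) hh \<phi> (x - c * (t - phase t))" for t x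
    by (simp add: u_def U_def algebra_simps)
  have u_shift: "u (t + T) x = u t (x - c * T)" for t x
    unfolding u_eq phase_shift by (simp add: algebra_simps)
  have u_first: "u t = yr.Op t hh \<phi>" if "0 \<le> t" "t < T" for t
    by (rule ext) (simp add: u_eq phase_id[OF that])
  have u0: "u 0 = \<phi>"
  proof -
    have "yr.Op 0 hh \<phi> = HM 0 0 \<phi>" by (rule Op_early[OF b]) (use times in auto)
    then show ?thesis using u_first[of 0] T_pos by (simp add: HM_start[OF b] a0_def A0_def)
  qed
  have early: "u r = HM r 0 (u 0)" if "0 \<le> r" "r < ta" for r
    using u_first[of r] Op_early[OF b that] that times u0 by simp
  note first = integrand_first_year[of u, OF early, unfolded u0]
  have main: "\<forall>t x. 0 \<le> t \<longrightarrow> t < real (Suc n) * T \<longrightarrow>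
      (\<lambda>s. HM t s (Rp s (u (s - tau s))) x) integrable_on {0..t} \<and>
      u t x = HM t 0 \<phi> x + integral {0..t} (\<lambda>s. HM t s (Rp s (u (s - tau s))) x)" for n
  proof (induction n)
    case 0
    show ?case
    proof (intro allI impI)
      fix t x :: real assume t: "0 \<le> t" "t < real (Suc 0) * T"
      then have mt: "min t T = t" by simp
      have cg: "HM t s (Rp s (u (s - tau s))) x = HM t s (Rp s (HM (s - tau s) 0 \<phi>)) x" if "s \<in> {0..t}" for s
        using first[of s] that t by simp
      have "(\<lambda>s. HM t s (Rp s (u (s - tau s))) x) integrable_on {0..t}"
        using integrable_cong[of "{0..t}", OF cg] has_integral_integrable[OF year_has_integral[OF b t(1), of x]] mt by simp
      moreover have "u t x = HM t 0 \<phi> x + integral {0..t} (\<lambda>s. HM t s (Rp s (u (s - tau s))) x)"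
        using Op_eq_year[OF b t(1), of x] integral_cong[of "{0..t}", OF cg] u_first[of t] t mt by simp
      ultimately show "(\<lambda>s. HM t s (Rp s (u (s - tau s))) x) integrable_on {0..t} \<and>
        u t x = HM t 0 \<phi> x + integral {0..t} (\<lambda>s. HM t s (Rp s (u (s - tau s))) x)" by simp
    qed
  next
    case (Suc n)
    show ?case
    proof (intro allI impI)
      fix t x :: real assume t: "0 \<le> t" "t < real (Suc (Suc n)) * T"
      let ?F = "\<lambda>t x s. HM t s (Rp s (u (s - tau s))) x"
      show "?F t x integrable_on {0..t} \<and> u t x = HM t 0 \<phi> x + integral {0..t} (?F t x)"
      proof (cases "t < T")
        case True
        moreover have "1 * T \<le> real (Suc n) * T" using T_pos by (intro mult_right_mono) auto
        ultimately have "t < real (Suc n) * T" by linarith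
        then show ?thesis using Suc t by blast
      next
        case False
        define t' where "t' = t - T"
        have t': "0 \<le> t'" "t' < real (Suc n) * T" "t = t' + T" using False t by (auto simp: t'_def algebra_simps)
        have IH: "?F t' (x - c * T) integrable_on {0..t'}"
          "u t' (x - c * T) = HM t' 0 \<phi> (x - c * T) + integral {0..t'} (?F t' (x - c * T))"
          using Suc t' by blast+
        have sh: "?F t x (s + T) = ?F t' (x - c * T) s" for s
        proof -
          have "u (s + T - tau (s + T)) = (\<lambda>y. u (s - tau s) (y - c * T))"
          proof -
            have "s + T - tau (s + T) = (s - tau s) + T" by (simp add: per)
            then show ?thesis by (simp only:) (rule ext, rule u_shift)
          qed
          then have "Rp (s + T) (u (s + T - tau (s + T))) = (\<lambda>y. Rp s (u (s - tau s)) (y - c * T))"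
            by (auto simp: Rp_shift Rp_translate)
          then show ?thesis unfolding t'(3) by (simp add: heatop_shift heatop_translate)
        qed
        have i2: "(?F t x has_integral integral {0..t'} (?F t' (x - c * T))) {T..t}"
        proof -
          have "(?F t x \<circ> (+) T) = ?F t' (x - c * T)" using sh by (auto simp: comp_def add.commute)
          moreover have "(?F t' (x - c * T) has_integral integral {0..t'} (?F t' (x - c * T))) {0..t'}"
            using IH(1) by (rule integrable_integral)
          ultimately have "(?F t x \<circ> (+) T has_integral integral {0..t'} (?F t' (x - c * T))) {0..t'}" by simp
          then show ?thesis
            using has_integral_shift_Icc_real[of "?F t x" T _ 0 t'] t'(3) by simp
        qed
        have mt: "min t T = T" using t' by simp
        have cg: "?F t x s = HM t s (Rp s (HM (s - tau s) 0 \<phi>)) x" if "s \<in> {0..T}" for s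
          using first[of s] that by simp
        have "(?F t x has_integral (\<integral>s. W t s * yr.seas t hh \<phi> s x \<partial>S)) {0..T}"
          using has_integral_cong[of "{0..T}", OF cg] year_has_integral[OF b t(1), of x] mt by simp
        from has_integral_combine[OF _ _ this i2]
        have i: "(?F t x has_integral ((\<integral>s. W t s * yr.seas t hh \<phi> s x \<partial>S) + integral {0..t'} (?F t' (x - c * T)))) {0..t}"
          using T_pos t' by simp
        have "HM t' 0 \<phi> (x - c * T) = HM t T (\<lambda>y. \<phi> (y - c * T)) x"
          using heatop_shift(1)[of t' 0] t'(3) by (simp add: heatop_translate)
        also have "\<dots> = yr.Op t hh \<phi> x" using Op_semigroup[OF b, of t x] t' unfolding w by simp
        finally have "u t x = yr.Op t hh \<phi> x + integral {0..t'} (?F t' (x - c * T))"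
          using IH(2) u_shift[of t' x] t'(3) by simp
        then show ?thesis
          using i unfolding yr.Op_def HM_start[OF b] by (auto simp: has_integral_iff)
      qed
    qed
  qed
  have "mild u"
    unfolding mild_solution_def
  proof (intro conjI allI impI)
    fix t x :: real assume t: "0 \<le> t"
    obtain K where "bm K (yr.Op (phase t) hh \<phi>)" using bm_Op[OF b] by blast
    then have bu: "bm K (u t)" unfolding u_eq[abs_def] using bm_translate[of K _ "- c * (t - phase t)"] by simp
    show "u t \<in> borel_measurable lborel" using bmD(1)[OF bu] by simp
    show "bounded (range (u t))" using bmD(4)[OF bu] by (auto simp: bounded_real)
    show "0 \<le> u t x" by (rule bmD(2)[OF bu])
    obtain n :: nat where "t / T < real n" using reals_Archimedean2 by blast
    then have "t < real n * T" using T_pos by (simp add: divide_less_eq)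
    then have "t < real (Suc n) * T" using T_pos by (simp add: algebra_simps)
    then show "u t x = HM t 0 (u 0) x + integral {0..t} (\<lambda>s. HM t s (Rp s (u (s - tau s))) x)"
      using main t u0 by blast
  qed
  then show ?thesis by (simp add: u_def[abs_def])
qed

lemma wave_setting_T: "wave_setting S (a0 T) (A0 T) (W T) (A T) B C E (Wm T) (Am T) hh ustar (hd 0)"
proof (unfold_locales)
  show "continuous_on UNIV hh" by (rule hh_cont)
  show "0 \<le> hh z" if "0 \<le> z" for z using h_nonneg that by (simp add: hh_eq)
  show "mono_on {0..ustar} hh" using h_mono_ustar by (auto simp: mono_on_def hh_eq)
  show "hh z \<le> hd 0 * z" if "0 \<le> z" for z using that by (rule hh_le)
  show "\<exists>z0>0. \<forall>z. 0 \<le> z \<longrightarrow> z \<le> z0 \<longrightarrow> (1 - e) * hd 0 * z \<le> hh z" if "0 < e" for e using that by (rule hh_ge)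
  show "0 < hd 0" by (rule hd0_pos)
  show "0 < ustar" by (rule ustar_pos)
  show "yr.Op T hh (\<lambda>_. ustar) 0 = ustar"
    using Qmap_eq[OF bm_const[of ustar ustar], of 0] ustar_fix ustar_pos by simp
  show "yr.Op T hh (\<lambda>_. v) 0 \<noteq> v" if v: "0 < v" "v < ustar" for v
  proof
    assume a: "yr.Op T hh (\<lambda>_. v) 0 = v"
    have "Qmap DM dM DI dI tau p h T ta tb (\<lambda>_. v) = (\<lambda>_. v)"
    proof
      fix x
      have "Qmap DM dM DI dI tau p h T ta tb (\<lambda>_. v) x = yr.Op T hh (\<lambda>_. v) x"
        by (rule Qmap_eq[OF bm_const[of v v]]) (use v in auto)
      also have "\<dots> = yr.Op T hh (\<lambda>_. v) 0" by (simp add: yr.Op_const)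
      finally show "Qmap DM dM DI dI tau p h T ta tb (\<lambda>_. v) x = v" using a by simp
    qed
    then show False using ustar_min v by blast
  qed
  show "1 < yr.Kern T (hd 0) 0" by (rule Kern0)
qed

theorem no_wave:
  assumes c: "0 < c" "c < cstar / T" and ub: "0 < ubar 0"
    and tw: "periodic_tw DM dM DI dI tau p h T ta tb ubar c U"
  shows False
proof -
  define u where "u t x = U t (x - c * t)" for t x
  have m: "mild u" and per_U: "\<And>t \<xi>. U (t + T) \<xi> = U t \<xi>"
    and lims: "(U 0 \<longlongrightarrow> ubar 0) at_bot" "(U 0 \<longlongrightarrow> 0) at_top"
    using tw unfolding periodic_tw_def u_def[abs_def] by auto
  have u0: "u 0 = U 0" by (rule ext) (simp add: u_def)
  have "U 0 \<in> borel_measurable lborel" "bounded (range (U 0))" "\<And>x. 0 \<le> U 0 x"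
    using m u0 unfolding mild_solution_def by auto
  moreover obtain M where "\<forall>y\<in>range (U 0). \<bar>y\<bar> \<le> M" using calculation(2) unfolding bounded_real by blast
  ultimately have b: "bm M (U 0)" unfolding bm_def by (auto simp: abs_le_iff)
  have wave: "yr.Op T hh (U 0) x = U 0 (x - c * T)" for x
    using mild_year[OF m, of M x] b u0 per_U[of 0] by (simp add: u_def)
  show False
  proof (rule yr.no_slow_wave[of "c * T" "hd 0" hh M "U 0" T "ubar 0"])
    show "0 < c * T" using c T_pos by simp
    show "0 < hh z" if "0 < z" for z using h_pos[OF that] that by (simp add: hh_eq)
    show "exp (\<mu> * (c * T)) < yr.Kern T (hd 0) \<mu>" if "0 \<le> \<mu>" for \<mu>
    proof (cases "\<mu> = 0")
      case True then show ?thesis using Kern0 by simp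
    next
      case False
      then have \<mu>: "0 < \<mu>" using that by simp
      have "c * T < ln (yr.Kern T (hd 0) \<mu>) / \<mu>"
        using c(2) cstar_le[OF \<mu>] unfolding pos_less_divide_eq[OF T_pos] by linarith
      then have "\<mu> * (c * T) < ln (yr.Kern T (hd 0) \<mu>)" unfolding pos_less_divide_eq[OF \<mu>] by (simp only: mult.commute)
      then have "exp (\<mu> * (c * T)) < exp (ln (yr.Kern T (hd 0) \<mu>))" by simp
      then show ?thesis using Kern_gt1[of \<mu>] by simp
    qed
  qed (use hh_cont hh_ge hd0_pos b wave lims ub spread_pos in \<open>auto simp: hh_eq h_zero\<close>)
qed

theorem ex_wave:
  assumes c: "cstar / T \<le> c" and us: "mild (\<lambda>t x. ubar t)" and u0: "ubar 0 = ustar"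
  shows "\<exists>U. periodic_tw DM dM DI dI tau p h T ta tb ubar c U
    \<and> (\<forall>t \<xi>. continuous (at_left \<xi>) (U t)) \<and> (\<forall>t. antimono (U t))"
proof -
  interpret w: wave_setting S "a0 T" "A0 T" "W T" "A T" B C E "Wm T" "Am T" hh ustar "hd 0"
    by (rule wave_setting_T)
  define cs where "cs n = c * T + 1 / (real n + 1)" for n
  have "cs \<longlonglongrightarrow> c * T" unfolding cs_def by real_asymp
  moreover have "\<exists>\<mu>>0. yr.Kern T (hd 0) \<mu> \<le> exp (\<mu> * cs n)" for n
  proof -
    have "cstar \<le> c * T" using c T_pos by (simp add: divide_le_eq)
    moreover have "0 < 1 / (real n + 1)" by simp
    ultimately have "cstar < cs n" unfolding cs_def by linarith
    then have "\<exists>x\<in>(\<lambda>\<mu>. ln (yr.Kern T (hd 0) \<mu>) / \<mu>) ` {0<..}. x < cs n"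
      unfolding cstar_eq by (intro cInf_lessD) auto
    then obtain \<mu> where \<mu>: "0 < \<mu>" "ln (yr.Kern T (hd 0) \<mu>) / \<mu> < cs n" by auto
    have K0: "0 < yr.Kern T (hd 0) \<mu>" using Kern_gt1[of \<mu>] by linarith
    have "ln (yr.Kern T (hd 0) \<mu>) \<le> \<mu> * cs n" using \<mu> by (simp add: divide_less_eq mult.commute)
    then have "exp (ln (yr.Kern T (hd 0) \<mu>)) \<le> exp (\<mu> * cs n)" by simp
    then show ?thesis using K0 \<mu>(1) by auto
  qed
  ultimately obtain b where b: "w.profile b" "\<And>s. yr.Op T hh b (s + c * T) = b s" "(b \<longlongrightarrow> ustar) at_bot" "(b \<longlongrightarrow> 0) at_top"
    using w.wave_exists[of cs "c * T"] by blast
  have bb: "bm ustar b" and am: "antimono b" and lc: "\<And>x. (b \<longlongrightarrow> b x) (at_left x)"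
    using b(1) by (auto simp: w.profile_def)
  have us0: "0 \<le> ustar" using ustar_pos by simp
  note nlh = nl_hh[OF us0]
  define U where "U = (\<lambda>t \<xi>. yr.Op (phase t) hh b (\<xi> + c * phase t))"
  have mU: "mild (\<lambda>t x. U t (x - c * t))"
    unfolding U_def by (rule periodic_mild[OF bb]) (use b(2)[of "x - c * T" for x] in simp)
  have ubar_eq: "ubar t = yr.Op (phase t) hh (\<lambda>_. ustar) 0" if "0 \<le> t" for t
  proof -
    have bc: "bm ustar (\<lambda>_. ustar)" by (rule bm_const[OF us0 order_refl])
    have "mild (\<lambda>t x. yr.Op (phase t) hh (\<lambda>_. ustar) (x - 0 * t + 0 * phase t))"
      by (rule periodic_mild[OF bc]) (rule trans[OF w.Op_f_const w.fix_u])
    then have "mild (\<lambda>t x. yr.Op (phase t) hh (\<lambda>_. ustar) 0)" by (simp add: yr.Op_const)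
    moreover have "(\<lambda>x::real. ubar 0) = (\<lambda>x. yr.Op (phase 0) hh (\<lambda>_. ustar) 0)"
    proof -
      have "yr.Op 0 hh (\<lambda>_. ustar) = HM 0 0 (\<lambda>_. ustar)" by (rule Op_early[OF bc]) (use times in auto)
      then have "yr.Op 0 hh (\<lambda>_. ustar) 0 = ustar" by (simp add: HM_start[OF bc] a0_def)
      then show ?thesis using phase_id[of 0] T_pos u0 by simp
    qed
    ultimately have "(\<lambda>x::real. ubar t) = (\<lambda>x. yr.Op (phase t) hh (\<lambda>_. ustar) 0)"
      using mild_unique[OF us _ _ that] by blast
    then show ?thesis by (rule fun_cong)
  qed
  have Ubot: "(U t \<longlongrightarrow> yr.Op (phase t) hh (\<lambda>_. ustar) 0) at_bot" for t
  proof -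
    have "filterlim (\<lambda>\<xi>. \<xi> + c * phase t) at_bot at_bot" by real_asymp
    then show ?thesis unfolding U_def
      by (rule filterlim_compose[OF yr.Op_tendsto_at_bot[OF nlh bb b(3) us0 order_refl]])
  qed
  have Utop: "(U t \<longlongrightarrow> 0) at_top" for t
  proof -
    have "filterlim (\<lambda>\<xi>. \<xi> + c * phase t) at_top at_top" by real_asymp
    then have "(U t \<longlongrightarrow> yr.Op (phase t) hh (\<lambda>_. 0) 0) at_top" unfolding U_def
      by (rule filterlim_compose[OF yr.Op_tendsto_at_top[OF nlh bb b(4) order_refl us0]])
    then show ?thesis by (simp add: yr.Op_const hh_eq h_zero)
  qed
  have Ulc: "continuous (at_left \<xi>) (U t)" for t \<xi>
    unfolding continuous_within U_def
    by (rule filterlim_compose[OF yr.Op_left_cont[OF nlh bb lc] at_left_translate])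
  have "antimono (yr.Op (phase t) hh b)" for t
    by (rule yr.Op_antimono[OF nlh w.f_mono bb am])
  then have Uam: "antimono (U t)" for t unfolding U_def antimono_def by simp
  have Uper: "U (t + T) \<xi> = U t \<xi>" for t \<xi> by (simp add: U_def phase_shift)
  have "periodic_tw DM dM DI dI tau p h T ta tb ubar c U"
    unfolding periodic_tw_def using mU Uper Ubot Utop ubar_eq by auto
  then show ?thesis using Ulc Uam by blast
qed

end

theorem theorem5p1:
  fixes T alpha beta ta tb zs ustar :: real
    and DM DI dM dI tau p h hd ubar :: "real \<Rightarrow> real"
  assumes T_pos: "T > 0"
    and coef_sign: "\<forall>t. DM t \<ge> 0 \<and> DI t \<ge> 0 \<and> dM t > 0 \<and> dI t > 0 \<and> tau t > 0 \<and> p t \<ge> 0"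
    and coef_C1: "DM C1_differentiable_on UNIV" "DI C1_differentiable_on UNIV"
      "dM C1_differentiable_on UNIV" "dI C1_differentiable_on UNIV"
      "tau C1_differentiable_on UNIV" "p C1_differentiable_on UNIV"
    and coef_per: "\<forall>t. DM (t + T) = DM t \<and> DI (t + T) = DI t \<and> dM (t + T) = dM t
      \<and> dI (t + T) = dI t \<and> tau (t + T) = tau t \<and> p (t + T) = p t"
    and h_C1: "continuous_on {0..} hd" "\<forall>z\<ge>0. (h has_real_derivative hd z) (at z within {0..})"
    and h_nonneg: "\<forall>z\<ge>0. h z \<ge> 0"
    and times: "0 < alpha" "alpha \<le> beta" "beta < ta" "ta \<le> tb" "tb < T"
    and ta_def: "ta - tau ta = alpha" and tb_def: "tb - tau tb = beta"
    and p_zero: "\<forall>t \<in> {0..alpha} \<union> {beta..T}. p t = 0"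
    and tau_deriv: "\<forall>t. deriv tau t < 1"
    and h_zero: "h 0 = 0"
    and h_lim: "(h \<longlongrightarrow> 0) at_top"
    and zs_pos: "0 < zs"
    and h_incr: "strict_mono_on {0..<zs} h"
    and h_decr: "\<forall>x y. zs \<le> x \<longrightarrow> x < y \<longrightarrow> h y < h x"
    and h_subhom: "\<forall>lam z. 0 < lam \<longrightarrow> lam < 1 \<longrightarrow> 0 \<le> z \<longrightarrow> h (lam * z) \<ge> lam * h z"
    and L_gt1: "Lconst dM dI tau p (hd 0) T ta tb > 1"
    and ustar_pos: "0 < ustar"
    and ustar_fix: "Qmap DM dM DI dI tau p h T ta tb (\<lambda>_. ustar) = (\<lambda>_. ustar)"
    and ustar_min: "\<forall>v. 0 < v \<longrightarrow> v < ustar \<longrightarrow> Qmap DM dM DI dI tau p h T ta tb (\<lambda>_. v) \<noteq> (\<lambda>_. v)"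
    and h_mono_ustar: "mono_on {0..ustar} h"
    and cstar_pos: "spreading_speed DM dM DI dI tau p (hd 0) T ta tb > 0"
    and ubar_sol: "mild_solution DM dM DI dI tau p h T ta tb (\<lambda>t x. ubar t)"
    and ubar_init: "ubar 0 = ustar"
  shows "(\<forall>c. 0 < c \<and> c < spreading_speed DM dM DI dI tau p (hd 0) T ta tb / T \<longrightarrow>
            \<not> (\<exists>U. periodic_tw DM dM DI dI tau p h T ta tb ubar c U))
       \<and> (\<forall>c. c \<ge> spreading_speed DM dM DI dI tau p (hd 0) T ta tb / T \<longrightarrow>
            (\<exists>U. periodic_tw DM dM DI dI tau p h T ta tb ubar c U
                 \<and> (\<forall>t \<xi>. continuous (at_left \<xi>) (U t))
                 \<and> (\<forall>t. antimono (U t))))"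
proof -
  interpret model T alpha beta ta tb zs ustar DM DI dM dI tau p h hd
    by (rule model.intro) (fact assms)+
  show ?thesis
    using no_wave[of _ ubar] ex_wave[OF _ ubar_sol ubar_init] ubar_init ustar_pos by metis
qed

end
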